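(* The set $\{s_{(\mu|\lambda)}(x) : (\mu|\lambda)\in\Sigma\}$ of almost symmetric Schur functions is a homogeneous $\mathbb{Q}$-basis of $\mathscr{P}_{as,\mathbb{Q}}^+$ (that is, each $s_{(\mu|\lambda)}$ is homogeneous, and together they form a basis of this $\mathbb{Q}$-vector space).
   Context: **Combinatorics.** A composition is a finite tuple $\mu=(\mu_1,\ldots,\mu_n)$ of non-negative integers (the empty one $\emptyset$ is allowed); $\ell(\mu)=n$. It is reduced if $\mu=\emptyset$ or $\mu_{\ell(\mu)}\neq 0$. A partition is a composition with $\lambda_1\ge\dots\ge\lambda_n\ge1$ ($\emptyset$ allowed). $\Sigma$ is the set of pairs $(\mu|\lambda)$ with $\mu$ a reduced composition and $\lambda$ a partition. $*$ denotes concatenation. **Almost symmetric functions.** $\mathscr{P}_n^+=\mathbb{Q}(q,t)[x_1,\ldots,x_n]$; $\mathscr{P}(k)^+=\mathbb{Q}(q,t)[x_1,\ldots,x_k]\otimes\Lambda[\mathfrak{X}_k]$, where $\Lambda[\mathfrak{X}_k]$ is the ring of symmetric functions in $x_{k+1},x_{k+2},\ldots$; $\mathscr{P}_{as}^+=\bigcup_{k\ge0}\mathscr{P}(k)^+$. With $X=x_1+x_2+\cdots$ and $m_\lambda$ the monomial symmetric functions, $\{x^\mu m_\lambda[X]:(\mu|\lambda)\in\Sigma\}$ is a $\mathbb{Q}(q,t)$-basis of $\mathscr{P}_{as}^+$. $\mathscr{P}_{as,\mathbb{Q}}^+$ is the set of finite $\mathbb{Q}$-linear combinations of the $x^\mu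 m_\lambda[X]$, $(\mu|\lambda)\in\Sigma$. **Key polynomials.** $\xi_i(f)=\frac{x_if-x_{i+1}s_i(f)}{x_i-x_{i+1}}$, where $s_i$ swaps $x_i,x_{i+1}$. The key polynomials $\mathcal{K}_\alpha(x_1,\ldots,x_n)$, $\alpha\in\mathbb{Z}_{\ge0}^n$, are determined by: $\mathcal{K}_\alpha=x^\alpha$ if $\alpha_1\ge\dots\ge\alpha_n$; and $\mathcal{K}_{s_i(\alpha)}=\xi_i(\mathcal{K}_\alpha)$ if $\alpha_i>\alpha_{i+1}$ ($s_i(\alpha)$ swaps entries $i,i+1$). One has $\mathcal{K}_{\alpha*0}=\mathcal{K}_\alpha$. **Almost symmetric Schur functions.** Let $\mathfrak{S}_{(1^k,n-k)}\subset\mathfrak{S}_n$ be the permutations fixing $1,\ldots,k$. For $0\le k\le n$, $$W_k^{(n)}(f)=\sum_{\sigma\in\mathfrak{S}_{(1^k,n-k)}}\sigma\Big(f\prod_{k+1\le i<j\le n}\frac1{1-x_j/x_i}\Big),\qquad f\in\mathscr{P}_n^+,$$ with $\sigma$ permuting variables. These operators are compatible with setting $x_{n+1}=0$, and $W_k=\lim_nW_k^{(n)}$ is the operator on $\mathscr{P}_{as}^+$ such that $W_k(f)(x_1,\ldots,x_n,0,0,\ldots)=W_k^{(n)}(f(x_1,\ldots,x_n,0,0,\ldots))$ for all $n\ge k$. The functions $s_{(\mu|\lambda)}$, $(\mu|\lambda)\in\Sigma$, are defined recursively by $s_{(\mu|\emptyset)}=\mathcal{K}_\mu$, and, if $\mu_r\ge\lambda_1$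 (and $(\mu_1,\ldots,\mu_{r-1})$ is reduced), $s_{(\mu_1,\ldots,\mu_{r-1}|\mu_r,\lambda_1,\ldots,\lambda_\ell)}=W_{r-1}\big(s_{(\mu_1,\ldots,\mu_r|\lambda_1,\ldots,\lambda_\ell)}\big)$. *)

theory Defs
  imports
    "HOL-Library.Poly_Mapping"
    "HOL-Library.Multiset"
    "HOL-Combinatorics.Permutations"
    "HOL-Computational_Algebra.Polynomial_Factorial"
begin

text \<open>
  Variables are indexed from 0: the variable usually called \<open>x\<^sub>i\<close> is the one with index \<open>i - 1\<close>,
  so \<open>x\<^sub>1, \<dots>, x\<^sub>n\<close> have the indices in \<open>{..<n}\<close> and \<open>x\<^sub>k\<^sub>+\<^sub>1, x\<^sub>k\<^sub>+\<^sub>2, \<dots>\<close> those in \<open>{k..}\<close>.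
  A monomial is its exponent vector.
\<close>

type_synonym monom = "nat \<Rightarrow>\<^sub>0 nat"

type_synonym 'a mpoly = "monom \<Rightarrow>\<^sub>0 'a"

text \<open>The coefficient field \<open>\<rat>(q,t)\<close>.\<close>

type_synonym qt = "rat poly poly fract"

definition rat_qt :: "rat \<Rightarrow> qt" where
  "rat_qt c = to_fract [:[:c:]:]"

definition mdeg :: "monom \<Rightarrow> nat" where
  "mdeg m = (\<Sum>i\<in>Poly_Mapping.keys m. Poly_Mapping.lookup m i)"

definition polys :: "nat \<Rightarrow> 'a::zero mpoly set" where
  "polys n = {p. \<forall>m\<in>Poly_Mapping.keys p. Poly_Mapping.keys m \<subseteq> {..<n}}"

definition mon :: "nat list \<Rightarrow> 'a::zero_neq_one mpoly" where
  "mon \<alpha> = Poly_Mapping.single (Poly_Mapping.nth \<alpha>) 1"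

definition var :: "nat \<Rightarrow> 'a::zero_neq_one mpoly" where
  "var i = Poly_Mapping.single (Poly_Mapping.single i 1) 1"

text \<open>
  The action \<open>x\<^sub>i \<mapsto> x\<^bsub>\<sigma> i\<^esub>\<close> of a permutation: the coefficient of \<open>\<sigma> p\<close> at \<open>m\<close> is the coefficient
  of \<open>p\<close> at \<open>m \<circ> \<sigma>\<close>.
\<close>

definition perm_vars :: "(nat \<Rightarrow> nat) \<Rightarrow> 'a::zero mpoly \<Rightarrow> 'a mpoly" where
  "perm_vars \<sigma> p = Poly_Mapping.map_key (Poly_Mapping.map_key \<sigma>) p"


section \<open>Formal power series in infinitely many variables\<close>

typedef 'a series = "UNIV :: (monom \<Rightarrow> 'a) set"
  morphisms scoeff Abs_series ..

setup_lifting type_definition_series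

instantiation series :: (ab_group_add) ab_group_add
begin
lift_definition zero_series :: "'a series" is "\<lambda>_. 0" .
lift_definition plus_series :: "'a series \<Rightarrow> 'a series \<Rightarrow> 'a series" is "\<lambda>f g m. f m + g m" .
lift_definition minus_series :: "'a series \<Rightarrow> 'a series \<Rightarrow> 'a series" is "\<lambda>f g m. f m - g m" .
lift_definition uminus_series :: "'a series \<Rightarrow> 'a series" is "\<lambda>f m. - f m" .
instance by standard (transfer; simp add: fun_eq_iff algebra_simps)+
end

instantiation series :: (comm_semiring_0) times
begin
lift_definition times_series :: "'a series \<Rightarrow> 'a series \<Rightarrow> 'a series"
  is "\<lambda>f g m. \<Sum>(a, b)\<in>{(a, b). a + b = m}. f a * g b" .
instance ..
end

lift_definition scale :: "'a::times \<Rightarrow> 'a series \<Rightarrow> 'a series" is "\<lambda>c f m. c * f m" .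

definition scale_rat :: "rat \<Rightarrow> qt series \<Rightarrow> qt series" where
  "scale_rat c f = scale (rat_qt c) f"

lemma rat_qt_simps:
  "rat_qt (a + b) = rat_qt a + rat_qt b" "rat_qt (a * b) = rat_qt a * rat_qt b" "rat_qt 1 = 1"
  by (simp_all add: rat_qt_def to_fract_def One_fract_def one_pCons)

global_interpretation series: vector_space "scale :: 'a::field \<Rightarrow> 'a series \<Rightarrow> 'a series"
  by standard (transfer; simp add: fun_eq_iff algebra_simps)+

global_interpretation series_Q: vector_space scale_rat
  by standard (simp_all add: scale_rat_def rat_qt_simps series.scale_right_distrib
      series.scale_left_distrib)

definition homogeneous :: "'a::zero series \<Rightarrow> bool" where
  "homogeneous f \<longleftrightarrow> (\<exists>d. \<forall>m. scoeff f m \<noteq> 0 \<longrightarrow> mdeg m = d)"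

definition series_of_poly :: "'a::zero mpoly \<Rightarrow> 'a series" where
  "series_of_poly p = Abs_series (Poly_Mapping.lookup p)"

text \<open>
  \<open>f(x\<^sub>1, \<dots>, x\<^sub>n, 0, 0, \<dots>)\<close>. This is meaningful only if the result is a polynomial, for instance
  if \<open>f\<close> has bounded degree; it is used only on almost symmetric functions.
\<close>

definition trunc :: "nat \<Rightarrow> 'a::zero series \<Rightarrow> 'a mpoly" where
  "trunc n f =
     Poly_Mapping.Abs_poly_mapping (\<lambda>m. if Poly_Mapping.keys m \<subseteq> {..<n} then scoeff f m else 0)"


section \<open>Almost symmetric functions\<close>

definition sym_funs :: "nat \<Rightarrow> 'a::zero series set" where
  "sym_funs k = {f. (\<exists>d. \<forall>m. scoeff f m \<noteq> 0 \<longrightarrow> mdeg m \<le> d)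
     \<and> (\<forall>m. scoeff f m \<noteq> 0 \<longrightarrow> Poly_Mapping.keys m \<subseteq> {k..})
     \<and> (\<forall>\<sigma>. \<sigma> permutes {k..} \<longrightarrow> (\<forall>m. scoeff f (Poly_Mapping.map_key \<sigma> m) = scoeff f m))}"

text \<open>
  The tensor product of the polynomials in \<open>x\<^sub>1, \<dots>, x\<^sub>k\<close> with the symmetric functions in
  \<open>x\<^sub>k\<^sub>+\<^sub>1, x\<^sub>k\<^sub>+\<^sub>2, \<dots>\<close> is realised inside the power series, as the span of the products.
\<close>

definition almost_sym :: "nat \<Rightarrow> 'a::field series set" where
  "almost_sym k = series.span {series_of_poly p * g | p g. p \<in> polys k \<and> g \<in> sym_funs k}"

definition P_as :: "'a::field series set" where
  "P_as = (\<Union>k. almost_sym k)"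

text \<open>
  \<open>m\<^sub>\<nu>[X]\<close> is the sum of the distinct monomials whose nonzero exponents, sorted, are \<open>\<nu>\<close>.
\<close>

lift_definition monomial_sym :: "nat list \<Rightarrow> 'a::zero_neq_one series" is
  "\<lambda>\<nu> m. if image_mset (Poly_Mapping.lookup m) (mset_set (Poly_Mapping.keys m)) = mset \<nu>
          then 1 else 0" .

definition reduced :: "nat list \<Rightarrow> bool" where
  "reduced \<mu> \<longleftrightarrow> \<mu> = [] \<or> last \<mu> \<noteq> 0"

definition is_partition :: "nat list \<Rightarrow> bool" where
  "is_partition \<nu> \<longleftrightarrow> sorted_wrt (\<ge>) \<nu> \<and> (\<forall>a\<in>set \<nu>. a \<ge> 1)"

definition Sig :: "(nat list \<times> nat list) set" where
  "Sig = {(\<mu>, \<nu>). reduced \<mu> \<and> is_partition \<nu>}"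

definition P_as_Q :: "qt series set" where
  "P_as_Q = series_Q.span ((\<lambda>(\<mu>, \<nu>). series_of_poly (mon \<mu>) * monomial_sym \<nu>) ` Sig)"


section \<open>Key polynomials\<close>

text \<open>The quotient is formed among rational functions; it is in fact a polynomial.\<close>

definition xi :: "nat \<Rightarrow> 'a::field mpoly \<Rightarrow> 'a mpoly" where
  "xi i f = (THE g. to_fract g =
     to_fract (var i * f - var (Suc i) * perm_vars (transpose i (Suc i)) f)
       / to_fract (var i - var (Suc i)))"

definition swap_entries :: "nat \<Rightarrow> nat list \<Rightarrow> nat list" where
  "swap_entries i \<alpha> = \<alpha>[i := \<alpha> ! Suc i, Suc i := \<alpha> ! i]"

inductive is_key :: "nat list \<Rightarrow> 'a::field mpoly \<Rightarrow> bool" where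
  "sorted_wrt (\<ge>) \<alpha> \<Longrightarrow> is_key \<alpha> (mon \<alpha>)"
| "is_key \<alpha> p \<Longrightarrow> Suc i < length \<alpha> \<Longrightarrow> \<alpha> ! i > \<alpha> ! Suc i \<Longrightarrow> is_key (swap_entries i \<alpha>) (xi i p)"

definition key :: "nat list \<Rightarrow> 'a::field mpoly" where
  "key \<alpha> = (THE p. is_key \<alpha> p)"


section \<open>Almost symmetric Schur functions\<close>

text \<open>
  Each \<open>\<sigma>\<close> has been distributed over the product. The sum is formed among rational functions;
  it is in fact a polynomial.
\<close>

definition W_fin :: "nat \<Rightarrow> nat \<Rightarrow> 'a::field mpoly \<Rightarrow> 'a mpoly" where
  "W_fin k n f = (THE g. to_fract g =
     (\<Sum>\<sigma> | \<sigma> permutes {k..<n}. to_fract (perm_vars \<sigma> f) *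
        (\<Prod>i\<in>{k..<n}. \<Prod>j\<in>{i<..<n}. 1 / (1 - to_fract (var (\<sigma> j)) / to_fract (var (\<sigma> i))))))"

definition W :: "nat \<Rightarrow> 'a::field series \<Rightarrow> 'a series" where
  "W k f = (THE g. g \<in> P_as \<and> (\<forall>n\<ge>k. trunc n g = W_fin k n (trunc n f)))"

text \<open>
  Since \<open>\<mu>\<close> has length \<open>r - 1\<close> and the first part \<open>a\<close> of the partition plays the role of
  \<open>\<mu>\<^sub>r\<close>, the operator is \<open>W\<^bsub>r - 1\<^esub>\<close>. For pairs in \<open>Sig\<close> all recursive calls stay in \<open>Sig\<close>.
\<close>

fun as_schur :: "nat list \<Rightarrow> nat list \<Rightarrow> 'a::field series" where
  "as_schur \<mu> [] = series_of_poly (key \<mu>)"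
| "as_schur \<mu> (a # \<nu>) = W (length \<mu>) (as_schur (\<mu> @ [a]) \<nu>)"

end

theory Submission
  imports Defs
begin

text \<open>
  In finitely many variables every almost symmetric Schur function is a single key polynomial. Let
  \<open>\<alpha>\<^sub>n = (\<mu>, 0, \<dots>, 0, \<nu>\<^sub>l, \<dots>, \<nu>\<^sub>1)\<close> be the exponent vector of length \<open>n\<close> belonging to \<open>(\<mu>|\<nu>)\<close>. Then
  \<open>s\<^bsub>(\<mu>|\<nu>)\<^esub>(x\<^sub>1, \<dots>, x\<^sub>n) = K\<close>, the key polynomial of \<open>\<alpha>\<^sub>n\<close>, for all large \<open>n\<close>; this is \<open>as_schur_eq\<close>, with the limit
  of the key polynomials called \<open>schur_lim\<close>. It rests on three facts.

  \<^item> The Demazure operators \<open>\<xi>\<^sub>i\<close> satisfy the braid relations, so key polynomials are well defined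
    (\<open>is_key_monom_unique\<close>), and \<open>\<xi>\<^sub>i\<close> fixes the key polynomial of an exponent vector that does not
    descend at \<open>i\<close> (\<open>xi_keyp_le\<close>).
  \<^item> The symmetrizer \<open>W\<^sub>k\<^sup>(\<^sup>n\<^sup>)\<close> absorbs every \<open>\<xi>\<^sub>i\<close> that acts on the variables it symmetrizes
    (\<open>weyl_sym_xi\<close>) and fixes the symmetric polynomials (\<open>weyl_sym_symmetric\<close>). Hence \<open>W\<^sub>k\<^sup>(\<^sup>n\<^sup>)\<close> maps \<open>f\<close> to \<open>g\<close> as soon as some
    word in the \<open>\<xi>\<^sub>i\<close> maps \<open>f\<close> to a symmetric \<open>g\<close> (\<open>W_fin_chain\<close>), and sorting the exponent vector of \<open>s\<^bsub>(\<mu>,a|\<nu>)\<^esub>\<close> by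
    such a word gives that of \<open>s\<^bsub>(\<mu>|a,\<nu>)\<^esub>\<close> (\<open>W_schur_lim\<close>).
  \<^item> Setting the last variable to zero turns the last operator \<open>\<xi>\<^sub>i\<close> into the identity
    (\<open>res_xi_last\<close>); this makes the key polynomials of the \<open>\<alpha>\<^sub>n\<close> compatible and the limit exist (\<open>res_keyp_alpha_Suc\<close>).

  Key polynomials are homogeneous with integer coefficients, and the key polynomial of \<open>\<alpha>\<close> is \<open>x\<^sup>\<alpha>\<close> plus
  monomials whose exponent vectors either have a smaller sum of squares or have the same one and precede \<open>\<alpha>\<close> in
  a Bruhat order (\<open>is_key_monom_triangular\<close>). Since \<open>\<alpha>\<^sub>n\<close> determines \<open>(\<mu>|\<nu>)\<close> for large \<open>n\<close>, independence and
  injectivity follow from the leading monomials.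

  For the span both sides are compared with the series of bounded degree with rational
  coefficients that are symmetric in all variables from some index on. The products
  \<open>x\<^sup>\<mu> m\<^sub>\<nu>[X]\<close> span them by induction on the degree in the symmetric variables
  (\<open>VQ_tail_induct\<close>). The functions \<open>schur_lim\<close> do as well: in enough variables an exponent vector of
  such a series that is maximal in the above order has to ascend in the symmetric variables, which
  makes it an \<open>\<alpha>\<^sub>n\<close>, and a multiple of the corresponding key polynomial removes it (\<open>VQ_rank_induct\<close>).
\<close>

section \<open>Polynomials, monomials and permutations of the variables\<close>

abbreviation adj :: "nat \<Rightarrow> nat \<Rightarrow> nat" where
  "adj i \<equiv> transpose i (Suc i)"

definition sw :: "nat \<Rightarrow> monom \<Rightarrow> monom" where
  "sw i m = Poly_Mapping.map_key (adj i) m"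

lemma lookup_map_key: "bij \<sigma> \<Longrightarrow> Poly_Mapping.lookup (Poly_Mapping.map_key \<sigma> m) j = Poly_Mapping.lookup m (\<sigma> j)"
  by (simp add: map_key.rep_eq bij_is_inj)

lemma map_key_comp: "bij \<sigma> \<Longrightarrow> bij \<tau> \<Longrightarrow>
    Poly_Mapping.map_key \<sigma> (Poly_Mapping.map_key \<tau> m) = Poly_Mapping.map_key (\<tau> \<circ> \<sigma>) m"
  by (simp add: map_key_compose bij_is_inj)

lemma inj_map_key: "bij \<sigma> \<Longrightarrow> inj (Poly_Mapping.map_key \<sigma> :: ('b \<Rightarrow>\<^sub>0 'a::zero) \<Rightarrow> 'b \<Rightarrow>\<^sub>0 'a)"
  by (rule injI, rule poly_mapping_eqI) (metis bij_pointE lookup_map_key)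

lemma lookup_perm_vars:
  "bij \<sigma> \<Longrightarrow> Poly_Mapping.lookup (perm_vars \<sigma> p) m = Poly_Mapping.lookup p (Poly_Mapping.map_key \<sigma> m)"
  by (simp add: perm_vars_def map_key.rep_eq inj_map_key)

lemma lookup_sw: "Poly_Mapping.lookup (sw i m) j = Poly_Mapping.lookup m (adj i j)"
  by (simp add: sw_def lookup_map_key)

lemma lookup_sw_simps [simp]:
  "Poly_Mapping.lookup (sw i m) i = Poly_Mapping.lookup m (Suc i)"
  "Poly_Mapping.lookup (sw i m) (Suc i) = Poly_Mapping.lookup m i"
  "j \<noteq> i \<Longrightarrow> j \<noteq> Suc i \<Longrightarrow> Poly_Mapping.lookup (sw i m) j = Poly_Mapping.lookup m j"
  by (simp_all add: lookup_sw)

lemma sw_sw [simp]: "sw i (sw i m) = m"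
  by (rule poly_mapping_eqI) (simp add: lookup_sw)

lemma sw_eq_iff: "sw i m = m' \<longleftrightarrow> m = sw i m'"
  by (metis sw_sw)

lemma lookup_perm_adj:
  "Poly_Mapping.lookup (perm_vars (adj i) p) m = Poly_Mapping.lookup p (sw i m)"
  by (simp add: lookup_perm_vars sw_def)

lemma lookup_single_mult_add:
  "Poly_Mapping.lookup (Poly_Mapping.single a c * p) (a + m :: monom) = c * Poly_Mapping.lookup p (m :: monom)"
  for p :: "'a::comm_semiring_1 mpoly"
proof -
  have "Poly_Mapping.lookup (Poly_Mapping.single a c * p) (a + m)
     = (\<Sum>l. (c * (\<Sum>q. Poly_Mapping.lookup p q when a + m = l + q)) when a = l)"
    by (simp add: lookup_mult lookup_single when_mult)
  also have "\<dots> = c * Poly_Mapping.lookup p m"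
    by simp
  finally show ?thesis .
qed

lemma lookup_single_mult_not:
  fixes p :: "'a::comm_semiring_1 mpoly"
  assumes "\<And>b. m \<noteq> a + b"
  shows "Poly_Mapping.lookup (Poly_Mapping.single a c * p) (m :: monom) = 0"
proof -
  have "Poly_Mapping.lookup (Poly_Mapping.single a c * p) m
     = (\<Sum>l. (c * (\<Sum>q. Poly_Mapping.lookup p q when m = l + q)) when a = l)"
    by (simp add: lookup_mult lookup_single when_mult)
  also have "\<dots> = 0"
    using assms by simp
  finally show ?thesis .
qed

lemma monom_le_split: "(\<And>j. Poly_Mapping.lookup a j \<le> Poly_Mapping.lookup m j) \<Longrightarrow> (m::monom) = a + (m - a)"
  by (rule poly_mapping_eqI) (simp add: lookup_add lookup_minus)

lemma lookup_var_mult: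
  "Poly_Mapping.lookup (var i * p) m =
     (if Poly_Mapping.lookup m i = 0 then 0 else Poly_Mapping.lookup p (m - Poly_Mapping.single i 1))"
  for p :: "'a::comm_semiring_1 mpoly"
proof (cases "Poly_Mapping.lookup m i = 0")
  case True
  then have "m \<noteq> Poly_Mapping.single i 1 + b" for b
    by (metis add_is_0 lookup_add lookup_single_eq one_neq_zero)
  then show ?thesis using True
    by (simp add: var_def lookup_single_mult_not)
next
  case False
  then have "m = Poly_Mapping.single i 1 + (m - Poly_Mapping.single i 1)"
    by (intro monom_le_split) (auto simp: lookup_single when_def)
  then show ?thesis using False
    by (metis lookup_single_mult_add mult_1 var_def)
qed

lemma lookup_scale_mult: "Poly_Mapping.lookup (Poly_Mapping.single 0 c * p) m = c * Poly_Mapping.lookup p m"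
  for p :: "'a::comm_semiring_1 mpoly"
  using lookup_single_mult_add[of 0 c p m] by simp

lemma poly_as_sum: "p = (\<Sum>m\<in>Poly_Mapping.keys p. Poly_Mapping.single m (Poly_Mapping.lookup p m))"
  by (rule poly_mapping_eqI)
    (simp add: lookup_sum lookup_single when_def in_keys_iff sum.delta'[of _ _ "\<lambda>_. _"] sum.delta)

lemma perm_vars_diff: "bij \<sigma> \<Longrightarrow> perm_vars \<sigma> (p - q :: 'a::comm_ring_1 mpoly) = perm_vars \<sigma> p - perm_vars \<sigma> q"
  by (rule poly_mapping_eqI) (simp add: lookup_perm_vars lookup_minus)

lemma perm_vars_var_mult:
  fixes p :: "'a::comm_ring_1 mpoly"
  assumes "bij \<sigma>"
  shows "perm_vars \<sigma> (var i * p) = var (\<sigma> i) * perm_vars \<sigma> p"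
proof (rule poly_mapping_eqI)
  fix m :: monom
  have "Poly_Mapping.map_key \<sigma> m - Poly_Mapping.single i 1
      = Poly_Mapping.map_key \<sigma> (m - Poly_Mapping.single (\<sigma> i) 1)"
    using assms
    by (intro poly_mapping_eqI)
      (auto simp: lookup_map_key lookup_minus lookup_single when_def bij_def inj_eq)
  then show "Poly_Mapping.lookup (perm_vars \<sigma> (var i * p)) m
      = Poly_Mapping.lookup (var (\<sigma> i) * perm_vars \<sigma> p) m"
    using assms by (simp add: lookup_perm_vars lookup_var_mult lookup_map_key)
qed

lemma perm_vars_comp:
  assumes "bij \<sigma>" "bij \<tau>"
  shows "perm_vars \<sigma> (perm_vars \<tau> p) = perm_vars (\<sigma> \<circ> \<tau>) p"
  using assms by (intro poly_mapping_eqI) (simp add: lookup_perm_vars map_key_comp bij_comp)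

lemma perm_vars_id [simp]: "perm_vars id p = p"
  by (rule poly_mapping_eqI) (simp add: lookup_perm_vars[OF bij_id] map_key_id[folded id_def] del: id_apply)

lemma perm_vars_adj_single: "perm_vars (adj i) (Poly_Mapping.single m c) = Poly_Mapping.single (sw i m) c"
  by (rule poly_mapping_eqI) (auto simp: lookup_perm_adj lookup_single when_def sw_eq_iff)

lemma perm_vars_sum:
  "bij \<sigma> \<Longrightarrow> perm_vars \<sigma> (sum f A :: 'a::comm_ring_1 mpoly) = (\<Sum>x\<in>A. perm_vars \<sigma> (f x))"
  by (rule poly_mapping_eqI) (simp add: lookup_perm_vars lookup_sum)

lemma perm_vars_scale_mult:
  "bij \<sigma> \<Longrightarrow> perm_vars \<sigma> (Poly_Mapping.single 0 c * p) = Poly_Mapping.single 0 c * perm_vars \<sigma> p"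
  for p :: "'a::comm_ring_1 mpoly"
  by (rule poly_mapping_eqI) (simp add: lookup_perm_vars lookup_scale_mult)

lemma var_neq: "i \<noteq> j \<Longrightarrow> var i \<noteq> (var j :: 'a::comm_ring_1 mpoly)"
proof
  assume "i \<noteq> j" and eq: "var i = (var j :: 'a mpoly)"
  have "Poly_Mapping.lookup (var i :: 'a mpoly) (Poly_Mapping.single i 1)
      = Poly_Mapping.lookup (var j :: 'a mpoly) (Poly_Mapping.single i 1)"
    by (simp add: eq)
  then have "Poly_Mapping.single j (1::nat) = Poly_Mapping.single i 1"
    by (auto simp: var_def lookup_single when_def split: if_splits)
  then show False using \<open>i \<noteq> j\<close>
    by (metis lookup_single_eq lookup_single_not_eq zero_neq_one)
qed

lemma var_nz: "var i \<noteq> (0 :: 'a::comm_ring_1 mpoly)"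
  by (metis lookup_single_eq lookup_zero var_def zero_neq_one)


section \<open>The Demazure operators\<close>

definition set_pair :: "nat \<Rightarrow> nat \<Rightarrow> nat \<Rightarrow> monom \<Rightarrow> monom" where
  "set_pair i a b m = Poly_Mapping.update (Suc i) b (Poly_Mapping.update i a m)"

lemma lookup_set_pair: "Poly_Mapping.lookup (set_pair i a b m) j =
    (if j = i then a else if j = Suc i then b else Poly_Mapping.lookup m j)"
  by (simp add: set_pair_def lookup_update)

text \<open>
  The image of a monomial, obtained by carrying out the division by \<open>var i - var (Suc i)\<close>: up to a
  common factor it is a geometric sum. If the second exponent is the larger one, the telescoping
  runs backwards, which gives the sign and excludes both ends.
\<close>

definition xi_monom :: "nat \<Rightarrow> monom \<Rightarrow> 'a::comm_ring_1 mpoly" where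
  "xi_monom i m =
    (let a = Poly_Mapping.lookup m i; b = Poly_Mapping.lookup m (Suc i);
         h = (\<lambda>t. Poly_Mapping.single (set_pair i t (a + b - t) m) 1)
     in if b \<le> a then \<Sum>t\<in>{b..a}. h t else - (\<Sum>t\<in>{a<..<b}. h t))"

lemma telescope_closed: "b \<le> a \<Longrightarrow> (\<Sum>t\<in>{b..a}. H (Suc t) - H t) = H (Suc a) - (H b :: 'a::ab_group_add)"
  using sum_Suc_diff[of b a H] by simp

lemma telescope_open: "a < b \<Longrightarrow> (\<Sum>t\<in>{a<..<b}. H (Suc t) - H t) = H b - (H (Suc a) :: 'a::ab_group_add)"
proof -
  assume "a < b"
  moreover have "{a<..<b} = {Suc a..<b}" by auto
  ultimately show ?thesis by (simp add: sum_Suc_diff')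
qed

lemma xi_monom_eq:
  "(var i - var (Suc i)) * xi_monom i m =
     var i * Poly_Mapping.single m 1 - var (Suc i) * (Poly_Mapping.single (sw i m) 1 :: 'a::comm_ring_1 mpoly)"
proof -
  define a where "a = Poly_Mapping.lookup m i"
  define b where "b = Poly_Mapping.lookup m (Suc i)"
  define h :: "nat \<Rightarrow> 'a mpoly" where "h t = Poly_Mapping.single (set_pair i t (a + b - t) m) 1" for t
  define H :: "nat \<Rightarrow> 'a mpoly" where "H t = Poly_Mapping.single (set_pair i t (Suc (a + b) - t) m) 1" for t
  have 1: "var i * h t = H (Suc t)" if "t \<le> a + b" for t
  proof -
    have "Poly_Mapping.single i 1 + set_pair i t (a + b - t) m = set_pair i (Suc t) (Suc (a + b) - Suc t) m"
      by (rule poly_mapping_eqI) (auto simp: lookup_add lookup_single lookup_set_pair when_def)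
    then show ?thesis by (simp add: var_def h_def H_def mult_single)
  qed
  have 2: "var (Suc i) * h t = H t" if "t \<le> a + b" for t
  proof -
    have "Poly_Mapping.single (Suc i) 1 + set_pair i t (a + b - t) m = set_pair i t (Suc (a + b) - t) m"
      using that by (intro poly_mapping_eqI) (auto simp: lookup_add lookup_single lookup_set_pair when_def)
    then show ?thesis by (simp add: var_def h_def H_def mult_single)
  qed
  have step: "(var i - var (Suc i)) * h t = H (Suc t) - H t" if "t \<le> a + b" for t
    using 1[OF that] 2[OF that] by (simp add: algebra_simps)
  have ends: "var i * Poly_Mapping.single m 1 = H (Suc a)"
    "var (Suc i) * Poly_Mapping.single (sw i m) 1 = H b"
  proof -
    have "Poly_Mapping.single i 1 + m = set_pair i (Suc a) (Suc (a + b) - Suc a) m"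
      by (rule poly_mapping_eqI) (auto simp: lookup_add lookup_single lookup_set_pair when_def a_def b_def)
    then show "var i * Poly_Mapping.single m 1 = H (Suc a)"
      by (simp add: var_def H_def mult_single)
    have "Poly_Mapping.single (Suc i) 1 + sw i m = set_pair i b (Suc (a + b) - b) m"
      by (rule poly_mapping_eqI) (auto simp: lookup_add lookup_single lookup_set_pair when_def a_def b_def)
    then show "var (Suc i) * Poly_Mapping.single (sw i m) 1 = H b"
      by (simp add: var_def H_def mult_single)
  qed
  show ?thesis
  proof (cases "b \<le> a")
    case True
    then have "(var i - var (Suc i)) * xi_monom i m = (\<Sum>t\<in>{b..a}. (var i - var (Suc i)) * h t)"
      unfolding xi_monom_def a_def[symmetric] b_def[symmetric] Let_def h_def
      by (simp add: sum_distrib_left)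
    also have "\<dots> = (\<Sum>t\<in>{b..a}. H (Suc t) - H t)"
      by (intro sum.cong refl step) auto
    finally show ?thesis using True by (simp add: telescope_closed ends)
  next
    case False
    then have "(var i - var (Suc i)) * xi_monom i m = - (\<Sum>t\<in>{a<..<b}. (var i - var (Suc i)) * h t)"
      unfolding xi_monom_def a_def[symmetric] b_def[symmetric] Let_def h_def
      by (simp add: sum_distrib_left)
    also have "(\<Sum>t\<in>{a<..<b}. (var i - var (Suc i)) * h t) = (\<Sum>t\<in>{a<..<b}. H (Suc t) - H t)"
      by (intro sum.cong refl step) auto
    finally show ?thesis using False by (simp add: telescope_open ends)
  qed
qed

definition xi_expand :: "nat \<Rightarrow> 'a::comm_ring_1 mpoly \<Rightarrow> 'a mpoly" where
  "xi_expand i f = (\<Sum>m\<in>Poly_Mapping.keys f. Poly_Mapping.single 0 (Poly_Mapping.lookup f m) * xi_monom i m)"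

lemma single_as_scale: "Poly_Mapping.single m c = Poly_Mapping.single 0 c * Poly_Mapping.single m (1 :: 'a::comm_ring_1)"
  for m :: monom
  by (simp add: mult_single)

lemma xi_expand_eq:
  "(var i - var (Suc i)) * xi_expand i f = var i * f - var (Suc i) * perm_vars (adj i) f"
  for f :: "'a::comm_ring_1 mpoly"
proof -
  let ?c = "\<lambda>m. Poly_Mapping.single 0 (Poly_Mapping.lookup f m) :: 'a mpoly"
  have f: "f = (\<Sum>m\<in>Poly_Mapping.keys f. ?c m * Poly_Mapping.single m 1)"
    by (subst poly_as_sum[of f], rule sum.cong[OF refl], rule single_as_scale)
  have "perm_vars (adj i) f = perm_vars (adj i) (\<Sum>m\<in>Poly_Mapping.keys f. ?c m * Poly_Mapping.single m 1)"
    by (rule arg_cong[OF f])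
  also have "\<dots> = (\<Sum>m\<in>Poly_Mapping.keys f. ?c m * Poly_Mapping.single (sw i m) 1)"
    by (simp add: perm_vars_sum perm_vars_scale_mult perm_vars_adj_single)
  finally have sf: "perm_vars (adj i) f = (\<Sum>m\<in>Poly_Mapping.keys f. ?c m * Poly_Mapping.single (sw i m) 1)" .
  have "(var i - var (Suc i)) * xi_expand i f
      = (\<Sum>m\<in>Poly_Mapping.keys f. ?c m * ((var i - var (Suc i)) * xi_monom i m))"
    by (simp add: xi_expand_def sum_distrib_left mult.left_commute)
  also have "\<dots> = var i * (\<Sum>m\<in>Poly_Mapping.keys f. ?c m * Poly_Mapping.single m 1)
      - var (Suc i) * (\<Sum>m\<in>Poly_Mapping.keys f. ?c m * Poly_Mapping.single (sw i m) 1)"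
    unfolding xi_monom_eq
    by (simp add: sum_distrib_left sum_subtractf algebra_simps)
  finally show ?thesis unfolding f[symmetric] sf[symmetric] .
qed

lemma to_fract_var_diff_nz: "i \<noteq> j \<Longrightarrow> to_fract (var i - var j :: 'a::field mpoly) \<noteq> 0"
  by (simp only: to_fract_eq_0_iff right_minus_eq var_neq not_False_eq_True)

lemma xi_eq_expand: "xi i f = xi_expand i f"
  unfolding xi_def
proof (rule the_equality)
  have nz: "to_fract (var i - var (Suc i) :: 'a mpoly) \<noteq> 0"
    by (rule to_fract_var_diff_nz) simp
  have "to_fract (xi_expand i f) * to_fract (var i - var (Suc i))
      = to_fract (var i * f - var (Suc i) * perm_vars (adj i) f)"
    by (simp only: to_fract_mult[symmetric] xi_expand_eq mult.commute[of "xi_expand i f"])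
  then show eq: "to_fract (xi_expand i f) =
      to_fract (var i * f - var (Suc i) * perm_vars (adj i) f) / to_fract (var i - var (Suc i))"
    by (rule iffD2[OF nonzero_eq_divide_eq[OF nz]])
  show "g = xi_expand i f" if "to_fract g =
      to_fract (var i * f - var (Suc i) * perm_vars (adj i) f) / to_fract (var i - var (Suc i))" for g
    by (rule iffD1[OF to_fract_eq_iff trans[OF that eq[symmetric]]])
qed

lemma xi_eq: "(var i - var (Suc i)) * xi i f = var i * f - var (Suc i) * perm_vars (adj i) f"
  by (simp only: xi_eq_expand xi_expand_eq)

text \<open>Every later identity between Demazure operators is checked after clearing the denominator.\<close>

lemma xi_unique:
  assumes "(var i - var (Suc i)) * g = var i * f - var (Suc i) * perm_vars (adj i) f"
  shows "xi i f = g"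
proof -
  have "(var i - var (Suc i)) * xi i f = (var i - var (Suc i)) * g"
    using assms by (simp add: xi_eq)
  moreover have "var i - var (Suc i) \<noteq> (0 :: 'a mpoly)"
    using var_neq[of i "Suc i", where 'a='a] by simp
  ultimately show ?thesis by (simp only: mult_cancel_left) simp
qed

lemma xi_diff: "xi i (f - g) = xi i f - xi i (g :: 'a::field mpoly)"
  by (rule xi_unique) (simp add: right_diff_distrib xi_eq perm_vars_diff)

lemma xi_var_mult:
  assumes "k \<noteq> i" "k \<noteq> Suc i"
  shows "xi i (var k * f) = var k * xi i (f :: 'a::field mpoly)"
proof (rule xi_unique)
  have "(var i - var (Suc i)) * (var k * xi i f) = var k * ((var i - var (Suc i)) * xi i f)"
    by (rule mult.left_commute)
  then show "(var i - var (Suc i)) * (var k * xi i f)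
      = var i * (var k * f) - var (Suc i) * perm_vars (adj i) (var k * f)"
    using assms by (simp add: xi_eq perm_vars_var_mult right_diff_distrib mult.left_commute)
qed

text \<open>The defining quotient is invariant, as numerator and denominator both change their sign.\<close>

lemma xi_sym: "perm_vars (adj i) (xi i f) = xi i (f :: 'a::field mpoly)"
proof (rule sym, rule xi_unique)
  have "perm_vars (adj i) ((var i - var (Suc i)) * xi i f)
      = perm_vars (adj i) (var i * f - var (Suc i) * perm_vars (adj i) f)"
    by (simp add: xi_eq)
  then have "(var (Suc i) - var i) * perm_vars (adj i) (xi i f) = var (Suc i) * perm_vars (adj i) f - var i * f"
    by (simp add: perm_vars_diff perm_vars_var_mult left_diff_distrib perm_vars_comp)
  then show "(var i - var (Suc i)) * perm_vars (adj i) (xi i f)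
      = var i * f - var (Suc i) * perm_vars (adj i) f"
    by (simp add: algebra_simps)
qed

lemma xi_of_sym: "perm_vars (adj i) f = f \<Longrightarrow> xi i f = (f :: 'a::field mpoly)"
  by (rule xi_unique) (simp add: left_diff_distrib)

lemma xi_idem: "xi i (xi i f) = xi i (f :: 'a::field mpoly)"
  by (rule xi_of_sym) (rule xi_sym)

lemma perm_vars_xi_far:
  assumes "i \<noteq> j" "i \<noteq> Suc j" "j \<noteq> Suc i"
  shows "perm_vars (adj i) (xi j f) = xi j (perm_vars (adj i) (f :: 'a::field mpoly))"
proof (rule sym, rule xi_unique)
  have fixed: "adj i j = j" "adj i (Suc j) = Suc j"
    using assms by auto
  have comm: "adj i \<circ> adj j = adj j \<circ> adj i"
    using assms by (auto simp: fun_eq_iff transpose_def)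
  have "perm_vars (adj i) ((var j - var (Suc j)) * xi j f)
      = perm_vars (adj i) (var j * f - var (Suc j) * perm_vars (adj j) f)"
    by (simp add: xi_eq)
  then show "(var j - var (Suc j)) * perm_vars (adj i) (xi j f)
      = var j * perm_vars (adj i) f - var (Suc j) * perm_vars (adj j) (perm_vars (adj i) f)"
    by (simp add: perm_vars_diff perm_vars_var_mult left_diff_distrib perm_vars_comp fixed comm)
qed

lemma xi_commute:
  assumes "i \<noteq> j" "i \<noteq> Suc j" "j \<noteq> Suc i"
  shows "xi i (xi j f) = xi j (xi i (f :: 'a::field mpoly))"
proof (rule xi_unique)
  have "(var i - var (Suc i)) * xi j (xi i f) = xi j ((var i - var (Suc i)) * xi i f)"
    using assms by (simp add: left_diff_distrib xi_diff xi_var_mult)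
  also have "\<dots> = var i * xi j f - var (Suc i) * perm_vars (adj i) (xi j f)"
    using assms by (simp add: xi_eq xi_diff xi_var_mult perm_vars_xi_far)
  finally show "(var i - var (Suc i)) * xi j (xi i f)
      = var i * xi j f - var (Suc i) * perm_vars (adj i) (xi j f)" .
qed

text \<open>
  The braid relation comes down to a rational identity in three variables and the six images of the
  argument. Both sides are the quotient of the antisymmetrisation of \<open>x\<^sup>2 y f\<close> by the Vandermonde product.
\<close>

lemma braid_left:
  fixes x y z :: "'b::idom"
  assumes ne: "x \<noteq> y" "y \<noteq> z" "x \<noteq> z"
    and g1: "(x - y) * g1 = x * f - y * sf"
    and tg1: "(x - z) * tg1 = x * tf - z * tsf"
    and stg1: "(y - z) * stg1 = y * stf - z * stsf"
    and g2: "(y - z) * g2 = y * g1 - z * tg1"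
    and sg2: "(x - z) * sg2 = x * g1 - z * stg1"
    and u: "(x - y) * u = x * g2 - y * sg2"
  shows "(x - y) * (y - z) * (x - z) * u
    = x^2*y*f - x*y^2*sf - x^2*z*tf + x*z^2*tsf + y^2*z*stf - y*z^2*stsf"
proof -
  have 1: "(x - y) * (y - z) * (x - z) * u = x * (x - z) * (y * g1 - z * tg1) - y * (y - z) * (x * g1 - z * stg1)"
    using g2 sg2 u by algebra
  also have "\<dots> = x * y * ((x - y) * g1) - x * z * ((x - z) * tg1) + y * z * ((y - z) * stg1)"
    by algebra
  also have "\<dots> = x^2*y*f - x*y^2*sf - x^2*z*tf + x*z^2*tsf + y^2*z*stf - y*z^2*stsf"
    unfolding g1 tg1 stg1 by algebra
  finally show ?thesis .
qed

lemma braid_right: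
  fixes x y z :: "'b::idom"
  assumes h1: "(y - z) * h1 = y * f - z * tf"
    and sh1: "(x - z) * sh1 = x * sf - z * stf"
    and tsh1: "(x - y) * tsh1 = x * tsf - y * stsf"
    and h2: "(x - y) * h2 = x * h1 - y * sh1"
    and th2: "(x - z) * th2 = x * h1 - z * tsh1"
    and v: "(y - z) * v = y * h2 - z * th2"
  shows "(x - y) * (y - z) * (x - z) * v
    = x^2*y*f - x*y^2*sf - x^2*z*tf + x*z^2*tsf + y^2*z*stf - y*z^2*stsf"
proof -
  have "(x - y) * (y - z) * (x - z) * v = y * (x - z) * (x * h1 - y * sh1) - z * (x - y) * (x * h1 - z * tsh1)"
    using h2 th2 v by algebra
  also have "\<dots> = x^2 * ((y - z) * h1) - y^2 * ((x - z) * sh1) + z^2 * ((x - y) * tsh1)"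
    by algebra
  also have "\<dots> = x^2*y*f - x*y^2*sf - x^2*z*tf + x*z^2*tsf + y^2*z*stf - y*z^2*stsf"
    unfolding h1 sh1 tsh1 by algebra
  finally show ?thesis .
qed

lemma perm_xi_eq:
  assumes "bij \<sigma>"
  shows "(var (\<sigma> i) - var (\<sigma> (Suc i))) * perm_vars \<sigma> (xi i f)
    = var (\<sigma> i) * perm_vars \<sigma> f - var (\<sigma> (Suc i)) * perm_vars (\<sigma> \<circ> adj i) (f :: 'a::field mpoly)"
proof -
  have "perm_vars \<sigma> ((var i - var (Suc i)) * xi i f)
      = perm_vars \<sigma> (var i * f - var (Suc i) * perm_vars (adj i) f)"
    by (simp add: xi_eq)
  then show ?thesis using assms
    by (simp add: perm_vars_diff perm_vars_var_mult left_diff_distrib perm_vars_comp)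
qed

lemma xi_braid: "xi i (xi (Suc i) (xi i f)) = xi (Suc i) (xi i (xi (Suc i) (f :: 'a::field mpoly)))"
proof -
  let ?s = "adj i" and ?t = "adj (Suc i)"
  let ?x = "var i :: 'a mpoly" and ?y = "var (Suc i) :: 'a mpoly" and ?z = "var (Suc (Suc i)) :: 'a mpoly"
  define P where "P \<sigma> = perm_vars \<sigma> f" for \<sigma>
  define g1 where "g1 = xi i f"
  define g2 where "g2 = xi (Suc i) g1"
  define h1 where "h1 = xi (Suc i) f"
  define h2 where "h2 = xi i h1"
  have b: "bij (?s \<circ> ?t)" "bij (?t \<circ> ?s)" by (simp_all add: bij_comp)
  have v: "?s i = Suc i" "?s (Suc i) = i" "?s (Suc (Suc i)) = Suc (Suc i)"
    "?t i = i" "?t (Suc i) = Suc (Suc i)" "?t (Suc (Suc i)) = Suc i"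
    by simp_all
  have br: "(?t \<circ> ?s) \<circ> ?t = (?s \<circ> ?t) \<circ> ?s"
    by (auto simp: fun_eq_iff transpose_def)
  have sg1: "perm_vars ?s g1 = g1" and th1: "perm_vars ?t h1 = h1"
    by (simp_all add: g1_def h1_def xi_sym)
  have stg: "perm_vars ((?s \<circ> ?t)) g1 = perm_vars ?s (perm_vars ?t g1)"
    and tsh: "perm_vars ((?t \<circ> ?s)) h1 = perm_vars ?t (perm_vars ?s h1)"
    by (simp_all add: perm_vars_comp)
  have L: "(?x - ?y) * (?y - ?z) * (?x - ?z) * xi i g2
      = ?x^2*?y*f - ?x*?y^2*P ?s - ?x^2*?z*P ?t + ?x*?z^2*P (?t \<circ> ?s) + ?y^2*?z*P (?s \<circ> ?t) - ?y*?z^2*P ((?s \<circ> ?t) \<circ> ?s)"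
  proof (rule braid_left)
    show "(?x - ?y) * g1 = ?x * f - ?y * P ?s"
      by (simp add: g1_def xi_eq P_def)
    show "(?x - ?z) * perm_vars ?t g1 = ?x * P ?t - ?z * P (?t \<circ> ?s)"
      using perm_xi_eq[of ?t i f] by (simp only: g1_def P_def v bij_transpose)
    show "(?y - ?z) * perm_vars (?s \<circ> ?t) g1 = ?y * P (?s \<circ> ?t) - ?z * P (?s \<circ> ?t \<circ> ?s)"
      using perm_xi_eq[OF b(1), of i f] by (simp only: g1_def P_def v comp_apply)
    show "(?y - ?z) * g2 = ?y * g1 - ?z * perm_vars ?t g1"
      by (simp add: g2_def xi_eq)
    show "(?x - ?z) * perm_vars ?s g2 = ?x * g1 - ?z * perm_vars (?s \<circ> ?t) g1"
      using perm_xi_eq[of ?s "Suc i" g1] by (simp only: g2_def v sg1 bij_transpose)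
    show "(?x - ?y) * xi i g2 = ?x * g2 - ?y * perm_vars ?s g2"
      by (rule xi_eq)
  qed (simp_all add: var_neq)
  have R: "(?x - ?y) * (?y - ?z) * (?x - ?z) * xi (Suc i) h2
      = ?x^2*?y*f - ?x*?y^2*P ?s - ?x^2*?z*P ?t + ?x*?z^2*P (?t \<circ> ?s) + ?y^2*?z*P (?s \<circ> ?t) - ?y*?z^2*P ((?s \<circ> ?t) \<circ> ?s)"
  proof (rule braid_right)
    show "(?y - ?z) * h1 = ?y * f - ?z * P ?t"
      by (simp add: h1_def xi_eq P_def)
    show "(?x - ?z) * perm_vars ?s h1 = ?x * P ?s - ?z * P (?s \<circ> ?t)"
      using perm_xi_eq[of ?s "Suc i" f] by (simp only: h1_def P_def v bij_transpose)
    show "(?x - ?y) * perm_vars (?t \<circ> ?s) h1 = ?x * P (?t \<circ> ?s) - ?y * P (?s \<circ> ?t \<circ> ?s)"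
      using perm_xi_eq[OF b(2), of "Suc i" f] by (simp only: h1_def P_def v comp_apply br)
    show "(?x - ?y) * h2 = ?x * h1 - ?y * perm_vars ?s h1"
      by (simp add: h2_def xi_eq)
    show "(?x - ?z) * perm_vars ?t h2 = ?x * h1 - ?z * perm_vars (?t \<circ> ?s) h1"
      using perm_xi_eq[of ?t i h1] by (simp only: h2_def v th1 bij_transpose)
    show "(?y - ?z) * xi (Suc i) h2 = ?y * h2 - ?z * perm_vars ?t h2"
      by (rule xi_eq)
  qed
  have "(?x - ?y) * (?y - ?z) * (?x - ?z) \<noteq> 0"
    using var_neq[of i "Suc i", where 'a='a] var_neq[of "Suc i" "Suc (Suc i)", where 'a='a]
      var_neq[of i "Suc (Suc i)", where 'a='a] by simp
  moreover have "(?x - ?y) * (?y - ?z) * (?x - ?z) * xi i g2 = (?x - ?y) * (?y - ?z) * (?x - ?z) * xi (Suc i) h2"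
    unfolding L R ..
  ultimately have "xi i g2 = xi (Suc i) h2"
    by (rule iffD1[OF mult_left_cancel])
  then show ?thesis by (simp only: g2_def g1_def h2_def h1_def)
qed


section \<open>The Bruhat order on exponent vectors\<close>

definition tail_count :: "monom \<Rightarrow> nat \<Rightarrow> nat \<Rightarrow> nat" where
  "tail_count m j c = card {i. j \<le> i \<and> c \<le> Poly_Mapping.lookup m i}"

lemma finite_tail: "c \<ge> 1 \<Longrightarrow> finite {i. j \<le> i \<and> c \<le> Poly_Mapping.lookup (m::monom) i}"
  by (rule finite_subset[OF _ finite_keys[of m]]) (auto simp: in_keys_iff)

lemma tail_count_step:
  assumes "c \<ge> 1"
  shows "tail_count m j c = tail_count m (Suc j) c + of_bool (c \<le> Poly_Mapping.lookup m j)"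
proof (cases "c \<le> Poly_Mapping.lookup m j")
  case True
  then have "{i. j \<le> i \<and> c \<le> Poly_Mapping.lookup m i} = insert j {i. Suc j \<le> i \<and> c \<le> Poly_Mapping.lookup m i}"
    by (auto simp: Suc_le_eq order_le_less)
  then show ?thesis using True finite_tail[OF assms]
    unfolding tail_count_def by simp
next
  case False
  then have "{i. j \<le> i \<and> c \<le> Poly_Mapping.lookup m i} = {i. Suc j \<le> i \<and> c \<le> Poly_Mapping.lookup m i}"
    by (auto simp: Suc_le_eq order_le_less)
  then show ?thesis using False unfolding tail_count_def by simp
qed

lemma tail_count_sw_above:
  "Suc i < j \<Longrightarrow> tail_count (sw i m) j c = tail_count m j c"
  unfolding tail_count_def
  by (rule arg_cong[where f=card]) (auto simp: lookup_sw transpose_def)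

lemma tail_count_sw_mid:
  "c \<ge> 1 \<Longrightarrow> tail_count (sw i m) (Suc i) c
     = tail_count m (Suc (Suc i)) c + of_bool (c \<le> Poly_Mapping.lookup m i)"
  by (simp add: tail_count_step[of c _ "Suc i"] tail_count_sw_above)

lemma tail_count_sw_below:
  assumes "c \<ge> 1" "j \<le> i"
  shows "tail_count (sw i m) j c = tail_count m j c"
  using assms(2)
proof (induction j rule: inc_induct)
  case base
  show ?case
    by (simp add: tail_count_step[OF assms(1), of _ i] tail_count_sw_mid[OF assms(1)] tail_count_step[OF assms(1), of m "Suc i"])
next
  case (step j)
  then show ?case by (simp add: tail_count_step[OF assms(1), of _ j])
qed

text \<open>
  For two rearrangements of the same entries this is the tableau criterion for the Bruhat order.
  Descending vectors are the smallest and ascending ones the largest.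
\<close>

definition bruhat_le :: "monom \<Rightarrow> monom \<Rightarrow> bool" where
  "bruhat_le b a \<longleftrightarrow> (\<forall>j. \<forall>c\<ge>1. tail_count b j c \<le> tail_count a j c)"

text \<open>A strictly monotone size for the Bruhat order: the sum of all the tail counts.\<close>

definition ell :: "monom \<Rightarrow> nat" where
  "ell m = card {((j, c), i). j \<le> i \<and> 1 \<le> c \<and> c \<le> Poly_Mapping.lookup m i}"

lemma ell_eq:
  assumes "Poly_Mapping.keys m \<subseteq> {..<n}" "\<And>i. Poly_Mapping.lookup m i \<le> d"
  shows "ell m = (\<Sum>(j, c)\<in>{..<n} \<times> {1..d}. tail_count m j c)"
proof -
  have lt: "i < n" if "c \<le> Poly_Mapping.lookup m i" "1 \<le> c" for i c
    using that assms(1) by (auto simp: in_keys_iff subset_iff)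
  have "{((j, c), i). j \<le> i \<and> 1 \<le> c \<and> c \<le> Poly_Mapping.lookup m i}
     = Sigma ({..<n} \<times> {1..d}) (\<lambda>(j, c). {i. j \<le> i \<and> c \<le> Poly_Mapping.lookup m i})"
    using lt assms(2) by (force intro: order_trans)
  then show ?thesis unfolding ell_def tail_count_def
    by (subst \<open>_ = Sigma _ _\<close>, subst card_SigmaI) (auto intro!: finite_tail sum.cong)
qed

lemma monom_bounds:
  fixes m :: monom
  obtains n d where "Poly_Mapping.keys m \<subseteq> {..<n}" "\<forall>i. Poly_Mapping.lookup m i \<le> d"
proof
  show "Poly_Mapping.keys m \<subseteq> {..<Suc (Max (insert 0 (Poly_Mapping.keys m)))}"
    by (auto simp: less_Suc_eq_le)
  show "\<forall>i. Poly_Mapping.lookup m i \<le> Max (insert 0 (Poly_Mapping.range m))"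
  proof
    fix i
    show "Poly_Mapping.lookup m i \<le> Max (insert 0 (Poly_Mapping.range m))"
      by (cases "Poly_Mapping.lookup m i = 0") (auto simp: in_keys_iff in_keys_lookup_in_range)
  qed
qed

lemma monom_bounds2:
  fixes m m' :: monom
  obtains n d where "Poly_Mapping.keys m \<subseteq> {..<n}" "\<forall>i. Poly_Mapping.lookup m i \<le> d"
    "Poly_Mapping.keys m' \<subseteq> {..<n}" "\<forall>i. Poly_Mapping.lookup m' i \<le> d"
proof -
  obtain n d where 1: "Poly_Mapping.keys m \<subseteq> {..<n}" "\<forall>i. Poly_Mapping.lookup m i \<le> d"
    by (rule monom_bounds[of m])
  obtain n' d' where 2: "Poly_Mapping.keys m' \<subseteq> {..<n'}" "\<forall>i. Poly_Mapping.lookup m' i \<le> d'"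
    by (rule monom_bounds[of m'])
  show ?thesis
  proof
    show "Poly_Mapping.keys m \<subseteq> {..<max n n'}" "Poly_Mapping.keys m' \<subseteq> {..<max n n'}"
      using 1 2 by fastforce+
    show "\<forall>i. Poly_Mapping.lookup m i \<le> max d d'" "\<forall>i. Poly_Mapping.lookup m' i \<le> max d d'"
      using 1(2) 2(2) by (simp_all add: le_max_iff_disj)
  qed
qed

lemma tail_count_determines:
  assumes "\<And>j c. c \<ge> 1 \<Longrightarrow> tail_count a j c = tail_count b j c"
  shows "a = b"
proof (rule poly_mapping_eqI)
  fix i
  have "c \<le> Poly_Mapping.lookup a i \<longleftrightarrow> c \<le> Poly_Mapping.lookup b i" if "c \<ge> 1" for c
    using assms[OF that, of i] assms[OF that, of "Suc i"] tail_count_step[OF that, of _ i]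
    by (auto split: if_splits simp: of_bool_def)
  from this[of "Poly_Mapping.lookup a i"] this[of "Poly_Mapping.lookup b i"]
  show "Poly_Mapping.lookup a i = Poly_Mapping.lookup b i"
    by (cases "Poly_Mapping.lookup a i"; cases "Poly_Mapping.lookup b i") auto
qed

lemma ell_less:
  assumes le: "bruhat_le b a" and ne: "b \<noteq> a"
  shows "ell b < ell a"
proof -
  obtain n d where nd: "Poly_Mapping.keys b \<subseteq> {..<n}" "\<forall>i. Poly_Mapping.lookup b i \<le> d"
    "Poly_Mapping.keys a \<subseteq> {..<n}" "\<forall>i. Poly_Mapping.lookup a i \<le> d"
    by (rule monom_bounds2[of b a])
  obtain j c where jc: "c \<ge> 1" "tail_count b j c < tail_count a j c"
    using tail_count_determines[of b a] le ne unfolding bruhat_le_def by (metis le_neq_implies_less)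
  then have "tail_count a j c \<noteq> 0" by simp
  then obtain i where "j \<le> i" "c \<le> Poly_Mapping.lookup a i"
    unfolding tail_count_def by (metis (mono_tags, lifting) Collect_empty_eq card.empty)
  moreover have "i < n"
    using nd(3) jc(1) \<open>c \<le> _\<close> by (auto simp: in_keys_iff subset_iff)
  ultimately have "(j, c) \<in> {..<n} \<times> {1..d}"
    using jc(1) order_trans[OF _ nd(4)[rule_format, of i], of c] by auto
  then have "(\<Sum>(j, c)\<in>{..<n} \<times> {1..d}. tail_count b j c) < (\<Sum>(j, c)\<in>{..<n} \<times> {1..d}. tail_count a j c)"
    using jc(2) le by (intro sum_strict_mono_ex1 bexI[of _ "(j, c)"]) (auto simp: bruhat_le_def)
  then show ?thesis
    by (simp add: ell_eq[OF nd(1) nd(2)[rule_format]] ell_eq[OF nd(3) nd(4)[rule_format]])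
qed

lemma bruhat_sw:
  assumes "Poly_Mapping.lookup a i \<le> Poly_Mapping.lookup a (Suc i)"
  shows "bruhat_le (sw i a) a"
  unfolding bruhat_le_def
proof (intro allI impI)
  fix j c :: nat assume c: "c \<ge> 1"
  consider "j \<le> i" | "j = Suc i" | "Suc i < j" by linarith
  then show "tail_count (sw i a) j c \<le> tail_count a j c"
  proof cases
    case 2
    then show ?thesis using assms
      by (simp add: tail_count_sw_mid[OF c] tail_count_step[OF c, of a "Suc i"])
  qed (simp_all add: tail_count_sw_below[OF c] tail_count_sw_above)
qed

lemma sw_neq: "Poly_Mapping.lookup a i \<noteq> Poly_Mapping.lookup a (Suc i) \<Longrightarrow> sw i a \<noteq> a"
  by (metis lookup_sw_simps(1))

lemma ell_sw_less:
  "Poly_Mapping.lookup a i < Poly_Mapping.lookup a (Suc i) \<Longrightarrow> ell (sw i a) < ell a"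
  by (intro ell_less bruhat_sw sw_neq) auto

lemma sw_same: "Poly_Mapping.lookup a i = Poly_Mapping.lookup a (Suc i) \<Longrightarrow> sw i a = a"
  by (rule poly_mapping_eqI) (auto simp: lookup_sw transpose_def)

section \<open>Key polynomials indexed by exponent vectors\<close>

definition dominant :: "monom \<Rightarrow> bool" where
  "dominant a \<longleftrightarrow> (\<forall>i. Poly_Mapping.lookup a (Suc i) \<le> Poly_Mapping.lookup a i)"

text \<open>
  The construction of the key polynomials, with the compositions replaced by exponent vectors.
  Compositions that differ by trailing zeros give the same exponent vector, so uniqueness here
  contains the identity \<open>\<K>\<^bsub>\<alpha>*0\<^esub> = \<K>\<^sub>\<alpha>\<close>.
\<close>

inductive is_key_monom :: "monom \<Rightarrow> 'a::field mpoly \<Rightarrow> bool" where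
  dom: "dominant a \<Longrightarrow> is_key_monom a (Poly_Mapping.single a 1)"
| step: "is_key_monom a p \<Longrightarrow> Poly_Mapping.lookup a (Suc i) < Poly_Mapping.lookup a i
    \<Longrightarrow> is_key_monom (sw i a) (xi i p)"

lemma is_key_monom_up:
  "is_key_monom (sw i a) p \<Longrightarrow> Poly_Mapping.lookup a i < Poly_Mapping.lookup a (Suc i) \<Longrightarrow> is_key_monom a (xi i p)"
  using is_key_monom.step[of "sw i a" p i] by simp

lemma is_key_monom_ex: "\<exists>p. is_key_monom a (p :: 'a::field mpoly)"
proof (induction "ell a" arbitrary: a rule: less_induct)
  case less
  show ?case
  proof (cases "dominant a")
    case True
    then show ?thesis by (blast intro: is_key_monom.dom)
  next
    case False
    then obtain i where i: "Poly_Mapping.lookup a i < Poly_Mapping.lookup a (Suc i)"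
      by (auto simp: dominant_def not_le)
    from less[OF ell_sw_less[OF i]] show ?thesis
      using is_key_monom_up[OF _ i] by blast
  qed
qed

lemma is_key_monom_cases:
  assumes "is_key_monom a (p :: 'a::field mpoly)"
  obtains "dominant a" "p = Poly_Mapping.single a 1"
  | i q where "Poly_Mapping.lookup a i < Poly_Mapping.lookup a (Suc i)" "is_key_monom (sw i a) q" "p = xi i q"
  using assms
proof (cases rule: is_key_monom.cases)
  case dom
  then show ?thesis by (intro that(1))
next
  case (step b q i)
  then show ?thesis by (intro that(2)[of i q]) simp_all
qed

text \<open>
  The construction is a rewriting system that terminates by \<open>ell\<close>, so local confluence suffices: two
  different last steps are joined by a commutation or by the braid relation.
\<close>

lemma is_key_monom_unique:
  assumes "is_key_monom a p" "is_key_monom a q"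
  shows "p = (q :: 'a::field mpoly)"
  using assms
proof (induction "ell a" arbitrary: a p q rule: less_induct)
  case less
  note uniq = less.hyps
  let ?L = "Poly_Mapping.lookup"
  have join: "xi i p' = xi j q'" if "i < j" and i: "?L a i < ?L a (Suc i)" "is_key_monom (sw i a) p'"
    and j: "?L a j < ?L a (Suc j)" "is_key_monom (sw j a) q'" for i j and p' q' :: "'a mpoly"
  proof (cases "j = Suc i")
    case True
    let ?c = "sw i (sw (Suc i) (sw i a))"
    obtain r :: "'a mpoly" where r: "is_key_monom ?c r" using is_key_monom_ex by blast
    have c: "?c = sw (Suc i) (sw i (sw (Suc i) a))"
      by (rule poly_mapping_eqI) (auto simp: lookup_sw transpose_def)
    have "is_key_monom (sw (Suc i) (sw i a)) (xi i r)"
      using r i(1) j(1) True by (intro is_key_monom_up[of i]) auto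
    then have "is_key_monom (sw i a) (xi (Suc i) (xi i r))"
      using i(1) j(1) True by (intro is_key_monom_up[of "Suc i"]) auto
    then have p: "p' = xi (Suc i) (xi i r)"
      using uniq[OF ell_sw_less[OF i(1)]] i(2) by blast
    have "is_key_monom (sw i (sw (Suc i) a)) (xi (Suc i) r)"
      using r i(1) j(1) True unfolding c by (intro is_key_monom_up[of "Suc i"]) auto
    then have "is_key_monom (sw (Suc i) a) (xi i (xi (Suc i) r))"
      using i(1) j(1) True by (intro is_key_monom_up[of i]) auto
    then have q: "q' = xi i (xi (Suc i) r)"
      using uniq[OF ell_sw_less[OF j(1)]] j(2) True by blast
    show ?thesis unfolding p q True by (rule xi_braid)
  next
    case False
    then have far: "i \<noteq> j" "i \<noteq> Suc j" "j \<noteq> Suc i" using \<open>i < j\<close> by auto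
    let ?c = "sw j (sw i a)"
    obtain r :: "'a mpoly" where r: "is_key_monom ?c r" using is_key_monom_ex by blast
    have c: "?c = sw i (sw j a)"
      using far by (intro poly_mapping_eqI) (auto simp: lookup_sw transpose_def)
    have "is_key_monom (sw i a) (xi j r)"
      using r j(1) far by (intro is_key_monom_up[of j]) auto
    then have p: "p' = xi j r"
      using uniq[OF ell_sw_less[OF i(1)]] i(2) by blast
    have "is_key_monom (sw j a) (xi i r)"
      using r i(1) far unfolding c by (intro is_key_monom_up[of i]) auto
    then have q: "q' = xi i r"
      using uniq[OF ell_sw_less[OF j(1)]] j(2) by blast
    show ?thesis unfolding p q by (rule xi_commute) (use far in auto)
  qed
  from less.prems(1) show ?case
  proof (cases rule: is_key_monom_cases)
    case 1
    from less.prems(2) show ?thesis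
      by (cases rule: is_key_monom_cases) (use 1 in \<open>auto simp: dominant_def not_le[symmetric]\<close>)
  next
    case (2 i p')
    note i = this
    from less.prems(2) show ?thesis
    proof (cases rule: is_key_monom_cases)
      case 1
      then show ?thesis using i(1) by (auto simp: dominant_def not_le[symmetric])
    next
      case (2 j q')
      consider "i = j" | "i < j" | "j < i" by linarith
      then show ?thesis
      proof cases
        case 1
        then show ?thesis using uniq[OF ell_sw_less[OF i(1)] i(2)] i(3) 2 by blast
      next
        case b: 2
        show ?thesis using join[OF b i(1,2) 2(1,2)] i(3) 2(3) by simp
      next
        case 3
        show ?thesis using join[OF 3 2(1,2) i(1,2)] i(3) 2(3) by simp
      qed
    qed
  qed
qed

definition keyp :: "monom \<Rightarrow> 'a::field mpoly" where
  "keyp a = (THE p. is_key_monom a p)"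

lemma is_key_keyp: "is_key_monom a (keyp a)"
  unfolding keyp_def by (rule theI') (metis is_key_monom_ex is_key_monom_unique)

lemma keyp_eqI: "is_key_monom a p \<Longrightarrow> keyp a = p"
  by (rule is_key_monom_unique[OF is_key_keyp])

lemma keyp_dominant: "dominant a \<Longrightarrow> keyp a = Poly_Mapping.single a 1"
  by (intro keyp_eqI is_key_monom.dom)

lemma keyp_sw: "Poly_Mapping.lookup a (Suc i) < Poly_Mapping.lookup a i \<Longrightarrow> keyp (sw i a) = xi i (keyp a)"
  by (intro keyp_eqI is_key_monom.step is_key_keyp)

lemma keyp_up: "Poly_Mapping.lookup a i < Poly_Mapping.lookup a (Suc i) \<Longrightarrow> keyp a = xi i (keyp (sw i a))"
  using keyp_sw[of "sw i a" i] by simp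

text \<open>
  If the entry \<open>i\<close> is the smaller one, \<open>\<xi>\<^sub>i\<close> was applied last and is idempotent. If the two entries
  are equal, the construction need not end with \<open>\<xi>\<^sub>i\<close>; then the braid relation carries the equality of
  the two entries through the last operators to a smaller exponent vector.
\<close>

lemma xi_keyp_le:
  "Poly_Mapping.lookup a i \<le> Poly_Mapping.lookup a (Suc i) \<Longrightarrow> xi i (keyp a) = (keyp a :: 'a::field mpoly)"
proof (induction "ell a" arbitrary: a i rule: less_induct)
  case less
  let ?L = "Poly_Mapping.lookup"
  note IH = less.hyps
  consider (lt) "?L a i < ?L a (Suc i)" | (eq) "?L a i = ?L a (Suc i)" using less.prems by linarith
  then show ?case
  proof cases
    case lt
    then show ?thesis by (simp add: keyp_up xi_idem)
  next
    case eq
    show ?thesis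
    proof (cases "dominant a")
      case True
      then show ?thesis
        by (simp add: keyp_dominant xi_of_sym perm_vars_adj_single sw_same[OF eq])
    next
      case False
      then obtain j where j: "?L a j < ?L a (Suc j)"
        by (auto simp: dominant_def not_le)
      have "i \<noteq> j" using eq j by auto
      let ?b = "sw j a"
      note less_b = ell_sw_less[OF j]
      have K: "keyp a = xi j (keyp ?b :: 'a mpoly)" by (rule keyp_up[OF j])
      consider "j = Suc i" | "i = Suc j" | "i \<noteq> Suc j" "j \<noteq> Suc i" by blast
      then show ?thesis
      proof cases
        case 1
        let ?c = "sw i ?b"
        have b: "?L ?b i < ?L ?b (Suc i)" using 1 eq j by auto
        have cK: "keyp ?b = xi i (keyp ?c :: 'a mpoly)" by (rule keyp_up[OF b])
        have "xi j (keyp ?c) = (keyp ?c :: 'a mpoly)"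
          using 1 eq j by (intro IH order.strict_trans[OF ell_sw_less[OF b] less_b]) auto
        then have "xi i (xi j (xi i (keyp ?c))) = xi j (xi i (keyp ?c :: 'a mpoly))"
          using xi_braid[of i "keyp ?c :: 'a mpoly"] 1 by simp
        then show ?thesis by (simp add: K cK)
      next
        case 2
        let ?c = "sw i ?b"
        have b: "?L ?b i < ?L ?b (Suc i)" using 2 eq j by auto
        have cK: "keyp ?b = xi i (keyp ?c :: 'a mpoly)" by (rule keyp_up[OF b])
        have "xi j (keyp ?c) = (keyp ?c :: 'a mpoly)"
          using 2 eq j by (intro IH order.strict_trans[OF ell_sw_less[OF b] less_b]) auto
        then have "xi i (xi j (xi i (keyp ?c))) = xi j (xi i (keyp ?c :: 'a mpoly))"
          using xi_braid[of j "keyp ?c :: 'a mpoly"] 2 by simp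
        then show ?thesis by (simp add: K cK)
      next
        case 3
        have "xi i (keyp ?b) = (keyp ?b :: 'a mpoly)"
          using 3 \<open>i \<noteq> j\<close> eq by (intro IH less_b) auto
        then show ?thesis using 3 \<open>i \<noteq> j\<close> xi_commute[of i j "keyp ?b :: 'a mpoly"] by (simp add: K)
      qed
    qed
  qed
qed

lemma nth_swap_entries:
  assumes "Suc i < length \<alpha>"
  shows "Poly_Mapping.nth (swap_entries i \<alpha>) = sw i (Poly_Mapping.nth \<alpha>)"
  using assms
  by (intro poly_mapping_eqI)
    (auto simp: lookup_sw transpose_def swap_entries_def nth_default_def nth_list_update)

lemma swap_entries_swap: "Suc i < length \<alpha> \<Longrightarrow> swap_entries i (swap_entries i \<alpha>) = \<alpha>"
  by (rule nth_equalityI) (auto simp: swap_entries_def nth_list_update)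

lemma is_key_imp_monom: "is_key \<alpha> p \<Longrightarrow> is_key_monom (Poly_Mapping.nth \<alpha>) p"
proof (induction rule: is_key.induct)
  case (1 \<alpha>)
  have "dominant (Poly_Mapping.nth \<alpha>)"
    unfolding dominant_def
  proof
    fix i
    show "Poly_Mapping.lookup (Poly_Mapping.nth \<alpha>) (Suc i) \<le> Poly_Mapping.lookup (Poly_Mapping.nth \<alpha>) i"
      using sorted_wrt_nth_less[OF 1, of i "Suc i"]
      by (cases "Suc i < length \<alpha>") (auto simp: nth_default_def)
  qed
  then show ?case unfolding mon_def by (rule is_key_monom.dom)
next
  case (2 \<alpha> p i)
  then show ?case
    by (auto simp: nth_swap_entries nth_default_def intro: is_key_monom.step)
qed

lemma is_key_ex: "\<exists>p. is_key \<alpha> (p :: 'a::field mpoly)"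
proof (induction "ell (Poly_Mapping.nth \<alpha>)" arbitrary: \<alpha> rule: less_induct)
  case less
  show ?case
  proof (cases "sorted_wrt (\<ge>) \<alpha>")
    case True
    then show ?thesis by (blast intro: is_key.intros)
  next
    case False
    then obtain i where i: "Suc i < length \<alpha>" "\<alpha> ! i < \<alpha> ! Suc i"
      by (auto simp: sorted_wrt_iff_nth_Suc_transp transp_def not_le)
    have "ell (Poly_Mapping.nth (swap_entries i \<alpha>)) < ell (Poly_Mapping.nth \<alpha>)"
      unfolding nth_swap_entries[OF i(1)] using i by (intro ell_sw_less) (simp add: nth_default_def)
    then obtain p :: "'a mpoly" where "is_key (swap_entries i \<alpha>) p" using less by blast
    then have "is_key (swap_entries i (swap_entries i \<alpha>)) (xi i p)"
      using i by (intro is_key.intros(2)) (auto simp: swap_entries_def)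
    then show ?thesis using swap_entries_swap[OF i(1)] by auto
  qed
qed

lemma key_eq_keyp: "key \<alpha> = (keyp (Poly_Mapping.nth \<alpha>) :: 'a::field mpoly)"
proof -
  obtain p :: "'a mpoly" where p: "is_key \<alpha> p" using is_key_ex by blast
  have "q = keyp (Poly_Mapping.nth \<alpha>)" if "is_key \<alpha> q" for q :: "'a mpoly"
    using keyp_eqI[OF is_key_imp_monom[OF that]] by simp
  with p show ?thesis unfolding key_def by (metis the_equality)
qed


section \<open>Key polynomials are unitriangular\<close>

definition weight :: "(nat \<Rightarrow> nat) \<Rightarrow> monom \<Rightarrow> nat" where
  "weight \<phi> m = (\<Sum>i\<in>Poly_Mapping.keys m. \<phi> (Poly_Mapping.lookup m i))"

abbreviation sqs :: "monom \<Rightarrow> nat" where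
  "sqs \<equiv> weight (\<lambda>a. a ^ 2)"

lemma mdeg_weight: "mdeg m = weight (\<lambda>a. a) m"
  by (simp add: mdeg_def weight_def)

lemma weight_sum:
  assumes "\<phi> 0 = 0" "Poly_Mapping.keys m \<subseteq> A" "finite A"
  shows "weight \<phi> m = (\<Sum>i\<in>A. \<phi> (Poly_Mapping.lookup m i))"
  unfolding weight_def using assms
  by (intro sum.mono_neutral_left) (auto simp: in_keys_iff)

definition same_line :: "nat \<Rightarrow> monom \<Rightarrow> monom \<Rightarrow> bool" where
  "same_line i m m' \<longleftrightarrow>
     Poly_Mapping.lookup m i + Poly_Mapping.lookup m (Suc i) = Poly_Mapping.lookup m' i + Poly_Mapping.lookup m' (Suc i)
     \<and> (\<forall>j. j \<noteq> i \<longrightarrow> j \<noteq> Suc i \<longrightarrow> Poly_Mapping.lookup m j = Poly_Mapping.lookup m' j)"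

lemma same_line_weight:
  assumes "same_line i m m'" "\<phi> 0 = 0"
  shows "weight \<phi> m + (\<phi> (Poly_Mapping.lookup m' i) + \<phi> (Poly_Mapping.lookup m' (Suc i)))
    = weight \<phi> m' + (\<phi> (Poly_Mapping.lookup m i) + \<phi> (Poly_Mapping.lookup m (Suc i)))"
proof -
  define A where "A = Poly_Mapping.keys m \<union> Poly_Mapping.keys m' \<union> {i, Suc i}"
  have fin: "finite A" by (simp add: A_def)
  have split: "weight \<phi> k = (\<phi> (Poly_Mapping.lookup k i) + \<phi> (Poly_Mapping.lookup k (Suc i)))
      + (\<Sum>j\<in>A - {i, Suc i}. \<phi> (Poly_Mapping.lookup k j))" if "Poly_Mapping.keys k \<subseteq> A" for k
  proof -
    have "weight \<phi> k = (\<Sum>j\<in>{i, Suc i} \<union> (A - {i, Suc i}). \<phi> (Poly_Mapping.lookup k j))"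
      using weight_sum[of \<phi>, OF assms(2) that fin] by (simp add: A_def insert_absorb Un_absorb1)
    also have "\<dots> = (\<Sum>j\<in>{i, Suc i}. \<phi> (Poly_Mapping.lookup k j)) + (\<Sum>j\<in>A - {i, Suc i}. \<phi> (Poly_Mapping.lookup k j))"
      using fin by (intro sum.union_disjoint) auto
    finally show ?thesis by simp
  qed
  have "(\<Sum>j\<in>A - {i, Suc i}. \<phi> (Poly_Mapping.lookup m j)) = (\<Sum>j\<in>A - {i, Suc i}. \<phi> (Poly_Mapping.lookup m' j))"
    using assms(1) by (intro sum.cong) (auto simp: same_line_def)
  moreover have "Poly_Mapping.keys m \<subseteq> A" "Poly_Mapping.keys m' \<subseteq> A" by (auto simp: A_def)
  ultimately show ?thesis using split[of m] split[of m'] by simp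
qed

lemma same_line_mdeg: "same_line i m m' \<Longrightarrow> mdeg m = mdeg m'"
  using same_line_weight[of i m m' "\<lambda>a. a"] by (simp add: mdeg_weight same_line_def)

lemma same_line_sw: "same_line i m (sw i m)"
  by (simp add: same_line_def)

lemma sqs_sw: "sqs (sw i m) = sqs m"
  using same_line_weight[OF same_line_sw[of i m], of "\<lambda>a. a ^ 2"] by simp

lemma mdeg_sw: "mdeg (sw i m) = mdeg m"
  using same_line_mdeg[OF same_line_sw[of i m]] by simp

lemma two_squares_less:
  fixes a b s t :: nat
  assumes "s + t = a + b" "min a b < s" "s < max a b"
  shows "s ^ 2 + t ^ 2 < a ^ 2 + b ^ 2"
proof -
  have "(int a - int s) * (int s - int b) > 0"
    using assms by (auto simp: zero_less_mult_iff min_def max_def split: if_splits)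
  moreover have t: "int t = int a + int b - int s" using assms(1) by linarith
  have "int a ^ 2 + int b ^ 2 - (int s ^ 2 + int t ^ 2) = 2 * ((int a - int s) * (int s - int b))"
    unfolding t by algebra
  ultimately have "int s ^ 2 + int t ^ 2 < int a ^ 2 + int b ^ 2"
    by linarith
  then show ?thesis by (simp flip: of_nat_power of_nat_add)
qed

lemma lookup_xi_monom:
  "Poly_Mapping.lookup (xi_monom i m :: 'a::comm_ring_1 mpoly) g =
    (if \<not> same_line i m g then 0
     else if Poly_Mapping.lookup m (Suc i) \<le> Poly_Mapping.lookup g i \<and> Poly_Mapping.lookup g i \<le> Poly_Mapping.lookup m i then 1
     else if Poly_Mapping.lookup m i < Poly_Mapping.lookup g i \<and> Poly_Mapping.lookup g i < Poly_Mapping.lookup m (Suc i) then - 1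
     else 0)"
proof -
  define a where "a = Poly_Mapping.lookup m i"
  define b where "b = Poly_Mapping.lookup m (Suc i)"
  have u: "set_pair i t (a + b - t) m = g \<longleftrightarrow> same_line i m g \<and> t = Poly_Mapping.lookup g i" if "t \<le> a + b" for t
  proof
    assume eq: "set_pair i t (a + b - t) m = g"
    show "same_line i m g \<and> t = Poly_Mapping.lookup g i"
      unfolding eq[symmetric] same_line_def lookup_set_pair using that by (simp add: a_def b_def)
  next
    assume "same_line i m g \<and> t = Poly_Mapping.lookup g i"
    then show "set_pair i t (a + b - t) m = g"
      by (intro poly_mapping_eqI) (auto simp: lookup_set_pair same_line_def a_def b_def)
  qed
  have S: "Poly_Mapping.lookup (\<Sum>t\<in>A. Poly_Mapping.single (set_pair i t (a + b - t) m) (1::'a)) g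
      = (if same_line i m g \<and> Poly_Mapping.lookup g i \<in> A then 1 else 0)"
    if "A \<subseteq> {..a + b}" "finite A" for A
  proof -
    have "Poly_Mapping.lookup (\<Sum>t\<in>A. Poly_Mapping.single (set_pair i t (a + b - t) m) (1::'a)) g
      = (\<Sum>t\<in>A. if t = Poly_Mapping.lookup g i then of_bool (same_line i m g) else 0)"
      unfolding lookup_sum using that(1)
      by (intro sum.cong refl) (auto simp: lookup_single when_def u subset_iff)
    then show ?thesis using that(2) by simp
  qed
  show ?thesis
  proof (cases "b \<le> a")
    case True
    then have "xi_monom i m = (\<Sum>t\<in>{b..a}. Poly_Mapping.single (set_pair i t (a + b - t) m) (1::'a))"
      by (simp only: xi_monom_def a_def[symmetric] b_def[symmetric] Let_def if_True)
    moreover have "{b..a} \<subseteq> {..a + b}" by auto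
    ultimately show ?thesis using S[of "{b..a}"] True
      by (simp add: a_def[symmetric] b_def[symmetric])
  next
    case False
    then have "xi_monom i m = - (\<Sum>t\<in>{a<..<b}. Poly_Mapping.single (set_pair i t (a + b - t) m) (1::'a))"
      by (simp only: xi_monom_def a_def[symmetric] b_def[symmetric] Let_def if_False)
    moreover have "{a<..<b} \<subseteq> {..a + b}" by auto
    ultimately show ?thesis using S[of "{a<..<b}"] False
      by (auto simp: a_def[symmetric] b_def[symmetric])
  qed
qed

lemma lookup_xi:
  "Poly_Mapping.lookup (xi i f) g =
    (\<Sum>m\<in>Poly_Mapping.keys f. Poly_Mapping.lookup f m * Poly_Mapping.lookup (xi_monom i m) g)"
  for f :: "'a::field mpoly"
  by (simp add: xi_eq_expand xi_expand_def lookup_sum lookup_scale_mult)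

text \<open>
  The exponents of the image of \<open>x\<^sup>m\<close> lie on the segment from \<open>m\<close> to its reflection, and strictly
  inside it the sum of squares has dropped.
\<close>

lemma xi_monom_support:
  assumes "Poly_Mapping.lookup (xi_monom i m :: 'a::comm_ring_1 mpoly) g \<noteq> 0"
  shows "same_line i m g \<and>
    (sqs g < sqs m \<or> g = m \<and> Poly_Mapping.lookup m (Suc i) \<le> Poly_Mapping.lookup m i
      \<or> g = sw i m \<and> Poly_Mapping.lookup m (Suc i) < Poly_Mapping.lookup m i)"
proof -
  let ?L = "Poly_Mapping.lookup"
  have line: "same_line i m g"
    using assms by (auto simp: lookup_xi_monom split: if_splits)
  have w: "sqs m + ((?L g i)^2 + (?L g (Suc i))^2) = sqs g + ((?L m i)^2 + (?L m (Suc i))^2)"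
    using same_line_weight[OF line, of "\<lambda>a. a ^ 2"] by simp
  have sum: "?L g i + ?L g (Suc i) = ?L m i + ?L m (Suc i)"
    using line by (simp add: same_line_def)
  have ends: "?L g i = ?L m i \<Longrightarrow> g = m" "?L g i = ?L m (Suc i) \<Longrightarrow> g = sw i m"
    using line by (auto simp: same_line_def poly_mapping_eq_iff fun_eq_iff lookup_sw transpose_def)
  have inside: "sqs g < sqs m" if "min (?L m i) (?L m (Suc i)) < ?L g i" "?L g i < max (?L m i) (?L m (Suc i))"
    using two_squares_less[OF sum that] w by linarith
  have "?L m (Suc i) \<le> ?L g i \<and> ?L g i \<le> ?L m i \<or> ?L m i < ?L g i \<and> ?L g i < ?L m (Suc i)"
    using assms by (auto simp: lookup_xi_monom split: if_splits)
  then show ?thesis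
    using line inside ends by (cases "?L g i = ?L m i"; cases "?L g i = ?L m (Suc i)") auto
qed

lemma xi_support:
  assumes "g \<in> Poly_Mapping.keys (xi i (f :: 'a::field mpoly))"
  obtains m where "m \<in> Poly_Mapping.keys f" "Poly_Mapping.lookup (xi_monom i m :: 'a mpoly) g \<noteq> 0"
proof -
  have "(\<Sum>m\<in>Poly_Mapping.keys f. Poly_Mapping.lookup f m * Poly_Mapping.lookup (xi_monom i m) g) \<noteq> 0"
    using assms by (simp add: in_keys_iff lookup_xi)
  then obtain m where "m \<in> Poly_Mapping.keys f" "Poly_Mapping.lookup f m * Poly_Mapping.lookup (xi_monom i m) g \<noteq> 0"
    by (rule sum.not_neutral_contains_not_neutral)
  then show ?thesis by (intro that) auto
qed

definition prec :: "monom \<Rightarrow> monom \<Rightarrow> bool" where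
  "prec b a \<longleftrightarrow> sqs b < sqs a \<or> sqs b = sqs a \<and> bruhat_le b a"

lemma bruhat_refl: "bruhat_le a a"
  by (simp add: bruhat_le_def)

lemma bruhat_trans: "bruhat_le a b \<Longrightarrow> bruhat_le b c \<Longrightarrow> bruhat_le a c"
  unfolding bruhat_le_def by (meson order_trans)

text \<open>
  Only the tail counts starting at \<open>Suc i\<close> change. If those starting at \<open>Suc (Suc i)\<close> agree, then the
  counts starting at \<open>i\<close> force the larger of the two entries of \<open>a\<close> to reach each bound that the larger entry of \<open>b\<close> reaches.
\<close>

lemma bruhat_sw_sw:
  assumes le: "bruhat_le b a" and a: "Poly_Mapping.lookup a (Suc i) < Poly_Mapping.lookup a i"
    and b: "Poly_Mapping.lookup b (Suc i) < Poly_Mapping.lookup b i"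
  shows "bruhat_le (sw i b) (sw i a)"
  unfolding bruhat_le_def
proof (intro allI impI)
  fix j c :: nat assume c: "c \<ge> 1"
  have t: "tail_count b i c \<le> tail_count a i c" "tail_count b (Suc (Suc i)) c \<le> tail_count a (Suc (Suc i)) c"
    "tail_count b j c \<le> tail_count a j c"
    using le c by (auto simp: bruhat_le_def)
  consider "j \<le> i" | "j = Suc i" | "Suc i < j" by linarith
  then show "tail_count (sw i b) j c \<le> tail_count (sw i a) j c"
  proof cases
    case 2
    have "tail_count b (Suc (Suc i)) c + of_bool (c \<le> Poly_Mapping.lookup b i)
        \<le> tail_count a (Suc (Suc i)) c + of_bool (c \<le> Poly_Mapping.lookup a i)"
      using t(1,2) a b unfolding tail_count_step[OF c, of _ i] tail_count_step[OF c, of _ "Suc i"]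
      by (auto simp: of_bool_def split: if_splits)
    then show ?thesis using 2 by (simp add: tail_count_sw_mid[OF c])
  qed (use t(3) c in \<open>simp_all add: tail_count_sw_below tail_count_sw_above\<close>)
qed


text \<open>
  An operator \<open>\<xi>\<^sub>i\<close> either lowers the sum of squares or keeps or reflects an exponent vector, and in the
  second case it respects the Bruhat order. The Bruhat order alone does not suffice, because the inner
  monomials of a segment are no rearrangements of its ends.
\<close>

lemma is_key_monom_triangular:
  assumes "is_key_monom a (p :: 'a::field mpoly)"
  shows "(\<forall>b\<in>Poly_Mapping.keys p. mdeg b = mdeg a \<and> prec b a) \<and> Poly_Mapping.lookup p a = 1"
  using assms
proof induction
  case (dom a)
  then show ?case by (simp add: prec_def bruhat_refl)
next
  case (step a p i)
  let ?L = "Poly_Mapping.lookup"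
  have up: "bruhat_le a (sw i a)"
    using bruhat_sw[of "sw i a" i] step.hyps(2) by simp
  have "mdeg g = mdeg (sw i a) \<and> prec g (sw i a)" if g: "g \<in> Poly_Mapping.keys (xi i p)" for g
  proof -
    obtain m where m: "m \<in> Poly_Mapping.keys p" "Poly_Mapping.lookup (xi_monom i m :: 'a mpoly) g \<noteq> 0"
      using g by (rule xi_support)
    note s = xi_monom_support[OF m(2)]
    have "mdeg g = mdeg (sw i a)"
      using s m(1) step.IH same_line_mdeg[of i m g] by (auto simp: mdeg_sw)
    moreover have "prec g (sw i a)"
      using s m(1) step.IH step.hyps(2) bruhat_trans[OF _ up] bruhat_sw_sw[of m a i]
      by (auto simp: prec_def sqs_sw)
    ultimately show ?thesis by simp
  qed
  moreover have "?L (xi i p) (sw i a) = 1"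
  proof -
    have z: "?L p m * ?L (xi_monom i m) (sw i a) = 0" if "m \<in> Poly_Mapping.keys p - {a}" for m
    proof (rule ccontr)
      assume "\<not> ?thesis"
      then have "?L (xi_monom i m :: 'a mpoly) (sw i a) \<noteq> 0" by auto
      note s = xi_monom_support[OF this]
      have "prec m a" using that step.IH by blast
      then have "\<not> sqs a < sqs m" by (auto simp: prec_def)
      moreover have "sw i a \<noteq> m \<or> \<not> ?L m (Suc i) \<le> ?L m i"
        using step.hyps(2) by auto
      moreover have "sw i a \<noteq> sw i m"
        using that by (metis DiffD2 insertI1 sw_sw)
      ultimately show False using s by (auto simp: sqs_sw)
    qed
    have "a \<in> Poly_Mapping.keys p" using step.IH by (simp add: in_keys_iff)
    then have "?L (xi i p) (sw i a) = ?L p a * ?L (xi_monom i a) (sw i a)"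
      unfolding lookup_xi using sum.neutral[of "Poly_Mapping.keys p - {a}", OF ballI[OF z]]
      by (simp add: sum.remove[of _ a])
    also have "\<dots> = 1"
      using step.hyps(2) step.IH by (simp add: lookup_xi_monom same_line_sw)
    finally show ?thesis .
  qed
  ultimately show ?case by blast
qed

lemma is_key_monom_vars:
  assumes "is_key_monom a (p :: 'a::field mpoly)" "Poly_Mapping.keys a \<subseteq> {..<n}" "b \<in> Poly_Mapping.keys p"
  shows "Poly_Mapping.keys b \<subseteq> {..<n}"
  using assms
proof (induction arbitrary: b)
  case (dom a)
  then show ?case by simp
next
  case (step a p i)
  have i: "Suc i < n"
    using step.prems(1) step.hyps(2) by (auto simp: in_keys_iff subset_iff)
  have "Poly_Mapping.keys a \<subseteq> {..<n}"
  proof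
    fix j assume "j \<in> Poly_Mapping.keys a"
    then have "adj i j \<in> Poly_Mapping.keys (sw i a)" by (simp add: in_keys_iff lookup_sw)
    then have "adj i j < n" using step.prems(1) by auto
    then show "j \<in> {..<n}" using i by (auto simp: transpose_def split: if_splits)
  qed
  note IH = step.IH[OF this]
  obtain m where m: "m \<in> Poly_Mapping.keys p" "Poly_Mapping.lookup (xi_monom i m :: 'a mpoly) b \<noteq> 0"
    using step.prems(2) by (rule xi_support)
  have "same_line i m b" using xi_monom_support[OF m(2)] by simp
  show ?case
  proof
    fix j assume "j \<in> Poly_Mapping.keys b"
    then have "j = i \<or> j = Suc i \<or> j \<in> Poly_Mapping.keys m"
      using \<open>same_line i m b\<close> by (auto simp: same_line_def in_keys_iff)
    then show "j \<in> {..<n}" using i IH[OF m(1)] by auto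
  qed
qed

lemma is_key_monom_Ints:
  "is_key_monom a (p :: 'a::field mpoly) \<Longrightarrow> Poly_Mapping.lookup p b \<in> \<int>"
proof (induction arbitrary: b rule: is_key_monom.induct)
  case (dom a)
  then show ?case by (simp add: lookup_single when_def)
next
  case (step a p i)
  have "Poly_Mapping.lookup (xi_monom i m :: 'a mpoly) b \<in> \<int>" for m
    by (simp add: lookup_xi_monom)
  then show ?case unfolding lookup_xi by (intro Ints_sum Ints_mult step.IH)
qed

lemma keyp_mdeg: "b \<in> Poly_Mapping.keys (keyp a :: 'a::field mpoly) \<Longrightarrow> mdeg b = mdeg a"
  and keyp_prec: "b \<in> Poly_Mapping.keys (keyp a :: 'a::field mpoly) \<Longrightarrow> prec b a"
  and keyp_lead: "Poly_Mapping.lookup (keyp a :: 'a::field mpoly) a = 1"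
  using is_key_monom_triangular[OF is_key_keyp[of a], where 'a='a] by blast+

lemma keyp_vars: "Poly_Mapping.keys a \<subseteq> {..<n} \<Longrightarrow> b \<in> Poly_Mapping.keys (keyp a :: 'a::field mpoly) \<Longrightarrow>
    Poly_Mapping.keys b \<subseteq> {..<n}"
  by (rule is_key_monom_vars[OF is_key_keyp])

lemma keyp_Ints: "Poly_Mapping.lookup (keyp a :: 'a::field mpoly) b \<in> \<int>"
  by (rule is_key_monom_Ints[OF is_key_keyp])

section \<open>The Weyl symmetrizer\<close>

definition weyl_prod :: "nat \<Rightarrow> nat \<Rightarrow> (nat \<Rightarrow> 'b::field) \<Rightarrow> 'b" where
  "weyl_prod k n y = (\<Prod>i\<in>{k..<n}. \<Prod>j\<in>{i<..<n}. 1 / (1 - y j / y i))"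

text \<open>The constant \<open>1\<close> is interpolated at the nodes \<open>1 / x\<^sub>a\<close> and then evaluated at \<open>0\<close>.\<close>

lemma lagrange_sum:
  fixes x :: "'i \<Rightarrow> 'b::field"
  assumes fin: "finite S" and ne: "S \<noteq> {}" and inj: "inj_on x S" and nz: "\<And>i. i \<in> S \<Longrightarrow> x i \<noteq> 0"
  shows "(\<Sum>a\<in>S. \<Prod>j\<in>S - {a}. 1 / (1 - x j / x a)) = 1"
proof -
  define L where "L a = (\<Prod>j\<in>S - {a}. smult (1 / (1 - x j / x a)) [:1, - x j:])" for a
  define P where "P = (\<Sum>a\<in>S. L a) - 1"
  have nz': "1 - x j / x a \<noteq> 0" if "a \<in> S" "j \<in> S - {a}" for a j
    using that nz[of a] inj by (auto simp: inj_on_def)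
  have poly_L: "poly (L a) z = (\<Prod>j\<in>S - {a}. 1 / (1 - x j / x a) * (1 - z * x j))" for a z
    unfolding L_def poly_prod poly_smult by (intro prod.cong refl arg_cong[where f = "(*) _"]) simp
  have L1: "poly (L a) (1 / x a) = 1" if "a \<in> S" for a
  proof -
    have "poly (L a) (1 / x a) = (\<Prod>j\<in>S - {a}. 1 / (1 - x j / x a) * (1 - x j / x a))"
      by (simp only: poly_L) simp
    also have "\<dots> = 1" using nz'[OF that] by (intro prod.neutral) auto
    finally show ?thesis .
  qed
  have L0: "poly (L a) (1 / x b) = 0" if "b \<in> S" "a \<noteq> b" for a b
  proof -
    have "b \<in> S - {a}" "x b \<noteq> 0" using that nz by auto
    then show ?thesis using fin by (auto simp: poly_L intro!: bexI[of _ b])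
  qed
  have root: "poly P (1 / x b) = 0" if "b \<in> S" for b
  proof -
    have "(\<Sum>a\<in>S. poly (L a) (1 / x b)) = (\<Sum>a\<in>S. if a = b then 1 else 0)"
      using L0[OF that] L1[OF that] by (intro sum.cong) auto
    then show ?thesis using fin that by (simp add: P_def poly_sum)
  qed
  have "degree (L a) \<le> card S - 1" if "a \<in> S" for a
  proof -
    have "degree (L a) \<le> (\<Sum>j\<in>S - {a}. degree (smult (1 / (1 - x j / x a)) [:1, - x j:]))"
      unfolding L_def by (rule order_trans[OF degree_prod_sum_le]) (use fin in auto)
    also have "\<dots> \<le> (\<Sum>j\<in>S - {a}. 1)"
      by (intro sum_mono) (auto intro: order_trans[OF degree_smult_le])
    finally show ?thesis using that fin by simp
  qed
  then have deg: "degree P \<le> card S - 1"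
    unfolding P_def by (intro degree_diff_le degree_sum_le) (use fin in auto)
  have "P = 0"
  proof (rule ccontr)
    assume "P \<noteq> 0"
    have "inj_on (\<lambda>b. 1 / x b) S" using inj by (auto simp: inj_on_def)
    then have "card S = card ((\<lambda>b. 1 / x b) ` S)" by (simp add: card_image)
    also have "\<dots> \<le> card {z. poly P z = 0}"
      using root \<open>P \<noteq> 0\<close> by (intro card_mono poly_roots_finite) auto
    also have "\<dots> \<le> degree P" by (rule card_poly_roots_bound[OF \<open>P \<noteq> 0\<close>])
    finally show False using deg fin ne by (cases "card S") auto
  qed
  then have "poly P 0 = 0" by simp
  then show ?thesis by (simp add: P_def poly_sum poly_L)
qed

lemma weyl_prod_first:
  assumes "k < n"
  shows "weyl_prod k n y = (\<Prod>j\<in>{k<..<n}. 1 / (1 - y j / y k)) * weyl_prod (Suc k) n y"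
proof -
  have "{k..<n} = insert k {Suc k..<n}" using assms by auto
  then show ?thesis by (simp add: weyl_prod_def)
qed

text \<open>
  The symmetrizer maps \<open>1\<close> to \<open>1\<close>: summing first over the permutations with a given value at
  \<open>k\<close> leaves, by induction, the sum in \<open>lagrange_sum\<close>.
\<close>

lemma weyl_sum:
  fixes x :: "nat \<Rightarrow> 'b::field"
  assumes "k \<le> n" "inj_on x {k..<n}" "\<And>i. i \<in> {k..<n} \<Longrightarrow> x i \<noteq> 0"
  shows "(\<Sum>\<sigma> | \<sigma> permutes {k..<n}. weyl_prod k n (x \<circ> \<sigma>)) = 1"
  using assms
proof (induction k arbitrary: x rule: inc_induct)
  case base
  have "{\<sigma>. \<sigma> permutes {n..<n}} = {id}" by auto
  then show ?case by (simp add: weyl_prod_def)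
next
  case (step k)
  have S: "{k..<n} = insert k {Suc k..<n}" and gt: "{k<..<n} = {Suc k..<n}" using step.hyps by auto
  have inner: "(\<Sum>q | q permutes {Suc k..<n}. weyl_prod k n (x \<circ> (transpose k b \<circ> q)))
      = (\<Prod>j\<in>{k..<n} - {b}. 1 / (1 - x j / x b))" if b: "b \<in> {k..<n}" for b
  proof -
    let ?t = "transpose k b"
    have t: "?t permutes {k..<n}"
      using b step.hyps by (intro permutes_swap_id) auto
    have head: "(\<Prod>j\<in>{k<..<n}. 1 / (1 - x (?t (q j)) / x (?t (q k)))) = (\<Prod>j\<in>{k..<n} - {b}. 1 / (1 - x j / x b))"
      if q: "q permutes {Suc k..<n}" for q
    proof -
      have qk: "q k = k" using q by (simp add: permutes_def)
      have "(\<Prod>j\<in>{k<..<n}. 1 / (1 - x (?t (q j)) / x b)) = (\<Prod>j\<in>{k<..<n}. 1 / (1 - x (?t j) / x b))"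
        unfolding gt using prod.permute[OF q, of "\<lambda>j. 1 / (1 - x (?t j) / x b)"] by (simp add: o_def)
      also have "\<dots> = (\<Prod>j\<in>{k..<n} - {b}. 1 / (1 - x j / x b))"
        using b by (intro prod.reindex_bij_witness[of _ ?t ?t]) (auto simp: transpose_def split: if_splits)
      finally show ?thesis by (simp add: qk)
    qed
    have "(\<Sum>q | q permutes {Suc k..<n}. weyl_prod (Suc k) n ((x \<circ> ?t) \<circ> q)) = 1"
    proof (rule step.IH)
      have "inj_on (x \<circ> ?t) {k..<n}"
        using step.prems(1) permutes_image[OF t] permutes_inj_on[OF t] by (intro comp_inj_on) auto
      then show "inj_on (x \<circ> ?t) {Suc k..<n}" by (rule inj_on_subset) auto
      show "(x \<circ> ?t) i \<noteq> 0" if "i \<in> {Suc k..<n}" for i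
        using step.prems(2)[of "?t i"] permutes_in_image[OF t, of i] that by auto
    qed
    moreover have "weyl_prod k n (x \<circ> (?t \<circ> q)) =
        (\<Prod>j\<in>{k..<n} - {b}. 1 / (1 - x j / x b)) * weyl_prod (Suc k) n ((x \<circ> ?t) \<circ> q)"
      if "q permutes {Suc k..<n}" for q
      using weyl_prod_first[of k n "x \<circ> (?t \<circ> q)"] step.hyps head[OF that] by (simp add: o_assoc)
    ultimately show ?thesis
      by (simp add: sum_distrib_left[symmetric])
  qed
  have "(\<Sum>\<sigma> | \<sigma> permutes {k..<n}. weyl_prod k n (x \<circ> \<sigma>))
      = (\<Sum>b\<in>{k..<n}. \<Sum>q | q permutes {Suc k..<n}. weyl_prod k n (x \<circ> (transpose k b \<circ> q)))"
    unfolding S by (rule sum_over_permutations_insert) auto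
  also have "\<dots> = (\<Sum>b\<in>{k..<n}. \<Prod>j\<in>{k..<n} - {b}. 1 / (1 - x j / x b))"
    by (intro sum.cong refl inner)
  also have "\<dots> = 1"
    using step.prems step.hyps by (intro lagrange_sum) auto
  finally show ?case .
qed

text \<open>The transposition permutes the factors of all pairs but \<open>(i, Suc i)\<close>, whose entries it exchanges.\<close>

lemma weyl_prod_swap:
  fixes y :: "nat \<Rightarrow> 'b::field"
  assumes "k \<le> i" "Suc i < n"
  shows "weyl_prod k n (y \<circ> adj i) * (1 / (1 - y (Suc i) / y i))
    = weyl_prod k n y * (1 / (1 - y i / y (Suc i)))"
proof -
  define P where "P = Sigma {k..<n} (\<lambda>i. {i<..<n}) - {(i, Suc i)}"
  have fin: "finite P" by (simp add: P_def)
  have split: "weyl_prod k n z = (1 / (1 - z (Suc i) / z i)) * (\<Prod>(a, b)\<in>P. 1 / (1 - z b / z a))" for z :: "nat \<Rightarrow> 'b"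
  proof -
    have "weyl_prod k n z = (\<Prod>(a, b)\<in>Sigma {k..<n} (\<lambda>i. {i<..<n}). 1 / (1 - z b / z a))"
      unfolding weyl_prod_def by (rule prod.Sigma) auto
    also have "\<dots> = (\<Prod>(a, b)\<in>insert (i, Suc i) P. 1 / (1 - z b / z a))"
      using assms by (intro prod.cong) (auto simp: P_def)
    also have "(i, Suc i) \<notin> P" by (simp add: P_def)
    then have "(\<Prod>(a, b)\<in>insert (i, Suc i) P. 1 / (1 - z b / z a))
        = (1 / (1 - z (Suc i) / z i)) * (\<Prod>(a, b)\<in>P. 1 / (1 - z b / z a))"
      using fin by simp
    finally show ?thesis .
  qed
  have "(\<Prod>(a, b)\<in>P. 1 / (1 - (y \<circ> adj i) b / (y \<circ> adj i) a)) = (\<Prod>(a, b)\<in>P. 1 / (1 - y b / y a))"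
    by (rule prod.reindex_bij_witness[of _ "\<lambda>(a, b). (adj i a, adj i b)" "\<lambda>(a, b). (adj i a, adj i b)"])
      (use assms in \<open>auto simp: P_def transpose_def split: if_splits\<close>)
  then show ?thesis by (simp add: split[of y] split[of "y \<circ> adj i"])
qed

definition weyl_sym :: "nat \<Rightarrow> nat \<Rightarrow> 'a::field mpoly \<Rightarrow> 'a mpoly fract" where
  "weyl_sym k n f = (\<Sum>\<sigma> | \<sigma> permutes {k..<n}.
     to_fract (perm_vars \<sigma> f) * weyl_prod k n (\<lambda>i. to_fract (var (\<sigma> i))))"

lemma W_fin_eqI: "weyl_sym k n f = to_fract g \<Longrightarrow> W_fin k n f = g"
  unfolding W_fin_def weyl_sym_def weyl_prod_def
  by (intro the_equality) auto

text \<open>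
  Writing \<open>\<xi>\<^sub>i f\<close> as a sum of two terms exchanged by the transposition and shifting the summation index in the
  second term collects the coefficients of \<open>\<sigma> f\<close> into \<open>a / (a - b) (w(\<sigma>) + w(\<sigma> s\<^sub>i)) = w(\<sigma>)\<close>, where \<open>a\<close> and \<open>b\<close> are the
  images of the two variables and \<open>w\<close> is the Weyl product.
\<close>

lemma weyl_sym_xi:
  fixes f :: "'a::field mpoly"
  assumes "k \<le> i" "Suc i < n"
  shows "weyl_sym k n (xi i f) = weyl_sym k n f"
proof -
  define X where "X j = (to_fract (var j) :: 'a mpoly fract)" for j
  define w where "w \<sigma> = weyl_prod k n (\<lambda>j. X (\<sigma> j))" for \<sigma>
  define F where "F \<sigma> = to_fract (perm_vars \<sigma> f)" for \<sigma>
  let ?S = "{\<sigma>. \<sigma> permutes {k..<n}}"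
  have X_nz: "X j \<noteq> 0" for j by (simp add: X_def var_nz)
  have X_eq: "X a = X b \<longleftrightarrow> a = b" for a b
    using var_neq[of a b, where 'a='a] by (auto simp: X_def)
  have adj: "adj i permutes {k..<n}" using assms by (intro permutes_swap_id) auto
  have ne: "\<sigma> i \<noteq> \<sigma> (Suc i)" if "\<sigma> \<in> ?S" for \<sigma>
    using permutes_inj[of \<sigma> "{k..<n}"] that by (auto simp: inj_eq)
  have summand: "to_fract (perm_vars \<sigma> (xi i f)) * w \<sigma> =
      X (\<sigma> i) / (X (\<sigma> i) - X (\<sigma> (Suc i))) * F \<sigma> * w \<sigma>
      - X (\<sigma> (Suc i)) / (X (\<sigma> i) - X (\<sigma> (Suc i))) * F (\<sigma> \<circ> adj i) * w \<sigma>" if "\<sigma> \<in> ?S" for \<sigma>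
  proof -
    have "bij \<sigma>" using that by (simp add: permutes_bij)
    have "X (\<sigma> i) - X (\<sigma> (Suc i)) \<noteq> 0" using ne[OF that] by (simp add: X_eq)
    moreover have "to_fract ((var (\<sigma> i) - var (\<sigma> (Suc i))) * perm_vars \<sigma> (xi i f))
        = to_fract (var (\<sigma> i) * perm_vars \<sigma> f - var (\<sigma> (Suc i)) * perm_vars (\<sigma> \<circ> adj i) f)"
      by (rule arg_cong[OF perm_xi_eq[OF \<open>bij \<sigma>\<close>]])
    then have "(X (\<sigma> i) - X (\<sigma> (Suc i))) * to_fract (perm_vars \<sigma> (xi i f))
        = X (\<sigma> i) * F \<sigma> - X (\<sigma> (Suc i)) * F (\<sigma> \<circ> adj i)"
      by (simp only: X_def F_def to_fract_mult to_fract_diff)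
    ultimately have "to_fract (perm_vars \<sigma> (xi i f))
        = (X (\<sigma> i) * F \<sigma> - X (\<sigma> (Suc i)) * F (\<sigma> \<circ> adj i)) / (X (\<sigma> i) - X (\<sigma> (Suc i)))"
      by (metis nonzero_mult_div_cancel_left)
    then show ?thesis by (simp add: diff_divide_distrib left_diff_distrib)
  qed
  have "(\<Sum>\<sigma>\<in>?S. X (\<sigma> (Suc i)) / (X (\<sigma> i) - X (\<sigma> (Suc i))) * F (\<sigma> \<circ> adj i) * w \<sigma>)
      = (\<Sum>\<sigma>\<in>?S. X (\<sigma> i) / (X (\<sigma> (Suc i)) - X (\<sigma> i)) * F \<sigma> * w (\<sigma> \<circ> adj i))"
    by (rule sum.reindex_bij_witness[of _ "\<lambda>\<sigma>. \<sigma> \<circ> adj i" "\<lambda>\<sigma>. \<sigma> \<circ> adj i"])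
      (use adj in \<open>auto simp: o_assoc[symmetric] intro: permutes_compose\<close>)
  then have "(\<Sum>\<sigma>\<in>?S. to_fract (perm_vars \<sigma> (xi i f)) * w \<sigma>)
      = (\<Sum>\<sigma>\<in>?S. X (\<sigma> i) / (X (\<sigma> i) - X (\<sigma> (Suc i))) * F \<sigma> * w \<sigma>
        - X (\<sigma> i) / (X (\<sigma> (Suc i)) - X (\<sigma> i)) * F \<sigma> * w (\<sigma> \<circ> adj i))"
    by (simp add: summand sum_subtractf)
  also have "\<dots> = (\<Sum>\<sigma>\<in>?S. F \<sigma> * w \<sigma>)"
  proof (rule sum.cong[OF refl])
    fix \<sigma> assume \<sigma>: "\<sigma> \<in> ?S"
    define a where "a = X (\<sigma> i)"
    define b where "b = X (\<sigma> (Suc i))"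
    have ab: "a \<noteq> 0" "b \<noteq> 0" "a - b \<noteq> 0" "b - a \<noteq> 0"
      using X_nz ne[OF \<sigma>] by (auto simp: a_def b_def X_eq)
    have "w (\<sigma> \<circ> adj i) * (1 / (1 - b / a)) = w \<sigma> * (1 / (1 - a / b))"
      using weyl_prod_swap[OF assms, of "\<lambda>j. X (\<sigma> j)"] by (simp add: w_def a_def b_def o_def)
    moreover have "1 / (1 - b / a) = a / (a - b)" "1 / (1 - a / b) = b / (b - a)"
      using ab by (simp_all add: field_simps)
    ultimately have "a / (b - a) * w (\<sigma> \<circ> adj i) = - (w \<sigma> * (b / (b - a)))"
      using ab by (simp add: field_simps)
    then have "a / (a - b) * w \<sigma> - a / (b - a) * w (\<sigma> \<circ> adj i) = a / (a - b) * w \<sigma> + w \<sigma> * (b / (b - a))"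
      by simp
    also have "\<dots> = w \<sigma>"
      using ab by (simp add: divide_simps) (simp add: algebra_simps)
    finally have "F \<sigma> * (a / (a - b) * w \<sigma> - a / (b - a) * w (\<sigma> \<circ> adj i)) = F \<sigma> * w \<sigma>" by simp
    then show "X (\<sigma> i) / (X (\<sigma> i) - X (\<sigma> (Suc i))) * F \<sigma> * w \<sigma>
        - X (\<sigma> i) / (X (\<sigma> (Suc i)) - X (\<sigma> i)) * F \<sigma> * w (\<sigma> \<circ> adj i) = F \<sigma> * w \<sigma>"
      unfolding a_def b_def by (simp only: right_diff_distrib mult_ac)
  qed
  finally show ?thesis by (simp add: weyl_sym_def w_def F_def X_def)
qed

definition sym_between :: "nat \<Rightarrow> nat \<Rightarrow> (monom \<Rightarrow> 'b) \<Rightarrow> bool" where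
  "sym_between k n F \<longleftrightarrow> (\<forall>i m. k \<le> i \<longrightarrow> Suc i < n \<longrightarrow> F (sw i m) = F m)"

lemma sym_between_transpose:
  assumes F: "sym_between k n F" and "k \<le> a"
  shows "a < b \<Longrightarrow> b < n \<Longrightarrow> F (Poly_Mapping.map_key (transpose a b) m) = F m"
proof (induction b arbitrary: m)
  case 0
  then show ?case by simp
next
  case (Suc b)
  show ?case
  proof (cases "a = b")
    case True
    then show ?thesis using F Suc.prems \<open>k \<le> a\<close> by (auto simp: sym_between_def sw_def)
  next
    case False
    then have ab: "a < b" "b < n" "k \<le> b" using Suc.prems \<open>k \<le> a\<close> by auto
    have "Poly_Mapping.map_key (transpose a (Suc b)) m = sw b (Poly_Mapping.map_key (transpose a b) (sw b m))"
      using ab(1) by (intro poly_mapping_eqI) (auto simp: lookup_sw lookup_map_key transpose_def)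
    then show ?thesis
      using Suc.IH[OF ab(1,2)] F ab(3) Suc.prems(2) by (simp add: sym_between_def)
  qed
qed

lemma sym_between_permutes:
  assumes F: "sym_between k n F" and "\<sigma> permutes {k..<n}"
  shows "F (Poly_Mapping.map_key \<sigma> m) = F m"
  using assms(2) finite_atLeastLessThan
proof (induction arbitrary: m rule: permutes_induct)
  case id
  then show ?case by (simp add: map_key_id id_def)
next
  case (swap a b p)
  have tr: "F (Poly_Mapping.map_key (transpose a b) m) = F m" for m
    using sym_between_transpose[OF F, of a b] sym_between_transpose[OF F, of b a] swap.hyps
    by (cases "a < b") (auto simp: transpose_commute)
  have "Poly_Mapping.map_key (transpose a b \<circ> p) m = Poly_Mapping.map_key p (Poly_Mapping.map_key (transpose a b) m)"
    using swap.hyps by (simp add: map_key_comp permutes_bij)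
  then show ?case by (simp only: swap.IH tr)
qed

lemma weyl_sym_symmetric:
  fixes g :: "'a::field mpoly"
  assumes "k \<le> n" "\<And>i. k \<le> i \<Longrightarrow> Suc i < n \<Longrightarrow> perm_vars (adj i) g = g"
  shows "weyl_sym k n g = to_fract g"
proof -
  let ?X = "\<lambda>j. to_fract (var j) :: 'a mpoly fract"
  have "sym_between k n (Poly_Mapping.lookup g)"
    using assms(2) by (auto simp: sym_between_def simp flip: lookup_perm_adj)
  then have "perm_vars \<sigma> g = g" if "\<sigma> permutes {k..<n}" for \<sigma>
    using that by (intro poly_mapping_eqI) (simp add: lookup_perm_vars permutes_bij sym_between_permutes)
  then have "weyl_sym k n g = (\<Sum>\<sigma> | \<sigma> permutes {k..<n}. to_fract g * weyl_prod k n (?X \<circ> \<sigma>))"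
    unfolding weyl_sym_def by (intro sum.cong) (auto simp: o_def)
  also have "\<dots> = to_fract g * (\<Sum>\<sigma> | \<sigma> permutes {k..<n}. weyl_prod k n (?X \<circ> \<sigma>))"
    by (simp add: sum_distrib_left)
  also have "(\<Sum>\<sigma> | \<sigma> permutes {k..<n}. weyl_prod k n (?X \<circ> \<sigma>)) = 1"
  proof (rule weyl_sum)
    show "inj_on ?X {k..<n}"
      using var_neq[where 'a='a] by (auto simp: inj_on_def)
  qed (use assms(1) var_nz[where 'a='a] in auto)
  finally show ?thesis by simp
qed

text \<open>
  A word in the operators that act on the variables with indices from \<open>k\<close> to \<open>n - 1\<close>. Keeping the word
  arbitrary avoids reduced words of the longest permutation.
\<close>

inductive xi_chain :: "nat \<Rightarrow> nat \<Rightarrow> 'a::field mpoly \<Rightarrow> 'a mpoly \<Rightarrow> bool" for k n where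
  start: "xi_chain k n f f"
| step: "xi_chain k n f g \<Longrightarrow> k \<le> i \<Longrightarrow> Suc i < n \<Longrightarrow> xi_chain k n f (xi i g)"

lemma xi_chain_weyl_sym: "xi_chain k n f g \<Longrightarrow> weyl_sym k n g = weyl_sym k n f"
  by (induction rule: xi_chain.induct) (simp_all add: weyl_sym_xi)

lemma W_fin_chain:
  assumes "xi_chain k n f g" "k \<le> n" "\<And>i. k \<le> i \<Longrightarrow> Suc i < n \<Longrightarrow> perm_vars (adj i) g = g"
  shows "W_fin k n f = g"
  using xi_chain_weyl_sym[OF assms(1)] weyl_sym_symmetric[OF assms(2,3)]
  by (intro W_fin_eqI) simp

lemma xi_chain_trans: "xi_chain k n g h \<Longrightarrow> xi_chain k n f g \<Longrightarrow> xi_chain k n f h"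
  by (induction rule: xi_chain.induct) (auto intro: xi_chain.intros)


section \<open>Setting variables to zero\<close>

lift_definition res :: "nat \<Rightarrow> 'a::zero mpoly \<Rightarrow> 'a mpoly" is
  "\<lambda>n p m. if Poly_Mapping.keys m \<subseteq> {..<n} then p m else 0"
  by (erule finite_subset[rotated]) auto

lemma lookup_res: "Poly_Mapping.lookup (res n p) m = (if Poly_Mapping.keys m \<subseteq> {..<n} then Poly_Mapping.lookup p m else 0)"
  by transfer simp

lemma keys_subset_iff: "Poly_Mapping.keys m \<subseteq> A \<longleftrightarrow> (\<forall>i. i \<notin> A \<longrightarrow> Poly_Mapping.lookup m i = 0)"
  by (auto simp: in_keys_iff)

lemma res_diff: "res n (p - q) = res n p - res n (q :: 'a::comm_ring_1 mpoly)"
  by (rule poly_mapping_eqI) (simp add: lookup_res lookup_minus)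

lemma res_var_mult:
  fixes p :: "'a::comm_ring_1 mpoly"
  shows "res n (var i * p) = (if i < n then var i * res n p else 0)"
proof (rule poly_mapping_eqI)
  fix m :: monom
  have "Poly_Mapping.keys (m - Poly_Mapping.single i 1) \<subseteq> {..<n} \<longleftrightarrow> Poly_Mapping.keys m \<subseteq> {..<n}"
    if "i < n" using that
    by (auto simp: keys_subset_iff lookup_minus lookup_single when_def)
  then show "Poly_Mapping.lookup (res n (var i * p)) m
      = Poly_Mapping.lookup (if i < n then var i * res n p else 0) m"
    by (auto simp: lookup_res lookup_var_mult keys_subset_iff[of m])
qed

lemma res_perm_adj: "Suc i < n \<Longrightarrow> res n (perm_vars (adj i) p) = perm_vars (adj i) (res n p)"
  by (rule poly_mapping_eqI)
    (auto simp: lookup_res lookup_perm_adj keys_subset_iff lookup_sw transpose_def split: if_splits)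

lemma res_xi: "Suc i < n \<Longrightarrow> res n (xi i f) = xi i (res n (f :: 'a::field mpoly))"
proof (rule sym, rule xi_unique)
  assume i: "Suc i < n"
  have "res n ((var i - var (Suc i)) * xi i f) = res n (var i * f - var (Suc i) * perm_vars (adj i) f)"
    by (simp add: xi_eq)
  then show "(var i - var (Suc i)) * res n (xi i f)
      = var i * res n f - var (Suc i) * perm_vars (adj i) (res n f)"
    using i by (simp add: left_diff_distrib res_diff res_var_mult res_perm_adj)
qed

text \<open>For \<open>var (Suc i) = 0\<close> numerator and denominator reduce to \<open>var i * f\<close> and \<open>var i\<close>.\<close>

lemma res_xi_last: "res (Suc i) (xi i f) = res (Suc i) (f :: 'a::field mpoly)"
proof -
  have "res (Suc i) ((var i - var (Suc i)) * xi i f) = res (Suc i) (var i * f - var (Suc i) * perm_vars (adj i) f)"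
    by (simp add: xi_eq)
  then have "var i * res (Suc i) (xi i f) = var i * res (Suc i) f"
    by (simp add: left_diff_distrib res_diff res_var_mult)
  then show ?thesis
    by (rule iffD1[OF mult_left_cancel[OF var_nz]])
qed

lemma res_res: "n \<le> n' \<Longrightarrow> res n (res n' p) = res n p"
  by (rule poly_mapping_eqI) (auto simp: lookup_res)

lemma xi_chain_res_Suc: "xi_chain k (Suc n) f g \<Longrightarrow> xi_chain k n (res n f) (res n g)"
proof (induction rule: xi_chain.induct)
  case (start f)
  show ?case by (rule xi_chain.start)
next
  case (step f g i)
  show ?case
  proof (cases "Suc i < n")
    case True
    then show ?thesis using step by (simp add: res_xi xi_chain.step)
  next
    case False
    then have "n = Suc i" using step by simp
    then show ?thesis using step by (simp add: res_xi_last)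
  qed
qed

lemma res_id: "p \<in> polys n \<Longrightarrow> res n p = p"
  by (intro poly_mapping_eqI) (auto simp: lookup_res polys_def in_keys_iff)

text \<open>
  A computation of \<open>W\<close> in many variables by a chain remains one in fewer variables, as the operators that
  involve a variable set to zero disappear.
\<close>

lemma W_fin_res:
  fixes f g :: "'a::field mpoly"
  assumes "k \<le> n" "n \<le> n'" "f \<in> polys n'" "g \<in> polys n'" "xi_chain k n' f g"
    and sym: "\<And>i. k \<le> i \<Longrightarrow> Suc i < n' \<Longrightarrow> perm_vars (adj i) g = g"
  shows "W_fin k n (res n f) = res n g"
proof (rule W_fin_chain)
  show "xi_chain k n (res n f) (res n g)"
    using \<open>n \<le> n'\<close>
  proof (induction n rule: inc_induct)
    case base
    then show ?case using assms by (simp add: res_id)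
  next
    case (step m)
    from xi_chain_res_Suc[OF step.IH] show ?case by (simp add: res_res)
  qed
  show "perm_vars (adj i) (res n g) = res n g" if "k \<le> i" "Suc i < n" for i
    using that sym[of i] assms(2) by (simp flip: res_perm_adj)
qed (rule assms(1))


section \<open>Moving an entry of an exponent vector\<close>

lemma nth_swap_adjacent:
  "Poly_Mapping.nth (\<mu> @ b # a # \<tau>) = sw (length \<mu>) (Poly_Mapping.nth (\<mu> @ a # b # \<tau> :: nat list))"
  using nth_swap_entries[of "length \<mu>" "\<mu> @ a # b # \<tau>"]
  by (simp add: swap_entries_def nth_append list_update_append)

lemma xi_chain_adjacent:
  assumes "b \<le> a" "k \<le> length \<mu>" "Suc (length \<mu>) < n"
  shows "xi_chain k n (keyp (Poly_Mapping.nth (\<mu> @ a # b # \<tau>))) (keyp (Poly_Mapping.nth (\<mu> @ b # a # \<tau>)) :: 'a::field mpoly)"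
proof (cases "a = b")
  case True
  then show ?thesis by (simp add: xi_chain.start)
next
  case False
  have "keyp (Poly_Mapping.nth (\<mu> @ b # a # \<tau>)) = xi (length \<mu>) (keyp (Poly_Mapping.nth (\<mu> @ a # b # \<tau>)) :: 'a mpoly)"
    using assms False
    by (subst nth_swap_adjacent, intro keyp_sw) (simp add: nth_default_def nth_append)
  then show ?thesis using assms by (simp add: xi_chain.intros)
qed

lemma xi_chain_move_right:
  assumes "\<And>c. c \<in> set \<rho> \<Longrightarrow> c \<le> a" "k \<le> length \<mu>" "length \<mu> + length \<rho> < n"
  shows "xi_chain k n (keyp (Poly_Mapping.nth (\<mu> @ a # \<rho> @ \<tau>))) (keyp (Poly_Mapping.nth (\<mu> @ \<rho> @ a # \<tau>)) :: 'a::field mpoly)"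
  using assms
proof (induction \<rho> arbitrary: \<mu>)
  case Nil
  then show ?case by (simp add: xi_chain.start)
next
  case (Cons c \<rho>)
  have 1: "xi_chain k n (keyp (Poly_Mapping.nth ((\<mu> @ [c]) @ a # \<rho> @ \<tau>))) (keyp (Poly_Mapping.nth ((\<mu> @ [c]) @ \<rho> @ a # \<tau>)) :: 'a mpoly)"
    using Cons.prems by (intro Cons.IH) auto
  have 2: "xi_chain k n (keyp (Poly_Mapping.nth (\<mu> @ a # c # \<rho> @ \<tau>))) (keyp (Poly_Mapping.nth (\<mu> @ c # a # \<rho> @ \<tau>)) :: 'a mpoly)"
    using Cons.prems by (intro xi_chain_adjacent) auto
  show ?case using xi_chain_trans[OF 1] 2 by simp
qed

lemma xi_chain_move_left:
  assumes "\<And>c. c \<in> set \<rho> \<Longrightarrow> b \<le> c" "k \<le> length \<mu>" "length \<mu> + length \<rho> < n"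
  shows "xi_chain k n (keyp (Poly_Mapping.nth (\<mu> @ \<rho> @ b # \<tau>))) (keyp (Poly_Mapping.nth (\<mu> @ b # \<rho> @ \<tau>)) :: 'a::field mpoly)"
  using assms
proof (induction \<rho> arbitrary: \<mu>)
  case Nil
  then show ?case by (simp add: xi_chain.start)
next
  case (Cons c \<rho>)
  have 1: "xi_chain k n (keyp (Poly_Mapping.nth ((\<mu> @ [c]) @ \<rho> @ b # \<tau>))) (keyp (Poly_Mapping.nth ((\<mu> @ [c]) @ b # \<rho> @ \<tau>)) :: 'a mpoly)"
    using Cons.prems by (intro Cons.IH) auto
  have 2: "xi_chain k n (keyp (Poly_Mapping.nth (\<mu> @ c # b # \<rho> @ \<tau>))) (keyp (Poly_Mapping.nth (\<mu> @ b # c # \<rho> @ \<tau>)) :: 'a mpoly)"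
    using Cons.prems by (intro xi_chain_adjacent) auto
  show ?case using xi_chain_trans[OF 2] 1 by simp
qed

section \<open>Series that are symmetric in almost all variables\<close>

lemma series_eqI: "(\<And>m. scoeff f m = scoeff g m) \<Longrightarrow> f = g"
  by (rule iffD1[OF scoeff_inject]) (rule ext)

lemma scoeff_Abs [simp]: "scoeff (Abs_series F) m = F m"
  by (simp add: Abs_series_inverse)

lemma scoeff_series_of_poly [simp]: "scoeff (series_of_poly p) m = Poly_Mapping.lookup p m"
  by (simp add: series_of_poly_def)

lemma scoeff_scale_rat: "scoeff (scale_rat c f) m = rat_qt c * scoeff f m"
  by (simp add: scale_rat_def scale.rep_eq)

lemma scoeff_sum: "scoeff (sum f A) m = (\<Sum>a\<in>A. scoeff (f a) m)"
  by (induction A rule: infinite_finite_induct) (simp_all add: zero_series.rep_eq plus_series.rep_eq)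

lemma keys_nth_subset: "Poly_Mapping.keys (Poly_Mapping.nth xs) \<subseteq> {..<length (xs :: nat list)}"
  unfolding keys_subset_iff by (simp add: nth_default_def)

lemma mdeg_sum: "Poly_Mapping.keys m \<subseteq> A \<Longrightarrow> finite A \<Longrightarrow> mdeg m = (\<Sum>i\<in>A. Poly_Mapping.lookup m i)"
  unfolding mdeg_weight by (rule weight_sum) auto

lemma mdeg_add: "mdeg (a + b) = mdeg a + mdeg b"
proof -
  let ?A = "Poly_Mapping.keys a \<union> Poly_Mapping.keys b"
  have "Poly_Mapping.keys (a + b) \<subseteq> ?A" by (rule keys_add)
  then show ?thesis
    using mdeg_sum[of "a + b" ?A] mdeg_sum[of a ?A] mdeg_sum[of b ?A]
    by (simp add: lookup_add sum.distrib)
qed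

lemma lookup_le_mdeg: "Poly_Mapping.lookup m i \<le> mdeg m"
  unfolding mdeg_def by (cases "i \<in> Poly_Mapping.keys m") (auto intro: member_le_sum simp: in_keys_iff)

lemma card_keys_le_mdeg: "card (Poly_Mapping.keys m) \<le> mdeg m"
proof -
  have "(\<Sum>i\<in>Poly_Mapping.keys m. 1) \<le> mdeg m"
    unfolding mdeg_def by (intro sum_mono) (simp add: in_keys_iff Suc_le_eq)
  then show ?thesis by simp
qed

lemma finite_monoms: "finite {m. Poly_Mapping.keys m \<subseteq> {..<n} \<and> mdeg m \<le> d}"
proof (rule finite_imageD)
  have "Poly_Mapping.lookup ` {m. Poly_Mapping.keys m \<subseteq> {..<n} \<and> mdeg m \<le> d}
      \<subseteq> {F. \<forall>i. (i \<in> {..<n} \<longrightarrow> F i \<in> {..d}) \<and> (i \<notin> {..<n} \<longrightarrow> F i = 0)}"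
    by (auto simp: keys_subset_iff intro: order_trans[OF lookup_le_mdeg])
  then show "finite (Poly_Mapping.lookup ` {m. Poly_Mapping.keys m \<subseteq> {..<n} \<and> mdeg m \<le> d})"
    by (rule finite_subset) (rule finite_set_of_finite_funs, auto)
qed (intro inj_onI poly_mapping_eqI, simp)

definition bdd :: "'a::zero series \<Rightarrow> bool" where
  "bdd f \<longleftrightarrow> (\<exists>d. \<forall>m. scoeff f m \<noteq> 0 \<longrightarrow> mdeg m \<le> d)"

lemma lookup_trunc:
  assumes "bdd f"
  shows "Poly_Mapping.lookup (trunc n f) m = (if Poly_Mapping.keys m \<subseteq> {..<n} then scoeff f m else 0)"
proof -
  obtain d where d: "\<And>m. scoeff f m \<noteq> 0 \<Longrightarrow> mdeg m \<le> d" using assms by (auto simp: bdd_def)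
  have "finite {m. (if Poly_Mapping.keys m \<subseteq> {..<n} then scoeff f m else 0) \<noteq> 0}"
    by (rule finite_subset[OF _ finite_monoms[of n d]]) (auto dest: d)
  then show ?thesis unfolding trunc_def by simp
qed

lemma trunc_determines:
  assumes "bdd f" "bdd g" "\<And>n. n \<ge> k \<Longrightarrow> trunc n f = trunc n g"
  shows "f = g"
proof (rule series_eqI)
  fix m :: monom
  obtain n d where n: "Poly_Mapping.keys m \<subseteq> {..<n}" "\<forall>i. Poly_Mapping.lookup m i \<le> d"
    by (rule monom_bounds)
  then have "Poly_Mapping.keys m \<subseteq> {..<max n k}" by auto
  then show "scoeff f m = scoeff g m"
    using assms(3)[of "max n k"] lookup_trunc[OF assms(1), of "max n k" m] lookup_trunc[OF assms(2), of "max n k" m]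
    by simp
qed

lemma finite_splittings: "finite {(a, b). a + b = (m :: monom)}"
proof -
  obtain n d where n: "Poly_Mapping.keys m \<subseteq> {..<n}" "\<forall>i. Poly_Mapping.lookup m i \<le> d"
    by (rule monom_bounds)
  let ?E = "{a. Poly_Mapping.keys a \<subseteq> {..<n} \<and> mdeg a \<le> mdeg m}"
  have "a \<in> ?E \<and> b \<in> ?E" if eq: "a + b = m" for a b
    using n(1) unfolding eq[symmetric] keys_subset_iff mdeg_add lookup_add by simp
  then have "{(a, b). a + b = m} \<subseteq> ?E \<times> ?E" by blast
  then show ?thesis by (rule finite_subset) (intro finite_SigmaI finite_monoms)
qed

lemma scoeff_times: "scoeff (f * g) m = (\<Sum>(a, b)\<in>{(a, b). a + b = m}. scoeff f a * scoeff g b)"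
  by (simp add: times_series.rep_eq)

lemma scoeff_monom_times:
  fixes g :: "'a::comm_semiring_1 series"
  shows "scoeff (series_of_poly (Poly_Mapping.single a 1) * g) m =
    (if \<forall>i. Poly_Mapping.lookup a i \<le> Poly_Mapping.lookup m i then scoeff g (m - a) else 0)"
proof -
  have "scoeff (series_of_poly (Poly_Mapping.single a 1) * g) m
      = (\<Sum>p\<in>{(a, b). a + b = m}. if fst p = a then scoeff g (snd p) else 0)"
    unfolding scoeff_times by (intro sum.cong) (auto simp: lookup_single when_def)
  also have "\<dots> = (\<Sum>p\<in>{p \<in> {(a, b). a + b = m}. fst p = a}. scoeff g (snd p))"
    by (rule sum.inter_filter[OF finite_splittings, symmetric])
  also have "{p \<in> {(a, b). a + b = m}. fst p = a}
      = (if \<forall>i. Poly_Mapping.lookup a i \<le> Poly_Mapping.lookup m i then {(a, m - a)} else {})"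
    using monom_le_split[of a m] by (auto simp: lookup_add)
  finally show ?thesis by simp
qed

lemma bdd_add: "bdd f \<Longrightarrow> bdd g \<Longrightarrow> bdd (f + (g :: 'a::ab_group_add series))"
proof -
  assume bdds: "bdd f" "bdd g"
  obtain d e where "\<And>m. scoeff f m \<noteq> 0 \<Longrightarrow> mdeg m \<le> d" "\<And>m. scoeff g m \<noteq> 0 \<Longrightarrow> mdeg m \<le> e"
    using bdds unfolding bdd_def by auto
  then have "mdeg m \<le> max d e" if "scoeff (f + g) m \<noteq> 0" for m
    using that by (cases "scoeff f m = 0") (auto simp: plus_series.rep_eq le_max_iff_disj)
  then show ?thesis unfolding bdd_def by blast
qed

lemma bdd_times: "bdd f \<Longrightarrow> bdd g \<Longrightarrow> bdd (f * (g :: 'a::comm_semiring_1 series))"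
proof -
  assume bdds: "bdd f" "bdd g"
  obtain d e where de: "\<And>m. scoeff f m \<noteq> 0 \<Longrightarrow> mdeg m \<le> d" "\<And>m. scoeff g m \<noteq> 0 \<Longrightarrow> mdeg m \<le> e"
    using bdds unfolding bdd_def by auto
  have "mdeg m \<le> d + e" if nz: "scoeff (f * g) m \<noteq> 0" for m
  proof -
    obtain p where p: "p \<in> {(a, b). a + b = m}" "(case p of (a, b) \<Rightarrow> scoeff f a * scoeff g b) \<noteq> 0"
      using nz unfolding scoeff_times by (rule sum.not_neutral_contains_not_neutral)
    then obtain a b where ab: "p = (a, b)" by (cases p)
    have "a + b = m" "scoeff f a \<noteq> 0" "scoeff g b \<noteq> 0"
      using p by (auto simp: ab)
    then show ?thesis using de(1)[of a] de(2)[of b] mdeg_add[of a b] by simp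
  qed
  then show ?thesis unfolding bdd_def by blast
qed

lemma bdd_poly: "bdd (series_of_poly p)"
  unfolding bdd_def
proof (intro exI allI impI)
  fix m assume "scoeff (series_of_poly p) m \<noteq> 0"
  then show "mdeg m \<le> (\<Sum>m\<in>Poly_Mapping.keys p. mdeg m)"
    by (intro member_le_sum) (auto simp: in_keys_iff)
qed

lemma bdd_scale: "bdd f \<Longrightarrow> bdd (scale c (f :: 'a::field series))"
  by (auto simp: bdd_def scale.rep_eq)

lemma bdd_0: "bdd 0"
  by (simp add: bdd_def zero_series.rep_eq)

lemma bdd_sym_funs: "g \<in> sym_funs k \<Longrightarrow> bdd g"
  by (simp add: sym_funs_def bdd_def)

lemma bdd_P_as: "f \<in> P_as \<Longrightarrow> bdd (f :: 'a::field series)"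
proof -
  assume "f \<in> P_as"
  then obtain k where "f \<in> almost_sym k" by (auto simp: P_as_def)
  moreover have "almost_sym k \<subseteq> {f :: 'a series. bdd f}"
    unfolding almost_sym_def
  proof (rule series.span_minimal)
    show "series.subspace {f :: 'a series. bdd f}"
      by (rule series.subspaceI) (simp_all add: bdd_0 bdd_add bdd_scale)
  qed (auto intro!: bdd_times bdd_poly intro: bdd_sym_funs)
  ultimately show ?thesis by auto
qed

definition sym_from :: "nat \<Rightarrow> 'a series \<Rightarrow> bool" where
  "sym_from k f \<longleftrightarrow> (\<forall>i m. k \<le> i \<longrightarrow> scoeff f (sw i m) = scoeff f m)"

definition shape :: "nat \<Rightarrow> monom \<Rightarrow> nat multiset" where
  "shape k m = image_mset (Poly_Mapping.lookup m) (mset_set (Poly_Mapping.keys m \<inter> {k..}))"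

lemma shape_interval:
  assumes "Poly_Mapping.keys m \<subseteq> {..<n}"
  shows "image_mset (Poly_Mapping.lookup m) (mset_set {k..<n})
    = shape k m + replicate_mset (n - k - size (shape k m)) 0"
proof -
  let ?A = "Poly_Mapping.keys m \<inter> {k..}" and ?B = "{k..<n} - Poly_Mapping.keys m"
  have AB: "{k..<n} = ?A \<union> ?B" using assms by auto
  have "mset_set {k..<n} = mset_set ?A + mset_set ?B"
    by (subst AB, rule mset_set_Union) auto
  moreover have "image_mset (Poly_Mapping.lookup m) (mset_set ?B) = image_mset (\<lambda>_. 0) (mset_set ?B)"
    by (intro image_mset_cong) (auto simp: in_keys_iff)
  moreover have "card ?B = n - k - size (shape k m)"
  proof -
    have "card {k..<n} = card ?A + card ?B" by (subst AB, rule card_Un_disjoint) auto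
    then show ?thesis by (simp add: shape_def)
  qed
  ultimately show ?thesis by (simp add: shape_def image_mset_const_eq)
qed

text \<open>
  Two monomials with the same exponents below \<open>k\<close> and the same shape above lie in one orbit of a
  finite symmetric group, which is generated by the adjacent transpositions.
\<close>

lemma sym_from_shape:
  assumes f: "sym_from k f" and head: "\<And>i. i < k \<Longrightarrow> Poly_Mapping.lookup m i = Poly_Mapping.lookup m' i"
    and sh: "shape k m = shape k m'"
  shows "scoeff f m = scoeff f m'"
proof -
  obtain n d where n: "Poly_Mapping.keys m \<subseteq> {..<n}" "\<forall>i. Poly_Mapping.lookup m i \<le> d"
    "Poly_Mapping.keys m' \<subseteq> {..<n}" "\<forall>i. Poly_Mapping.lookup m' i \<le> d"
    by (rule monom_bounds2)
  have "image_mset (Poly_Mapping.lookup m) (mset_set {k..<n}) = image_mset (Poly_Mapping.lookup m') (mset_set {k..<n})"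
    by (simp add: shape_interval n sh)
  then obtain p where p: "p permutes {k..<n}" "\<forall>x\<in>{k..<n}. Poly_Mapping.lookup m x = Poly_Mapping.lookup m' (p x)"
    by (rule image_mset_eq_implies_permutes[OF finite_atLeastLessThan])
  have "m = Poly_Mapping.map_key p m'"
  proof (rule poly_mapping_eqI)
    fix i
    show "Poly_Mapping.lookup m i = Poly_Mapping.lookup (Poly_Mapping.map_key p m') i"
    proof (cases "i \<in> {k..<n}")
      case True
      then show ?thesis using p by (simp add: lookup_map_key permutes_bij)
    next
      case False
      then have "p i = i" using p(1) by (rule permutes_not_in[rotated])
      moreover have "Poly_Mapping.lookup m i = Poly_Mapping.lookup m' i"
        using False head[of i] n(1,3) by (cases "i < k") (auto simp: keys_subset_iff)
      ultimately show ?thesis using p(1) by (simp add: lookup_map_key permutes_bij)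
    qed
  qed
  moreover have "sym_between k n (scoeff f)"
    using f by (simp add: sym_between_def sym_from_def)
  ultimately show ?thesis using p(1) by (simp add: sym_between_permutes)
qed

lemma shape_permute:
  assumes "\<sigma> permutes {k..}"
  shows "shape k (Poly_Mapping.map_key \<sigma> m) = shape k m"
proof -
  have b: "bij \<sigma>" using assms by (rule permutes_bij)
  let ?A = "Poly_Mapping.keys (Poly_Mapping.map_key \<sigma> m) \<inter> {k..}"
  have im: "\<sigma> ` ?A = Poly_Mapping.keys m \<inter> {k..}"
  proof -
    have "?A = \<sigma> -` (Poly_Mapping.keys m \<inter> {k..})"
      using permutes_in_image[OF assms] b by (auto simp: keys_map_key bij_is_inj)
    then show ?thesis using b by (simp only: surj_image_vimage_eq bij_is_surj)
  qed
  have "shape k (Poly_Mapping.map_key \<sigma> m) = image_mset (Poly_Mapping.lookup m) (image_mset \<sigma> (mset_set ?A))"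
  proof -
    have "Poly_Mapping.lookup (Poly_Mapping.map_key \<sigma> m) = Poly_Mapping.lookup m \<circ> \<sigma>"
      by (rule ext) (simp add: lookup_map_key[OF b])
    then show ?thesis by (simp add: shape_def image_mset.compositionality)
  qed
  also have "image_mset \<sigma> (mset_set ?A) = mset_set (\<sigma> ` ?A)"
    using b by (intro image_mset_mset_set) (meson bij_is_inj inj_on_subset subset_UNIV)
  finally show ?thesis by (simp only: im shape_def)
qed

lemma shape_sw: "k \<le> i \<Longrightarrow> shape k (sw i m) = shape k m"
  unfolding sw_def by (rule shape_permute) (auto intro: permutes_swap_id)

lift_definition head :: "nat \<Rightarrow> monom \<Rightarrow> monom" is "\<lambda>k m i. if i < k then m i else 0"
  by (rule finite_subset[of _ "{..<k}" for k]) auto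

lift_definition tail :: "nat \<Rightarrow> monom \<Rightarrow> monom" is "\<lambda>k m i. if i < k then 0 else m i"
  by (erule finite_subset[rotated]) auto

lemma lookup_head: "Poly_Mapping.lookup (head k m) i = (if i < k then Poly_Mapping.lookup m i else 0)"
  by transfer simp

lemma lookup_tail: "Poly_Mapping.lookup (tail k m) i = (if i < k then 0 else Poly_Mapping.lookup m i)"
  by transfer simp

lemma head_tail: "head k m + tail k m = m"
  by (rule poly_mapping_eqI) (simp add: lookup_head lookup_tail lookup_add)

lemma mdeg_head_tail: "mdeg m = mdeg (head k m) + mdeg (tail k m)"
  by (simp flip: mdeg_add add: head_tail)

lemma keys_head: "Poly_Mapping.keys (head k m) \<subseteq> {..<k}"
  by (auto simp: in_keys_iff lookup_head split: if_splits)

lemma sym_in_sym_funs: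
  fixes f :: "'a::field series"
  assumes f: "bdd f" "sym_from k f" and a: "Poly_Mapping.keys a \<subseteq> {..<k}"
  shows "Abs_series (\<lambda>m. if Poly_Mapping.keys m \<subseteq> {k..} then scoeff f (a + m) else 0) \<in> sym_funs k"
proof -
  obtain d where d: "\<And>m. scoeff f m \<noteq> 0 \<Longrightarrow> mdeg m \<le> d" using f(1) by (auto simp: bdd_def)
  have perm: "scoeff f (a + Poly_Mapping.map_key \<sigma> m) = scoeff f (a + m)"
    "Poly_Mapping.keys (Poly_Mapping.map_key \<sigma> m) \<subseteq> {k..} \<longleftrightarrow> Poly_Mapping.keys m \<subseteq> {k..}"
    if \<sigma>: "\<sigma> permutes {k..}" for \<sigma> m
  proof -
    have b: "bij \<sigma>" using \<sigma> by (rule permutes_bij)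
    have low: "\<sigma> i = i" if "i < k" for i using \<sigma> that by (auto intro: permutes_not_in)
    have high: "k \<le> \<sigma> i \<longleftrightarrow> k \<le> i" for i using permutes_in_image[OF \<sigma>, of i] by simp
    have "a + Poly_Mapping.map_key \<sigma> m = Poly_Mapping.map_key \<sigma> (a + m)"
    proof (rule poly_mapping_eqI)
      fix i
      have "Poly_Mapping.lookup a (\<sigma> i) = Poly_Mapping.lookup a i"
        using a low[of i] high[of i] by (cases "i < k") (auto simp: keys_subset_iff)
      then show "Poly_Mapping.lookup (a + Poly_Mapping.map_key \<sigma> m) i
          = Poly_Mapping.lookup (Poly_Mapping.map_key \<sigma> (a + m)) i"
        using b by (simp add: lookup_add lookup_map_key)
    qed
    then show "scoeff f (a + Poly_Mapping.map_key \<sigma> m) = scoeff f (a + m)"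
      using \<sigma> b low by (auto intro!: sym_from_shape[OF f(2)] simp: shape_permute lookup_map_key)
    show "Poly_Mapping.keys (Poly_Mapping.map_key \<sigma> m) \<subseteq> {k..} \<longleftrightarrow> Poly_Mapping.keys m \<subseteq> {k..}"
      using b low high by (auto simp: keys_subset_iff lookup_map_key not_le)
  qed
  have "mdeg m \<le> d" if "scoeff f (a + m) \<noteq> 0" for m
    using d[OF that] by (simp add: mdeg_add)
  then show ?thesis
    using perm unfolding sym_funs_def by auto
qed

text \<open>
  Sorting the monomials by their part in the first \<open>k\<close> variables writes such a series as a finite sum
  of monomials times symmetric functions.
\<close>

lemma sym_from_almost_sym:
  fixes f :: "'a::field series"
  assumes f: "bdd f" "sym_from k f"
  shows "f \<in> almost_sym k"
proof -
  obtain d where d: "\<And>m. scoeff f m \<noteq> 0 \<Longrightarrow> mdeg m \<le> d" using f(1) by (auto simp: bdd_def)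
  define A where "A = {a. Poly_Mapping.keys a \<subseteq> {..<k} \<and> mdeg a \<le> d}"
  define g where "g a = (Abs_series (\<lambda>m. if Poly_Mapping.keys m \<subseteq> {k..} then scoeff f (a + m) else 0) :: 'a series)" for a
  have finA: "finite A" unfolding A_def by (rule finite_monoms)
  have "f = (\<Sum>a\<in>A. series_of_poly (Poly_Mapping.single a 1) * g a)"
  proof (rule series_eqI)
    fix m
    have term0: "scoeff (series_of_poly (Poly_Mapping.single a 1) * g a) m = (if a = head k m then scoeff f m else 0)"
      if "a \<in> A" for a
    proof (cases "a = head k m")
      case True
      have "m - a = tail k m" "\<forall>i. Poly_Mapping.lookup a i \<le> Poly_Mapping.lookup m i"
        by (auto simp: True lookup_head lookup_tail lookup_minus intro!: poly_mapping_eqI)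
      moreover have "Poly_Mapping.keys (tail k m) \<subseteq> {k..}"
        by (auto simp: in_keys_iff lookup_tail split: if_splits)
      ultimately show ?thesis by (simp add: scoeff_monom_times g_def True head_tail)
    next
      case False
      have "a = head k m" if le: "\<forall>i. Poly_Mapping.lookup a i \<le> Poly_Mapping.lookup m i" and "Poly_Mapping.keys (m - a) \<subseteq> {k..}"
      proof (rule poly_mapping_eqI)
        fix i
        have "Poly_Mapping.lookup m i - Poly_Mapping.lookup a i = 0" if "i < k"
          using \<open>Poly_Mapping.keys (m - a) \<subseteq> {k..}\<close> that by (auto simp: keys_subset_iff lookup_minus)
        moreover have "Poly_Mapping.lookup a i = 0" if "\<not> i < k"
          using \<open>a \<in> A\<close> that by (auto simp: A_def keys_subset_iff)
        ultimately show "Poly_Mapping.lookup a i = Poly_Mapping.lookup (head k m) i"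
          using le by (cases "i < k") (auto simp: lookup_head intro: antisym)
      qed
      then show ?thesis using False by (auto simp: scoeff_monom_times g_def)
    qed
    have "scoeff (\<Sum>a\<in>A. series_of_poly (Poly_Mapping.single a 1) * g a) m
        = (\<Sum>a\<in>A. if a = head k m then scoeff f m else 0)"
      unfolding scoeff_sum by (rule sum.cong) (simp_all only: term0)
    also have "\<dots> = (if head k m \<in> A then scoeff f m else 0)" using finA by simp
    also have "\<dots> = scoeff f m"
    proof (cases "scoeff f m = 0")
      case False
      then show ?thesis using d[of m] keys_head[of k m] mdeg_head_tail[of m k] by (simp add: A_def)
    qed simp
    finally show "scoeff f m = scoeff (\<Sum>a\<in>A. series_of_poly (Poly_Mapping.single a 1) * g a) m" by simp
  qed
  also have "\<dots> \<in> almost_sym k"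
    unfolding almost_sym_def
  proof (intro series.span_sum series.span_base)
    fix a assume "a \<in> A"
    then have "Poly_Mapping.single a 1 \<in> (polys k :: 'a mpoly set)" "g a \<in> sym_funs k"
      using sym_in_sym_funs[OF f] by (auto simp: polys_def A_def g_def)
    then show "series_of_poly (Poly_Mapping.single a 1) * g a
        \<in> {series_of_poly p * g | p g. p \<in> polys k \<and> g \<in> sym_funs k}" by blast
  qed
  finally show ?thesis .
qed


section \<open>The rational span of monomials times monomial symmetric functions\<close>

text \<open>The union of these spaces over \<open>k\<close> is \<open>P_as_Q\<close>, but membership in them is a condition on coefficients.\<close>

definition VQ :: "nat \<Rightarrow> qt series set" where
  "VQ k = {f. bdd f \<and> sym_from k f \<and> (\<forall>m. scoeff f m \<in> range rat_qt)}"

lemma rat_qt_0: "rat_qt 0 = 0"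
  by (simp add: rat_qt_def)

lemma rat_qt_range:
  "0 \<in> range rat_qt" "1 \<in> range rat_qt"
  "a \<in> range rat_qt \<Longrightarrow> b \<in> range rat_qt \<Longrightarrow> a + b \<in> range rat_qt"
  "a \<in> range rat_qt \<Longrightarrow> rat_qt c * a \<in> range rat_qt"
proof -
  show "0 \<in> range rat_qt" by (rule range_eqI[of _ _ 0]) (simp add: rat_qt_0)
  show "1 \<in> range rat_qt" by (rule range_eqI[of _ _ 1]) (simp add: rat_qt_simps)
  show "a + b \<in> range rat_qt" if "a \<in> range rat_qt" "b \<in> range rat_qt"
  proof -
    obtain x y where "a = rat_qt x" "b = rat_qt y" using \<open>a \<in> range rat_qt\<close> \<open>b \<in> range rat_qt\<close> by blast
    then show ?thesis by (intro range_eqI[of _ _ "x + y"]) (simp add: rat_qt_simps)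
  qed
  show "rat_qt c * a \<in> range rat_qt" if "a \<in> range rat_qt"
  proof -
    obtain x where "a = rat_qt x" using \<open>a \<in> range rat_qt\<close> by blast
    then show ?thesis by (intro range_eqI[of _ _ "c * x"]) (simp add: rat_qt_simps)
  qed
qed

lemma VQ_zero: "0 \<in> VQ k"
  by (simp add: VQ_def bdd_0 sym_from_def zero_series.rep_eq rat_qt_range(1))

lemma VQ_add: "f \<in> VQ k \<Longrightarrow> g \<in> VQ k \<Longrightarrow> f + g \<in> VQ k"
  by (simp add: VQ_def bdd_add sym_from_def plus_series.rep_eq rat_qt_range(3))

lemma VQ_scale: "f \<in> VQ k \<Longrightarrow> scale_rat c f \<in> VQ k"
  by (simp add: VQ_def scale_rat_def bdd_scale sym_from_def scale.rep_eq rat_qt_range(4))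

lemma VQ_diff: "f \<in> VQ k \<Longrightarrow> g \<in> VQ k \<Longrightarrow> f - g \<in> VQ k"
  using VQ_add[of f k "scale_rat (- 1) g"] VQ_scale[of g k "- 1"] by simp

lemma VQ_sum: "(\<And>a. a \<in> A \<Longrightarrow> f a \<in> VQ k) \<Longrightarrow> sum f A \<in> VQ k"
  by (induction A rule: infinite_finite_induct) (auto simp: VQ_zero VQ_add)

lemma VQ_mono: "k \<le> l \<Longrightarrow> VQ k \<subseteq> VQ l"
  by (auto simp: VQ_def sym_from_def)

lemma scoeff_monomial_sym: "scoeff (monomial_sym \<nu>) m = (if shape 0 m = mset \<nu> then 1 else 0)"
  by (simp add: monomial_sym.rep_eq shape_def atLeast_0)

lemma mdeg_shape: "mdeg m = sum_mset (shape 0 m)"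
  by (simp add: mdeg_def shape_def atLeast_0 sum_unfold_sum_mset)

lemma shape_tail: "shape 0 (tail k m) = shape k m"
proof -
  have "Poly_Mapping.keys (tail k m) = Poly_Mapping.keys m \<inter> {k..}"
    by (auto simp: in_keys_iff lookup_tail split: if_splits)
  then show ?thesis unfolding shape_def
    by (auto simp: lookup_tail intro!: image_mset_cong)
qed

lemma generator_in_VQ:
  assumes "Poly_Mapping.keys b \<subseteq> {..<k}"
  shows "series_of_poly (Poly_Mapping.single b 1) * monomial_sym \<nu> \<in> VQ k"
proof -
  have "bdd (monomial_sym \<nu> :: qt series)"
    unfolding bdd_def
    by (rule exI[of _ "sum_list \<nu>"]) (auto simp: scoeff_monomial_sym mdeg_shape sum_mset_sum_list split: if_splits)
  then have 1: "bdd (series_of_poly (Poly_Mapping.single b 1) * monomial_sym \<nu> :: qt series)"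
    by (intro bdd_times bdd_poly)
  have b0: "Poly_Mapping.lookup b j = 0" if "k \<le> j" for j
    using assms that by (auto simp: keys_subset_iff)
  have "sym_from k (series_of_poly (Poly_Mapping.single b 1) * monomial_sym \<nu> :: qt series)"
    unfolding sym_from_def
  proof (intro allI impI)
    fix i m assume i: "k \<le> i"
    have le: "(\<forall>j. Poly_Mapping.lookup b j \<le> Poly_Mapping.lookup (sw i m) j) \<longleftrightarrow>
        (\<forall>j. Poly_Mapping.lookup b j \<le> Poly_Mapping.lookup m j)"
      by (intro iff_allI) (use i b0 in \<open>auto simp: lookup_sw transpose_def\<close>)
    have "sw i m - b = sw i (m - b)"
      by (rule poly_mapping_eqI) (use i b0 in \<open>auto simp: lookup_sw lookup_minus transpose_def\<close>)
    then show "scoeff (series_of_poly (Poly_Mapping.single b 1) * monomial_sym \<nu> :: qt series) (sw i m)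
        = scoeff (series_of_poly (Poly_Mapping.single b 1) * monomial_sym \<nu>) m"
      by (simp add: scoeff_monom_times le scoeff_monomial_sym shape_sw)
  qed
  moreover have "scoeff (series_of_poly (Poly_Mapping.single b 1) * monomial_sym \<nu>) m \<in> range rat_qt" for m
    by (simp add: scoeff_monom_times scoeff_monomial_sym rat_qt_range(1,2))
  ultimately show ?thesis using 1 by (simp add: VQ_def)
qed

lemma reduced_list_ex:
  assumes "Poly_Mapping.keys b \<subseteq> {..<k}"
  obtains \<mu> where "reduced \<mu>" "Poly_Mapping.nth \<mu> = (b :: monom)" "length \<mu> \<le> k"
proof
  let ?xs = "map (Poly_Mapping.lookup b) [0..<k]"
  let ?mu = "strip_while ((=) 0) ?xs"
  show "Poly_Mapping.nth ?mu = b"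
    unfolding nth_strip_while
    by (rule poly_mapping_eqI) (use assms in \<open>auto simp: nth_default_def keys_subset_iff\<close>)
  show "reduced ?mu"
    unfolding reduced_def using no_trailing_strip_while[of "(=) 0" ?xs] unfolding no_trailing_unfold by metis
  show "length ?mu \<le> k"
    using length_strip_while_le[of "(=) 0" ?xs] by simp
qed

lemma generator_in_P_as_Q:
  assumes "Poly_Mapping.keys b \<subseteq> {..<k}" "is_partition \<nu>"
  shows "series_of_poly (Poly_Mapping.single b 1) * monomial_sym \<nu> \<in> P_as_Q"
proof -
  obtain \<mu> where "reduced \<mu>" "Poly_Mapping.nth \<mu> = b"
    using reduced_list_ex[OF assms(1)] by blast
  then show ?thesis unfolding P_as_Q_def using assms(2)
    by (intro series_Q.span_base image_eqI[of _ _ "(\<mu>, \<nu>)"]) (auto simp: Sig_def mon_def)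
qed

definition sorted_shape :: "nat \<Rightarrow> monom \<Rightarrow> nat list" where
  "sorted_shape k m = rev (sorted_list_of_multiset (shape k m))"

lemma mset_sorted_shape: "mset (sorted_shape k m) = shape k m"
  by (simp add: sorted_shape_def)

lemma is_partition_sorted_shape: "is_partition (sorted_shape k m)"
proof -
  have "a \<noteq> 0" if "a \<in># shape k m" for a
    using that by (auto simp: shape_def in_keys_iff)
  then have "\<forall>a\<in>set (sorted_shape k m). a \<ge> 1"
    by (metis mset_sorted_shape set_mset_mset One_nat_def Suc_leI gr0I)
  moreover have "sorted_wrt (\<ge>) (sorted_shape k m)"
    unfolding sorted_shape_def by (simp add: sorted_wrt_rev)
  ultimately show ?thesis by (simp add: is_partition_def)
qed

lemma partition_eqI: "is_partition \<nu> \<Longrightarrow> is_partition \<nu>' \<Longrightarrow> mset \<nu> = mset \<nu>' \<Longrightarrow> \<nu> = \<nu>'"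
proof -
  assume p: "is_partition \<nu>" "is_partition \<nu>'" and eq: "mset \<nu> = mset \<nu>'"
  have "sorted (rev \<nu>)" "sorted (rev \<nu>')" using p by (auto simp: is_partition_def sorted_wrt_rev)
  then have "sort (rev \<nu>) = rev \<nu>" "sort (rev \<nu>) = rev \<nu>'"
    using eq by (intro properties_for_sort; simp)+
  then have "rev \<nu> = rev \<nu>'" by (rule trans[OF sym])
  then show ?thesis by simp
qed

text \<open>A representative of the monomials of shape \<open>\<nu>\<close>, in the smallest possible number of variables.\<close>

definition place :: "nat \<Rightarrow> nat list \<Rightarrow> monom" where
  "place k \<nu> = Poly_Mapping.nth (replicate k 0 @ \<nu>)"

lemma lookup_place: "Poly_Mapping.lookup (place k \<nu>) i = (if i < k then 0 else nth_default 0 \<nu> (i - k))"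
  by (simp add: place_def nth_default_append)

lemma keys_place: "Poly_Mapping.keys (place k \<nu>) \<subseteq> {..<k + length \<nu>}"
  by (auto simp: keys_subset_iff lookup_place nth_default_def)

lemma shape_place:
  assumes "Poly_Mapping.keys b \<subseteq> {..<k}" "is_partition \<nu>"
  shows "shape k (b + place k \<nu>) = mset \<nu>"
proof -
  have b0: "Poly_Mapping.lookup b j = 0" if "k \<le> j" for j
    using assms(1) that by (auto simp: keys_subset_iff)
  have pos: "\<nu> ! j \<noteq> 0" if "j < length \<nu>" for j
    using assms(2) nth_mem[OF that] by (force simp: is_partition_def)
  have "Poly_Mapping.keys (b + place k \<nu>) \<inter> {k..} = (\<lambda>j. k + j) ` {..<length \<nu>}"
  proof (intro equalityI subsetI)
    fix i assume "i \<in> Poly_Mapping.keys (b + place k \<nu>) \<inter> {k..}"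
    then have "k \<le> i" "i - k < length \<nu>"
      by (auto simp: in_keys_iff lookup_add b0 lookup_place nth_default_def split: if_splits)
    then show "i \<in> (\<lambda>j. k + j) ` {..<length \<nu>}" by (intro image_eqI[of _ _ "i - k"]) auto
  qed (auto simp: in_keys_iff lookup_add lookup_place nth_default_def pos)
  then have "shape k (b + place k \<nu>)
      = image_mset (\<lambda>j. Poly_Mapping.lookup (b + place k \<nu>) (k + j)) (mset_set {..<length \<nu>})"
    by (simp add: shape_def image_mset_mset_set[symmetric] image_mset.compositionality o_def)
  also have "\<dots> = image_mset ((!) \<nu>) (mset_set {..<length \<nu>})"
    by (intro image_mset_cong) (auto simp: lookup_add b0 lookup_place nth_default_def)
  also have "\<dots> = mset \<nu>"
    by (metis map_nth mset_map mset_upt atLeast0LessThan)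
  finally show ?thesis .
qed

lemma place_same_coeff:
  assumes "sym_from k f"
  shows "scoeff f (head k m + place k (sorted_shape k m)) = scoeff f m"
  using shape_place[OF keys_head is_partition_sorted_shape, of k m k m]
  by (intro sym_from_shape[OF assms])
    (simp_all add: mset_sorted_shape lookup_add lookup_head lookup_place)

text \<open>
  \<open>x\<^sup>b m\<^sub>\<nu>[X]\<close> and \<open>x\<^sup>b m\<^sub>\<nu>(x\<^sub>k\<^sub>+\<^sub>1, x\<^sub>k\<^sub>+\<^sub>2, \<dots>)\<close> differ only in monomials whose degree in the symmetric variables
  is less than \<open>|\<nu>|\<close>, so these products are removed from the top of that degree downwards.
\<close>

lemma VQ_tail_induct:
  assumes "f \<in> VQ k" "\<And>m. scoeff f m \<noteq> 0 \<Longrightarrow> mdeg (tail k m) < t"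
  shows "f \<in> P_as_Q"
  using assms
proof (induction t arbitrary: f)
  case 0
  then have "f = 0" by (intro series_eqI) (auto simp: zero_series.rep_eq)
  then show ?case by (simp add: P_as_Q_def series_Q.span_zero)
next
  case (Suc t)
  have f: "bdd f" "sym_from k f" "\<And>m. scoeff f m \<in> range rat_qt"
    using Suc.prems(1) by (auto simp: VQ_def)
  obtain d where d: "\<And>m. scoeff f m \<noteq> 0 \<Longrightarrow> mdeg m \<le> d" using f(1) by (auto simp: bdd_def)
  define B where "B = {b. Poly_Mapping.keys b \<subseteq> {..<k} \<and> mdeg b \<le> d}"
  define N where "N = {\<nu>. is_partition \<nu> \<and> sum_list \<nu> = t}"
  have finB: "finite B" unfolding B_def by (rule finite_monoms)
  have finN: "finite N"
  proof (rule finite_subset)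
    show "N \<subseteq> {xs. set xs \<subseteq> {..t} \<and> length xs \<le> t}"
    proof
      fix \<nu> assume "\<nu> \<in> N"
      then have \<nu>: "\<forall>a\<in>set \<nu>. 1 \<le> a" "sum_list \<nu> = t" by (auto simp: N_def is_partition_def)
      have "length \<nu> \<le> sum_list \<nu>"
        using \<nu>(1) by (induction \<nu>) auto
      then show "\<nu> \<in> {xs. set xs \<subseteq> {..t} \<and> length xs \<le> t}"
        using \<nu>(2) member_le_sum_list[of _ \<nu>] by auto
    qed
  qed (rule finite_lists_length_le, simp)
  define e :: "monom \<times> nat list \<Rightarrow> qt series" where
    "e p = series_of_poly (Poly_Mapping.single (fst p) 1) * monomial_sym (snd p)" for p
  define r where "r p = inv rat_qt (scoeff f (fst p + place k (snd p)))" for p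
  have r: "rat_qt (r p) = scoeff f (fst p + place k (snd p))" for p
    unfolding r_def by (rule f_inv_into_f[OF f(3)])
  define g where "g = (\<Sum>p\<in>B \<times> N. scale_rat (r p) (e p))"
  have eQ: "e p \<in> P_as_Q" "e p \<in> VQ k" if "p \<in> B \<times> N" for p
    using that generator_in_P_as_Q[of "fst p" k "snd p"] generator_in_VQ[of "fst p" k "snd p"]
    by (auto simp: e_def B_def N_def)
  have "f - g \<in> P_as_Q"
  proof (rule Suc.IH)
    show "f - g \<in> VQ k"
      unfolding g_def by (intro VQ_diff VQ_sum VQ_scale eQ Suc.prems(1))
    fix m assume nz: "scoeff (f - g) m \<noteq> 0"
    show "mdeg (tail k m) < t"
    proof (rule ccontr)
      assume big: "\<not> mdeg (tail k m) < t"
      (* In tail degree at least t only the product with exactly this head and shape contributes. *)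
      define p0 where "p0 = (head k m, sorted_shape k m)"
      have coeff: "scoeff (e p) m = (if p = p0 then 1 else 0)" if p: "p \<in> B \<times> N" for p
      proof -
        obtain b \<nu> where bn: "p = (b, \<nu>)" by (cases p)
        have b: "Poly_Mapping.keys b \<subseteq> {..<k}" and \<nu>: "is_partition \<nu>" "sum_list \<nu> = t"
          using p by (auto simp: bn B_def N_def)
        have b0: "Poly_Mapping.lookup b j = 0" if "k \<le> j" for j
          using b that by (auto simp: keys_subset_iff)
        have "p = p0" if le: "\<forall>i. Poly_Mapping.lookup b i \<le> Poly_Mapping.lookup m i" and sh: "shape 0 (m - b) = mset \<nu>"
        proof -
          have t: "tail k (m - b) = tail k m"
            by (rule poly_mapping_eqI) (simp add: lookup_tail lookup_minus b0)
          have "mdeg (m - b) = t" using sh \<nu>(2) by (simp add: mdeg_shape sum_mset_sum_list)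
          then have "mdeg (head k (m - b)) = 0"
            using big mdeg_head_tail[of "m - b" k] by (simp add: t)
          then have h: "Poly_Mapping.lookup (head k (m - b)) i = 0" for i
            using lookup_le_mdeg[of "head k (m - b)" i] by simp
          have "b = head k m"
          proof (rule poly_mapping_eqI)
            fix i
            show "Poly_Mapping.lookup b i = Poly_Mapping.lookup (head k m) i"
              using h[of i] le[rule_format, of i] b0[of i]
              by (cases "i < k") (auto simp: lookup_head lookup_minus)
          qed
          moreover have "m - b = tail k m"
          proof -
            have "head k (m - b) = 0" by (rule poly_mapping_eqI) (simp add: h)
            then show ?thesis using head_tail[of k "m - b"] by (simp add: t)
          qed
          then have "shape k m = mset \<nu>" using sh by (simp add: shape_tail)
          then have "\<nu> = sorted_shape k m"
            by (intro partition_eqI \<nu>(1) is_partition_sorted_shape) (simp add: mset_sorted_shape)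
          ultimately show ?thesis by (simp add: bn p0_def)
        qed
        moreover have "\<forall>i. Poly_Mapping.lookup b i \<le> Poly_Mapping.lookup m i" "shape 0 (m - b) = mset \<nu>" if "p = p0"
        proof -
          have b: "b = head k m" and n: "\<nu> = sorted_shape k m" using that by (auto simp: bn p0_def)
          show "\<forall>i. Poly_Mapping.lookup b i \<le> Poly_Mapping.lookup m i" by (simp add: b lookup_head)
          have "m - b = tail k m"
            by (rule poly_mapping_eqI) (simp add: b lookup_head lookup_tail lookup_minus)
          then show "shape 0 (m - b) = mset \<nu>" by (simp add: shape_tail n mset_sorted_shape)
        qed
        ultimately have "(\<forall>i. Poly_Mapping.lookup b i \<le> Poly_Mapping.lookup m i) \<and> shape 0 (m - b) = mset \<nu> \<longleftrightarrow> p = p0"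
          by blast
        then show ?thesis
          unfolding e_def bn fst_conv snd_conv scoeff_monom_times scoeff_monomial_sym by presburger
      qed
      have "scoeff g m = (\<Sum>p\<in>B \<times> N. if p = p0 then rat_qt (r p) else 0)"
        unfolding g_def scoeff_sum by (intro sum.cong) (auto simp: scoeff_scale_rat coeff)
      also have "\<dots> = (if p0 \<in> B \<times> N then scoeff f m else 0)"
        using finB finN by (simp add: r p0_def place_same_coeff[OF f(2)])
      also have "\<dots> = scoeff f m"
      proof -
        have "p0 \<in> B \<times> N" if nzf: "scoeff f m \<noteq> 0"
        proof -
          have "mdeg (tail k m) = t" using Suc.prems(2)[OF nzf] big by simp
          then have "sum_list (sorted_shape k m) = t"
            by (metis mdeg_shape mset_sorted_shape shape_tail sum_mset_sum_list)
          moreover have "mdeg (head k m) \<le> d" using d[OF nzf] mdeg_head_tail[of m k] by simp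
          ultimately show ?thesis
            using keys_head[of k m] is_partition_sorted_shape[of k m] by (auto simp: p0_def B_def N_def)
        qed
        then show ?thesis by auto
      qed
      finally show False using nz by (simp add: minus_series.rep_eq)
    qed
  qed
  moreover have "g \<in> P_as_Q"
    unfolding g_def using eQ(1) unfolding P_as_Q_def by (intro series_Q.span_sum series_Q.span_scale) auto
  ultimately have "(f - g) + g \<in> P_as_Q"
    unfolding P_as_Q_def by (rule series_Q.span_add)
  then show ?case by simp
qed

lemma VQ_subset_P_as_Q: "VQ k \<subseteq> P_as_Q"
proof
  fix f assume f: "f \<in> VQ k"
  then obtain d where d: "\<And>m. scoeff f m \<noteq> 0 \<Longrightarrow> mdeg m \<le> d" by (auto simp: VQ_def bdd_def)
  have "mdeg (tail k m) < Suc d" if "scoeff f m \<noteq> 0" for m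
    using d[OF that] mdeg_head_tail[of m k] by simp
  then show "f \<in> P_as_Q" by (rule VQ_tail_induct[OF f])
qed

lemma P_as_Q_eq: "P_as_Q = (\<Union>k. VQ k)"
proof
  show "P_as_Q \<subseteq> (\<Union>k. VQ k)"
    unfolding P_as_Q_def
  proof (rule series_Q.span_minimal)
    show "series_Q.subspace (\<Union>k. VQ k)"
    proof (rule series_Q.subspaceI)
      fix f g assume "f \<in> (\<Union>k. VQ k)" "g \<in> (\<Union>k. VQ k)"
      then obtain k l where "f \<in> VQ k" "g \<in> VQ l" by auto
      then have "f \<in> VQ (max k l)" "g \<in> VQ (max k l)"
        using VQ_mono[of k "max k l"] VQ_mono[of l "max k l"] by auto
      then show "f + g \<in> (\<Union>k. VQ k)" using VQ_add by blast
    qed (auto intro: VQ_zero VQ_scale)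
    show "(\<lambda>(\<mu>, \<nu>). series_of_poly (mon \<mu>) * monomial_sym \<nu>) ` Sig \<subseteq> (\<Union>k. VQ k)"
    proof (clarify)
      fix \<mu> \<nu> :: "nat list"
      have "Poly_Mapping.keys (Poly_Mapping.nth \<mu>) \<subseteq> {..<length \<mu>}"
        by (rule keys_nth_subset)
      then show "series_of_poly (mon \<mu>) * monomial_sym \<nu> \<in> (\<Union>k. VQ k)"
        using generator_in_VQ unfolding mon_def by blast
    qed
  qed
qed (use VQ_subset_P_as_Q in blast)

section \<open>Almost symmetric Schur functions as limits of key polynomials\<close>

text \<open>
  The exponent vector of \<open>(\<mu>|\<nu>)\<close> in \<open>n\<close> variables; the truncated subtraction is harmless if
  \<open>length \<mu> + length \<nu> \<le> n\<close>.
\<close>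

definition alpha :: "nat list \<Rightarrow> nat list \<Rightarrow> nat \<Rightarrow> monom" where
  "alpha \<mu> \<nu> n = Poly_Mapping.nth (\<mu> @ replicate (n - length \<mu> - length \<nu>) 0 @ rev \<nu>)"

lemma keys_alpha: "length \<mu> + length \<nu> \<le> n \<Longrightarrow> Poly_Mapping.keys (alpha \<mu> \<nu> n) \<subseteq> {..<n}"
  using keys_nth_subset[of "\<mu> @ replicate (n - length \<mu> - length \<nu>) 0 @ rev \<nu>"] by (simp add: alpha_def)

lemma alpha_ascending:
  assumes "is_partition \<nu>" "length \<mu> + length \<nu> \<le> n" "length \<mu> \<le> i" "Suc i < n"
  shows "Poly_Mapping.lookup (alpha \<mu> \<nu> n) i \<le> Poly_Mapping.lookup (alpha \<mu> \<nu> n) (Suc i)"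
proof -
  let ?L = "replicate (n - length \<mu> - length \<nu>) 0 @ rev \<nu>"
  have "sorted ?L"
    using assms(1) by (auto simp: is_partition_def sorted_append sorted_wrt_rev)
  then have "?L ! (i - length \<mu>) \<le> ?L ! (Suc i - length \<mu>)"
    using assms by (intro sorted_nth_mono) auto
  moreover have "Poly_Mapping.lookup (alpha \<mu> \<nu> n) j = ?L ! (j - length \<mu>)" if "length \<mu> \<le> j" "j < n" for j
    using that assms(2) unfolding alpha_def lookup_nth
    by (subst nth_default_append) (simp add: nth_default_nth)
  ultimately show ?thesis using assms by simp
qed

lemma xi_keyp_alpha:
  assumes "is_partition \<nu>" "length \<mu> + length \<nu> \<le> n" "length \<mu> \<le> i" "Suc i < n"
  shows "xi i (keyp (alpha \<mu> \<nu> n)) = (keyp (alpha \<mu> \<nu> n) :: 'a::field mpoly)"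
  by (rule xi_keyp_le[OF alpha_ascending[OF assms]])

lemma perm_keyp_alpha:
  assumes "is_partition \<nu>" "length \<mu> + length \<nu> \<le> n" "length \<mu> \<le> i" "Suc i < n"
  shows "perm_vars (adj i) (keyp (alpha \<mu> \<nu> n)) = (keyp (alpha \<mu> \<nu> n) :: 'a::field mpoly)"
  using xi_sym[of i "keyp (alpha \<mu> \<nu> n) :: 'a mpoly"] by (simp add: xi_keyp_alpha[OF assms])

lemma xi_chain_fixed:
  assumes "xi_chain k n f g" "\<And>i. k \<le> i \<Longrightarrow> Suc i < n \<Longrightarrow> xi i f = f"
  shows "g = f"
  using assms by (induction rule: xi_chain.induct) auto

lemma keyp_polys: "Poly_Mapping.keys a \<subseteq> {..<n} \<Longrightarrow> (keyp a :: 'a::field mpoly) \<in> polys n"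
  unfolding polys_def using keyp_vars[where 'a='a] by blast

text \<open>
  Appending an entry \<open>0\<close> and moving it to the left past \<open>\<nu>\<close> leads from the exponent vector of length \<open>n\<close>
  to the one of length \<open>n + 1\<close>. The first operator on this way becomes trivial at \<open>x\<^sub>n\<^sub>+\<^sub>1 = 0\<close>, and
  the others fix the smaller key polynomial.
\<close>

lemma res_keyp_alpha_Suc:
  assumes "is_partition \<nu>" "length \<mu> + length \<nu> \<le> n"
  shows "res n (keyp (alpha \<mu> \<nu> (Suc n))) = (keyp (alpha \<mu> \<nu> n) :: 'a::field mpoly)"
proof -
  let ?z = "replicate (n - length \<mu> - length \<nu>) (0::nat)"
  have 1: "alpha \<mu> \<nu> n = Poly_Mapping.nth ((\<mu> @ ?z) @ rev \<nu> @ 0 # [])"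
    unfolding alpha_def by (rule poly_mapping_eqI) (auto simp: nth_default_def nth_append)
  have "Suc n - length \<mu> - length \<nu> = Suc (n - length \<mu> - length \<nu>)" using assms(2) by simp
  then have 2: "alpha \<mu> \<nu> (Suc n) = Poly_Mapping.nth ((\<mu> @ ?z) @ 0 # rev \<nu> @ [])"
    unfolding alpha_def by (simp add: replicate_app_Cons_same)
  have "xi_chain (length (\<mu> @ ?z)) (Suc n) (keyp (alpha \<mu> \<nu> n)) (keyp (alpha \<mu> \<nu> (Suc n)) :: 'a mpoly)"
    unfolding 1 2 using assms by (intro xi_chain_move_left) auto
  from xi_chain_res_Suc[OF this]
  have "xi_chain (length (\<mu> @ ?z)) n (keyp (alpha \<mu> \<nu> n)) (res n (keyp (alpha \<mu> \<nu> (Suc n))) :: 'a mpoly)"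
    using assms by (simp add: res_id keyp_polys keys_alpha)
  then show ?thesis
    by (rule xi_chain_fixed) (use assms in \<open>auto intro: xi_keyp_alpha\<close>)
qed

lemma res_keyp_alpha:
  assumes "is_partition \<nu>" "length \<mu> + length \<nu> \<le> n" "n \<le> n'"
  shows "res n (keyp (alpha \<mu> \<nu> n')) = (keyp (alpha \<mu> \<nu> n) :: 'a::field mpoly)"
  using assms(3)
proof (induction n' rule: dec_induct)
  case base
  show ?case using assms by (simp add: res_id keyp_polys keys_alpha)
next
  case (step m)
  then have "res n (keyp (alpha \<mu> \<nu> (Suc m)) :: 'a mpoly) = res n (res m (keyp (alpha \<mu> \<nu> (Suc m))))"
    by (simp add: res_res)
  also have "\<dots> = keyp (alpha \<mu> \<nu> n)"
    using step assms by (simp add: res_keyp_alpha_Suc)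
  finally show ?case .
qed

text \<open>
  Each coefficient is read off in a number of variables that suffices both for the monomial and for
  \<open>(\<mu>|\<nu>)\<close>; every larger number gives the same coefficient.
\<close>

definition schur_lim :: "nat list \<Rightarrow> nat list \<Rightarrow> 'a::field series" where
  "schur_lim \<mu> \<nu> = Abs_series (\<lambda>m. Poly_Mapping.lookup
     (keyp (alpha \<mu> \<nu> (length \<mu> + length \<nu> + (LEAST n. Poly_Mapping.keys m \<subseteq> {..<n})))) m)"

lemma scoeff_schur_lim:
  assumes "is_partition \<nu>" "length \<mu> + length \<nu> \<le> n" "Poly_Mapping.keys m \<subseteq> {..<n}"
  shows "scoeff (schur_lim \<mu> \<nu> :: 'a::field series) m = Poly_Mapping.lookup (keyp (alpha \<mu> \<nu> n)) m"
proof -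
  have stable: "Poly_Mapping.lookup (keyp (alpha \<mu> \<nu> n') :: 'a mpoly) m = Poly_Mapping.lookup (keyp (alpha \<mu> \<nu> l)) m"
    if "length \<mu> + length \<nu> \<le> l" "Poly_Mapping.keys m \<subseteq> {..<l}" "l \<le> n'" for l n'
    using res_keyp_alpha[OF assms(1) that(1,3), where 'a='a] that(2) by (metis lookup_res)
  define l where "l = length \<mu> + length \<nu> + (LEAST n. Poly_Mapping.keys m \<subseteq> {..<n})"
  have "Poly_Mapping.keys m \<subseteq> {..<(LEAST n. Poly_Mapping.keys m \<subseteq> {..<n})}"
    using assms(3) by (rule LeastI)
  then have l: "Poly_Mapping.keys m \<subseteq> {..<l}" "length \<mu> + length \<nu> \<le> l" by (auto simp: l_def)
  have "Poly_Mapping.lookup (keyp (alpha \<mu> \<nu> l) :: 'a mpoly) m = Poly_Mapping.lookup (keyp (alpha \<mu> \<nu> n)) m"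
    using stable[of l n] stable[of n l] l assms by (cases "l \<le> n") auto
  then show ?thesis by (simp add: schur_lim_def l_def)
qed

lemma big_enough:
  obtains n where "Poly_Mapping.keys (m::monom) \<subseteq> {..<n}" "N \<le> n"
proof -
  obtain n d where "Poly_Mapping.keys m \<subseteq> {..<n}" "\<forall>i. Poly_Mapping.lookup m i \<le> d"
    by (rule monom_bounds)
  then show ?thesis by (intro that[of "max n N"]) auto
qed

lemma mdeg_nth: "mdeg (Poly_Mapping.nth xs) = sum_list xs"
  using mdeg_sum[OF keys_nth_subset, of xs]
  by (simp add: sum_list_sum_nth nth_default_def atLeast0LessThan)

lemma mdeg_alpha: "mdeg (alpha \<mu> \<nu> n) = sum_list \<mu> + sum_list \<nu>"
  by (simp add: alpha_def mdeg_nth sum_list_rev sum_list_replicate)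

lemma schur_lim_mdeg:
  assumes "is_partition \<nu>" "scoeff (schur_lim \<mu> \<nu> :: 'a::field series) m \<noteq> 0"
  shows "mdeg m = sum_list \<mu> + sum_list \<nu>"
proof -
  obtain n where "Poly_Mapping.keys m \<subseteq> {..<n}" "length \<mu> + length \<nu> \<le> n"
    by (rule big_enough)
  then have "m \<in> Poly_Mapping.keys (keyp (alpha \<mu> \<nu> n) :: 'a mpoly)"
    using assms by (simp add: in_keys_iff scoeff_schur_lim)
  then show ?thesis using keyp_mdeg mdeg_alpha by metis
qed

lemma homogeneous_schur_lim: "is_partition \<nu> \<Longrightarrow> homogeneous (schur_lim \<mu> \<nu> :: 'a::field series)"
  unfolding homogeneous_def using schur_lim_mdeg by blast

lemma bdd_schur_lim: "is_partition \<nu> \<Longrightarrow> bdd (schur_lim \<mu> \<nu> :: 'a::field series)"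
  unfolding bdd_def using schur_lim_mdeg[of \<nu> \<mu>, where 'a='a] by (metis order_refl)

lemma sym_schur_lim:
  assumes "is_partition \<nu>"
  shows "sym_from (length \<mu>) (schur_lim \<mu> \<nu> :: 'a::field series)"
  unfolding sym_from_def
proof (intro allI impI)
  fix i and m :: monom assume i: "length \<mu> \<le> i"
  obtain n where n: "Poly_Mapping.keys m \<subseteq> {..<n}" "length \<mu> + length \<nu> + i + 2 \<le> n"
    by (rule big_enough)
  have "Poly_Mapping.keys (sw i m) \<subseteq> {..<n}"
    using n by (auto simp: keys_subset_iff lookup_sw transpose_def)
  then have "scoeff (schur_lim \<mu> \<nu> :: 'a series) (sw i m) = Poly_Mapping.lookup (perm_vars (adj i) (keyp (alpha \<mu> \<nu> n))) m"
    using assms n by (simp add: scoeff_schur_lim[of \<nu> \<mu> n] lookup_perm_adj)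
  also have "perm_vars (adj i) (keyp (alpha \<mu> \<nu> n)) = (keyp (alpha \<mu> \<nu> n) :: 'a mpoly)"
    using assms n i by (intro perm_keyp_alpha) auto
  finally show "scoeff (schur_lim \<mu> \<nu> :: 'a series) (sw i m) = scoeff (schur_lim \<mu> \<nu>) m"
    using assms n by (simp add: scoeff_schur_lim[of \<nu> \<mu> n])
qed

lemma trunc_schur_lim:
  assumes "is_partition \<nu>" "length \<mu> + length \<nu> \<le> n'" "n \<le> n'"
  shows "trunc n (schur_lim \<mu> \<nu>) = res n (keyp (alpha \<mu> \<nu> n') :: 'a::field mpoly)"
proof (rule poly_mapping_eqI)
  fix m :: monom
  have "Poly_Mapping.keys m \<subseteq> {..<n} \<Longrightarrow> Poly_Mapping.keys m \<subseteq> {..<n'}" using assms(3) by auto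
  then show "Poly_Mapping.lookup (trunc n (schur_lim \<mu> \<nu>)) m
      = Poly_Mapping.lookup (res n (keyp (alpha \<mu> \<nu> n') :: 'a mpoly)) m"
    using assms by (simp add: lookup_trunc bdd_schur_lim lookup_res scoeff_schur_lim[of \<nu> \<mu> n'])
qed

text \<open>
  The entry \<open>a\<close> is at least as large as the entries \<open>0, \<dots>, 0, \<nu>\<^sub>l, \<dots>, \<nu>\<^sub>1\<close> behind it; sorting it to the end by Demazure
  operators gives a polynomial symmetric in the last variables, so this is what \<open>W\<close> does.
\<close>

lemma W_schur_lim:
  assumes p: "is_partition (a # \<nu>)"
  shows "W (length \<mu>) (schur_lim (\<mu> @ [a]) \<nu>) = (schur_lim \<mu> (a # \<nu>) :: 'a::field series)"
proof -
  have p': "is_partition \<nu>" and a: "\<And>c. c \<in> set \<nu> \<Longrightarrow> c \<le> a" using p by (auto simp: is_partition_def)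
  let ?k = "length \<mu>"
  have "W_fin ?k n (trunc n (schur_lim (\<mu> @ [a]) \<nu>)) = trunc n (schur_lim \<mu> (a # \<nu>) :: 'a series)" if n: "?k \<le> n" for n
  proof -
    define n' where "n' = max n (Suc (?k + length \<nu>))"
    have n': "n \<le> n'" "Suc (?k + length \<nu>) \<le> n'" by (auto simp: n'_def)
    let ?z = "replicate (n' - Suc (?k + length \<nu>)) (0::nat)"
    have 1: "alpha (\<mu> @ [a]) \<nu> n' = Poly_Mapping.nth (\<mu> @ a # (?z @ rev \<nu>) @ [])"
      by (simp add: alpha_def)
    have 2: "alpha \<mu> (a # \<nu>) n' = Poly_Mapping.nth (\<mu> @ (?z @ rev \<nu>) @ a # [])"
      by (simp add: alpha_def)
    have chain: "xi_chain ?k n' (keyp (alpha (\<mu> @ [a]) \<nu> n')) (keyp (alpha \<mu> (a # \<nu>) n') :: 'a mpoly)"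
      unfolding 1 2 using n' a by (intro xi_chain_move_right) auto
    have "W_fin ?k n (res n (keyp (alpha (\<mu> @ [a]) \<nu> n'))) = res n (keyp (alpha \<mu> (a # \<nu>) n') :: 'a mpoly)"
      using n n' by (intro W_fin_res[OF n n'(1) _ _ chain] keyp_polys keys_alpha perm_keyp_alpha p) auto
    then show ?thesis
      using p p' n' by (simp add: trunc_schur_lim[of _ _ n'])
  qed
  moreover have "(schur_lim \<mu> (a # \<nu>) :: 'a series) \<in> P_as"
    unfolding P_as_def using sym_from_almost_sym[OF bdd_schur_lim sym_schur_lim, OF p p] by blast
  moreover have "g = schur_lim \<mu> (a # \<nu>)"
    if "g \<in> P_as" "\<forall>n\<ge>?k. trunc n g = trunc n (schur_lim \<mu> (a # \<nu>))" for g :: "'a series"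
    using that by (intro trunc_determines[of g _ ?k] bdd_P_as bdd_schur_lim p) auto
  ultimately show ?thesis
    unfolding W_def by (intro the_equality) auto
qed

lemma as_schur_eq: "is_partition \<nu> \<Longrightarrow> as_schur \<mu> \<nu> = (schur_lim \<mu> \<nu> :: 'a::field series)"
proof (induction \<mu> \<nu> rule: as_schur.induct)
  case (1 \<mu>)
  have nil: "is_partition []" by (simp add: is_partition_def)
  show ?case
  proof (rule series_eqI)
    fix m :: monom
    obtain n where n: "Poly_Mapping.keys m \<subseteq> {..<n}" "length \<mu> \<le> n"
      by (rule big_enough)
    have "alpha \<mu> [] n = Poly_Mapping.nth \<mu>"
      unfolding alpha_def by (rule poly_mapping_eqI) (auto simp: nth_default_def nth_append)
    then show "scoeff (as_schur \<mu> [] :: 'a series) m = scoeff (schur_lim \<mu> []) m"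
      using n nil by (simp add: scoeff_schur_lim[of "[]" \<mu> n] key_eq_keyp)
  qed
next
  case (2 \<mu> a \<nu>)
  then have "is_partition \<nu>" by (simp add: is_partition_def)
  with 2 show ?case by (simp add: W_schur_lim)
qed

lemma Ints_range_rat_qt: "x \<in> \<int> \<Longrightarrow> x \<in> range rat_qt"
proof -
  have nat: "of_nat n = rat_qt (of_nat n)" for n
    by (induction n) (simp_all add: rat_qt_simps rat_qt_0)
  have neg: "rat_qt (- c) = - rat_qt c" for c
    using rat_qt_simps(1)[of c "- c"] by (simp add: rat_qt_0 eq_neg_iff_add_eq_0 add.commute)
  have "of_int z = rat_qt (of_int z)" for z
    by (cases z rule: int_cases2) (simp_all add: nat neg)
  then show "x \<in> \<int> \<Longrightarrow> x \<in> range rat_qt" by (auto elim!: Ints_cases)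
qed

lemma schur_lim_VQ:
  assumes "is_partition \<nu>"
  shows "schur_lim \<mu> \<nu> \<in> VQ (length \<mu>)"
proof -
  have "scoeff (schur_lim \<mu> \<nu>) m \<in> range rat_qt" for m
  proof -
    obtain n where n: "Poly_Mapping.keys m \<subseteq> {..<n}" "length \<mu> + length \<nu> \<le> n"
      by (rule big_enough)
    then show ?thesis
      unfolding scoeff_schur_lim[OF assms n(2,1)] by (intro Ints_range_rat_qt keyp_Ints)
  qed
  then show ?thesis using assms by (simp add: VQ_def bdd_schur_lim sym_schur_lim)
qed


section \<open>Independence and spanning\<close>

text \<open>
  In finitely many variables and bounded degree the order of the triangularity is refined by a
  numerical rank: sum of squares first, then the size for the Bruhat order.
\<close>

definition rank_bound :: "nat \<Rightarrow> nat \<Rightarrow> nat" where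
  "rank_bound n d = Suc (Max (insert 0 (ell ` {m. Poly_Mapping.keys m \<subseteq> {..<n} \<and> mdeg m \<le> d})))"

definition rank :: "nat \<Rightarrow> nat \<Rightarrow> monom \<Rightarrow> nat" where
  "rank n d m = rank_bound n d * sqs m + ell m"

lemma ell_lt_rank_bound:
  "Poly_Mapping.keys m \<subseteq> {..<n} \<Longrightarrow> mdeg m \<le> d \<Longrightarrow> ell m < rank_bound n d"
  unfolding rank_bound_def less_Suc_eq_le by (intro Max_ge) (auto simp: finite_monoms)

lemma prec_rank:
  assumes "prec b a" "b \<noteq> a" "Poly_Mapping.keys b \<subseteq> {..<n}" "mdeg b \<le> d"
  shows "rank n d b < rank n d a"
proof (cases "sqs b < sqs a")
  case True
  have "rank n d b < rank_bound n d * Suc (sqs b)"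
    using ell_lt_rank_bound[OF assms(3,4)] by (simp add: rank_def)
  also have "\<dots> \<le> rank_bound n d * sqs a" using True by (intro mult_le_mono2) simp
  finally show ?thesis by (simp add: rank_def)
next
  case False
  then show ?thesis using assms(1,2) ell_less[of b a] by (simp add: prec_def rank_def)
qed

lemma keyp_rank:
  assumes "Poly_Mapping.lookup (keyp a :: 'a::field mpoly) b \<noteq> 0"
    "Poly_Mapping.keys a \<subseteq> {..<n}" "mdeg a \<le> d" "b \<noteq> a"
  shows "rank n d b < rank n d a"
proof -
  have b: "b \<in> Poly_Mapping.keys (keyp a :: 'a mpoly)" using assms(1) by (simp add: in_keys_iff)
  show ?thesis
    using keyp_prec[OF b] keyp_vars[OF assms(2) b] keyp_mdeg[OF b] assms(3,4) by (intro prec_rank) auto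
qed

lemma sorted_zeros_first:
  "sorted (ys :: nat list) \<Longrightarrow> ys = replicate (length (filter (\<lambda>y. y = 0) ys)) 0 @ filter (\<lambda>y. y \<noteq> 0) ys"
proof (induction ys)
  case (Cons y ys)
  show ?case
  proof (cases "y = 0")
    case True
    then show ?thesis using Cons by simp
  next
    case False
    then have "\<forall>z\<in>set (y # ys). z \<noteq> 0" using Cons.prems by auto
    then show ?thesis by (simp add: filter_empty_conv)
  qed
qed simp

text \<open>
  The ascending part consists of zeros followed by a reversed partition; zeros at the end of the first
  \<open>k\<close> entries join that block of zeros, which leaves a reduced composition.
\<close>

lemma ascending_is_alpha:
  assumes keys: "Poly_Mapping.keys m \<subseteq> {..<n}" and "k \<le> n"
    and asc: "\<And>i. k \<le> i \<Longrightarrow> Suc i < n \<Longrightarrow> Poly_Mapping.lookup m i \<le> Poly_Mapping.lookup m (Suc i)"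
  obtains \<mu> \<nu> where "(\<mu>, \<nu>) \<in> Sig" "length \<mu> \<le> k" "length \<mu> + length \<nu> \<le> n" "alpha \<mu> \<nu> n = m"
proof -
  define ys where "ys = map (Poly_Mapping.lookup m) [k..<n]"
  define \<nu> where "\<nu> = rev (filter (\<lambda>y. y \<noteq> 0) ys)"
  have "sorted ys"
    unfolding sorted_iff_nth_Suc ys_def using asc by simp
  obtain \<mu> where \<mu>: "reduced \<mu>" "Poly_Mapping.nth \<mu> = head k m" "length \<mu> \<le> k"
    by (rule reduced_list_ex[OF keys_head])
  have len: "length \<nu> \<le> n - k"
    using length_filter_le[of "\<lambda>y. y \<noteq> 0" ys] by (simp add: \<nu>_def ys_def)
  have "is_partition \<nu>"
    using sorted_wrt_filter[OF \<open>sorted ys\<close>] by (auto simp: is_partition_def \<nu>_def sorted_wrt_rev)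
  moreover have "alpha \<mu> \<nu> n = m"
  proof -
    have ys: "ys = replicate (n - k - length \<nu>) 0 @ rev \<nu>"
    proof -
      have "length (filter (\<lambda>y. y = 0) ys) = n - k - length \<nu>"
        using sum_length_filter_compl[of "\<lambda>y. y = 0" ys] by (simp add: \<nu>_def ys_def)
      then show ?thesis using sorted_zeros_first[OF \<open>sorted ys\<close>] by (simp add: \<nu>_def)
    qed
    have "n - length \<mu> - length \<nu> = (k - length \<mu>) + (n - k - length \<nu>)"
      using \<mu>(3) len \<open>k \<le> n\<close> by simp
    then have xs: "\<mu> @ replicate (n - length \<mu> - length \<nu>) 0 @ rev \<nu> = (\<mu> @ replicate (k - length \<mu>) 0) @ ys"
      by (simp add: ys replicate_add)
    have head: "(\<mu> @ replicate (k - length \<mu>) 0) ! i = Poly_Mapping.lookup m i" if "i < k" for i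
    proof -
      have "nth_default 0 \<mu> i = Poly_Mapping.lookup (head k m) i" using \<mu>(2) by (metis lookup_nth)
      then show ?thesis using that by (auto simp: lookup_head nth_default_def nth_append split: if_splits)
    qed
    show ?thesis
    proof (rule poly_mapping_eqI)
      fix i
      have l: "length (\<mu> @ replicate (k - length \<mu>) 0) = k" using \<mu>(3) by simp
      have "Poly_Mapping.lookup (alpha \<mu> \<nu> n) i
          = (if i < k then (\<mu> @ replicate (k - length \<mu>) 0) ! i else nth_default 0 ys (i - k))"
        unfolding alpha_def xs lookup_nth by (subst nth_default_append) (simp only: l)
      also have "\<dots> = Poly_Mapping.lookup m i"
        using head[of i] keys by (auto simp: ys_def nth_default_def keys_subset_iff)
      finally show "Poly_Mapping.lookup (alpha \<mu> \<nu> n) i = Poly_Mapping.lookup m i" .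
    qed
  qed
  ultimately show ?thesis
    using \<mu> len \<open>k \<le> n\<close> by (intro that[of \<mu> \<nu>]) (auto simp: Sig_def)
qed

text \<open>
  An element of \<open>VQ k\<close> of degree at most \<open>d\<close> is determined by its coefficients in \<open>k + d\<close> variables. There
  its exponents of largest rank ascend behind the first \<open>k\<close> entries: otherwise a swap, under
  which the coefficients are invariant, would raise the rank.
\<close>

lemma VQ_rank_induct:
  assumes "f \<in> VQ k" "\<And>m. scoeff f m \<noteq> 0 \<Longrightarrow> mdeg m \<le> d"
    and "\<And>m. Poly_Mapping.keys m \<subseteq> {..<k + d} \<Longrightarrow> scoeff f m \<noteq> 0 \<Longrightarrow> rank (k + d) d m < t"
  shows "f \<in> series_Q.span ((\<lambda>(\<mu>, \<nu>). schur_lim \<mu> \<nu>) ` Sig)"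
  using assms
proof (induction t arbitrary: f)
  case 0
  have "scoeff f m = 0" for m
  proof (rule ccontr)
    assume nz: "scoeff f m \<noteq> 0"
    (* At most d exponents outside the head are nonzero, so the monomial can be moved into k + d variables. *)
    define m' where "m' = head k m + place k (sorted_shape k m)"
    have "scoeff f m' \<noteq> 0"
      using nz place_same_coeff[of k f m] 0(1) by (simp add: m'_def VQ_def)
    moreover have "Poly_Mapping.keys m' \<subseteq> {..<k + d}"
    proof -
      have "length (sorted_shape k m) = size (shape k m)"
        by (metis mset_sorted_shape size_mset)
      also have "\<dots> = card (Poly_Mapping.keys m \<inter> {k..})" by (simp add: shape_def)
      also have "\<dots> \<le> card (Poly_Mapping.keys m)" by (intro card_mono) auto
      also have "\<dots> \<le> d" using card_keys_le_mdeg[of m] 0(2)[OF nz] by simp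
      finally show ?thesis
        using keys_place[of k "sorted_shape k m"] keys_head[of k m]
        by (auto simp: m'_def keys_subset_iff lookup_add)
    qed
    ultimately show False using 0(3) by blast
  qed
  then have "f = 0" by (intro series_eqI) (simp add: zero_series.rep_eq)
  then show ?case by (simp add: series_Q.span_zero)
next
  case (Suc t)
  let ?n = "k + d" and ?S = "series_Q.span ((\<lambda>(\<mu>, \<nu>). schur_lim \<mu> \<nu>) ` Sig)"
  have f: "sym_from k f" "\<And>m. scoeff f m \<in> range rat_qt" using Suc.prems(1) by (auto simp: VQ_def)
  (* Several exponent vectors may share the largest rank; all of them are removed at once. *)
  define T where "T = {m. Poly_Mapping.keys m \<subseteq> {..<?n} \<and> scoeff f m \<noteq> 0 \<and> rank ?n d m = t}"
  have finT: "finite T"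
    by (rule finite_subset[OF _ finite_monoms[of ?n d]]) (auto simp: T_def Suc.prems(2))
  have "\<exists>p. p \<in> Sig \<and> length (fst p) \<le> k \<and> length (fst p) + length (snd p) \<le> ?n \<and> alpha (fst p) (snd p) ?n = m"
    if m: "m \<in> T" for m
  proof (rule ascending_is_alpha[of m ?n k])
    show "Poly_Mapping.keys m \<subseteq> {..<?n}" using m by (simp add: T_def)
    fix i assume i: "k \<le> i" "Suc i < ?n"
    show "Poly_Mapping.lookup m i \<le> Poly_Mapping.lookup m (Suc i)"
    proof (rule ccontr)
      assume desc: "\<not> ?thesis"
      have keys: "Poly_Mapping.keys (sw i m) \<subseteq> {..<?n}"
        using m i by (auto simp: T_def keys_subset_iff lookup_sw transpose_def)
      have nz: "scoeff f (sw i m) \<noteq> 0"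
        using m i f(1) by (simp add: T_def sym_from_def)
      have "bruhat_le m (sw i m)"
        using bruhat_sw[of "sw i m" i] desc by simp
      then have "prec m (sw i m)" by (simp add: prec_def sqs_sw)
      then have "t < rank ?n d (sw i m)"
        using prec_rank[of m "sw i m" ?n d] m desc sw_neq[of m i] Suc.prems(2)[of m] by (auto simp: T_def)
      then show False using Suc.prems(3)[OF keys nz] by simp
    qed
  qed auto
  then obtain P where P: "\<And>m. m \<in> T \<Longrightarrow> P m \<in> Sig \<and> length (fst (P m)) \<le> k
      \<and> length (fst (P m)) + length (snd (P m)) \<le> ?n \<and> alpha (fst (P m)) (snd (P m)) ?n = m"
    by metis
  define s :: "monom \<Rightarrow> qt series" where "s m = schur_lim (fst (P m)) (snd (P m))" for m
  have part: "is_partition (snd (P m))" if "m \<in> T" for m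
    using P[OF that] by (auto simp: Sig_def)
  have s_coeff: "scoeff (s a) m = Poly_Mapping.lookup (keyp a) m" if "a \<in> T" "Poly_Mapping.keys m \<subseteq> {..<?n}" for a m
    using P[OF that(1)] part[OF that(1)] that(2) by (simp add: s_def scoeff_schur_lim[of _ _ ?n])
  have s_span: "s m \<in> ?S" if "m \<in> T" for m
    using P[OF that] by (intro series_Q.span_base image_eqI[of _ _ "P m"]) (auto simp: s_def case_prod_beta)
  have s_VQ: "s m \<in> VQ k" if "m \<in> T" for m
    using schur_lim_VQ[OF part[OF that]] VQ_mono P[OF that] unfolding s_def by blast
  have s_deg: "mdeg m = mdeg a" if "a \<in> T" "scoeff (s a) m \<noteq> 0" for a m
    using schur_lim_mdeg[OF part[OF that(1)]] that(2) P[OF that(1)] mdeg_alpha unfolding s_def by metis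
  have T_deg: "mdeg a \<le> d" if "a \<in> T" for a using that Suc.prems(2) by (auto simp: T_def)
  define r where "r m = inv rat_qt (scoeff f m)" for m
  have r: "rat_qt (r m) = scoeff f m" for m
    unfolding r_def by (rule f_inv_into_f[OF f(2)])
  define g where "g = (\<Sum>a\<in>T. scale_rat (r a) (s a))"
  have g_coeff: "scoeff g m = (\<Sum>a\<in>T. scoeff f a * scoeff (s a) m)" for m
    by (simp add: g_def scoeff_sum scoeff_scale_rat r)
  have "f - g \<in> ?S"
  proof (rule Suc.IH)
    show "f - g \<in> VQ k"
      unfolding g_def by (intro VQ_diff VQ_sum VQ_scale s_VQ Suc.prems(1))
    show "mdeg m \<le> d" if nz: "scoeff (f - g) m \<noteq> 0" for m
    proof (cases "scoeff f m = 0")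
      case True
      then have "scoeff g m \<noteq> 0" using nz by (simp add: minus_series.rep_eq)
      then obtain a where a: "a \<in> T" "scoeff f a * scoeff (s a) m \<noteq> 0"
        unfolding g_coeff by (rule sum.not_neutral_contains_not_neutral)
      then show ?thesis using s_deg[of a m] T_deg[of a] by auto
    qed (rule Suc.prems(2))
    show "rank ?n d m < t" if keys: "Poly_Mapping.keys m \<subseteq> {..<?n}" and nz: "scoeff (f - g) m \<noteq> 0" for m
    proof (rule ccontr)
      assume big: "\<not> rank ?n d m < t"
      have "scoeff (s a) m = (if a = m then 1 else 0)" if a: "a \<in> T" for a
      proof (cases "a = m")
        case True
        then show ?thesis using a keys by (simp add: s_coeff keyp_lead)
      next
        case False
        then have "Poly_Mapping.lookup (keyp a :: qt mpoly) m = 0"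
          using keyp_rank[of a m ?n d] T_deg[OF a] a big by (auto simp: T_def)
        then show ?thesis using False a keys by (simp add: s_coeff)
      qed
      then have "scoeff g m = (\<Sum>a\<in>T. if a = m then scoeff f a else 0)"
        unfolding g_coeff by (intro sum.cong) auto
      also have "\<dots> = (if m \<in> T then scoeff f m else 0)" using finT by simp
      also have "\<dots> = scoeff f m"
      proof (cases "scoeff f m = 0")
        case False
        then have "m \<in> T" using Suc.prems(3)[OF keys False] big keys by (simp add: T_def)
        then show ?thesis by simp
      qed simp
      finally show False using nz by (simp add: minus_series.rep_eq)
    qed
  qed
  moreover have "g \<in> ?S"
    unfolding g_def by (intro series_Q.span_sum series_Q.span_scale s_span)
  ultimately have "(f - g) + g \<in> ?S" by (rule series_Q.span_add)
  then show ?case by simp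
qed

lemma span_schur_lim: "series_Q.span ((\<lambda>(\<mu>, \<nu>). schur_lim \<mu> \<nu>) ` Sig) = P_as_Q"
proof
  show "series_Q.span ((\<lambda>(\<mu>, \<nu>). schur_lim \<mu> \<nu>) ` Sig) \<subseteq> P_as_Q"
  proof (rule series_Q.span_minimal)
    show "(\<lambda>(\<mu>, \<nu>). schur_lim \<mu> \<nu>) ` Sig \<subseteq> P_as_Q"
      unfolding P_as_Q_eq using schur_lim_VQ by (force simp: Sig_def)
  qed (simp add: P_as_Q_def series_Q.subspace_span)
  show "P_as_Q \<subseteq> series_Q.span ((\<lambda>(\<mu>, \<nu>). schur_lim \<mu> \<nu>) ` Sig)"
  proof
    fix f assume "f \<in> P_as_Q"
    then obtain k where f: "f \<in> VQ k" unfolding P_as_Q_eq by blast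
    then obtain d where d: "\<And>m. scoeff f m \<noteq> 0 \<Longrightarrow> mdeg m \<le> d" by (auto simp: VQ_def bdd_def)
    define E where "E = {m. Poly_Mapping.keys m \<subseteq> {..<k + d} \<and> mdeg m \<le> d}"
    show "f \<in> series_Q.span ((\<lambda>(\<mu>, \<nu>). schur_lim \<mu> \<nu>) ` Sig)"
    proof (rule VQ_rank_induct[OF f d])
      show "rank (k + d) d m < Suc (Max (insert 0 (rank (k + d) d ` E)))"
        if "Poly_Mapping.keys m \<subseteq> {..<k + d}" "scoeff f m \<noteq> 0" for m
        unfolding less_Suc_eq_le
        using that d[of m] by (intro Max_ge) (auto simp: E_def finite_monoms)
    qed
  qed
qed

text \<open>At least one zero between \<open>\<mu>\<close> and \<open>\<nu>\<close> makes the two parts of the exponent vector recognisable.\<close>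

lemma alpha_inj:
  assumes "(\<mu>, \<nu>) \<in> Sig" "(\<mu>', \<nu>') \<in> Sig"
    and len: "length \<mu> + length \<nu> < n" "length \<mu>' + length \<nu>' < n"
    and eq: "alpha \<mu> \<nu> n = alpha \<mu>' \<nu>' n"
  shows "\<mu> = \<mu>' \<and> \<nu> = \<nu>'"
proof -
  have len_le: "length \<nu>2 \<le> length \<nu>1"
    if "(\<mu>1, \<nu>1) \<in> Sig" "(\<mu>2, \<nu>2) \<in> Sig" "length \<mu>1 + length \<nu>1 < n" "length \<mu>2 + length \<nu>2 < n"
      "alpha \<mu>1 \<nu>1 n = alpha \<mu>2 \<nu>2 n" for \<mu>1 \<nu>1 \<mu>2 \<nu>2
  proof (rule ccontr)
    assume lt: "\<not> ?thesis"
    define i where "i = n - Suc (length \<nu>1)"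
    have "Poly_Mapping.lookup (alpha \<mu>1 \<nu>1 n) i = 0"
      using that(3) by (auto simp: alpha_def i_def nth_default_def nth_append)
    moreover have "Poly_Mapping.lookup (alpha \<mu>2 \<nu>2 n) i = rev \<nu>2 ! (i - (n - length \<nu>2))"
      using that(4) lt by (auto simp: alpha_def i_def nth_default_def nth_append)
    moreover have "rev \<nu>2 ! (i - (n - length \<nu>2)) \<in> set (rev \<nu>2)"
      using that(4) lt by (intro nth_mem) (auto simp: i_def)
    ultimately show False using that(2,5) by (auto simp: Sig_def is_partition_def)
  qed
  have l: "length \<nu> = length \<nu>'"
    using len_le[OF assms(1,2) len eq] len_le[OF assms(2,1) len(2,1) eq[symmetric]] by simp
  have xs: "\<mu> @ replicate (n - length \<mu> - length \<nu>) 0 @ rev \<nu> = \<mu>' @ replicate (n - length \<mu>' - length \<nu>') 0 @ rev \<nu>'"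
  proof (rule nth_equalityI)
    fix i assume "i < length (\<mu> @ replicate (n - length \<mu> - length \<nu>) 0 @ rev \<nu>)"
    then have "i < n" using len by simp
    then show "(\<mu> @ replicate (n - length \<mu> - length \<nu>) 0 @ rev \<nu>) ! i = (\<mu>' @ replicate (n - length \<mu>' - length \<nu>') 0 @ rev \<nu>') ! i"
      using arg_cong[OF eq, of "\<lambda>m. Poly_Mapping.lookup m i"] len
      unfolding alpha_def lookup_nth by (simp add: nth_default_nth)
  qed (use len in simp)
  then have "rev \<nu> = rev \<nu>'" and h: "\<mu> @ replicate (n - length \<mu> - length \<nu>) 0 = \<mu>' @ replicate (n - length \<mu>' - length \<nu>') 0"
    using l append_eq_append_conv[of "rev \<nu>" "rev \<nu>'" "\<mu> @ replicate (n - length \<mu> - length \<nu>) 0"] by (simp_all flip: append_assoc)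
  moreover have "\<mu> = \<mu>'"
  proof -
    have "strip_while ((=) 0) \<mu>1 = \<mu>1" if "reduced \<mu>1" for \<mu>1 :: "nat list"
      using that unfolding strip_while_idem_iff no_trailing_unfold reduced_def by auto
    moreover have "strip_while ((=) 0) (\<mu>1 @ replicate z 0) = strip_while ((=) 0) \<mu>1" for \<mu>1 :: "nat list" and z
      by (induction z) (simp_all add: replicate_append_same[symmetric] flip: append_assoc)
    ultimately show ?thesis using assms(1,2) h by (auto simp: Sig_def) (metis)
  qed
  ultimately show ?thesis by simp
qed

text \<open>
  In a vanishing combination the leading exponent of largest rank occurs in no other term.
\<close>

lemma schur_lim_independent_family:
  assumes t: "finite t" "t \<subseteq> Sig" and zero: "(\<Sum>p\<in>t. scale_rat (u p) (case p of (\<mu>, \<nu>) \<Rightarrow> schur_lim \<mu> \<nu>)) = 0"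
    and "p \<in> t"
  shows "u p = 0"
proof (rule ccontr)
  assume "u p \<noteq> 0"
  define S where "S = {p \<in> t. u p \<noteq> 0}"
  have S: "finite S" "p \<in> S" using t(1) \<open>p \<in> t\<close> \<open>u p \<noteq> 0\<close> by (auto simp: S_def)
  (* The successor provides the zero that alpha_inj needs. *)
  define n where "n = Suc (\<Sum>p\<in>t. length (fst p) + length (snd p))"
  define d where "d = (\<Sum>p\<in>t. sum_list (fst p) + sum_list (snd p))"
  define al where "al q = alpha (fst q) (snd q) n" for q
  have n: "length (fst q) + length (snd q) < n" if "q \<in> t" for q
    unfolding n_def less_Suc_eq_le by (rule member_le_sum[OF that _ t(1)]) simp
  have d: "mdeg (al q) \<le> d" if "q \<in> t" for q
    unfolding d_def al_def mdeg_alpha by (rule member_le_sum[OF that _ t(1)]) simp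
  have keys: "Poly_Mapping.keys (al q) \<subseteq> {..<n}" if "q \<in> t" for q
    unfolding al_def using n[OF that] by (intro keys_alpha) simp
  define M where "M = Max (rank n d ` al ` S)"
  have "M \<in> rank n d ` al ` S" unfolding M_def using S by (intro Max_in) auto
  then obtain q where q: "q \<in> S" "rank n d (al q) = M" by auto
  then have qt: "q \<in> t" by (simp add: S_def)
  have coeff: "rat_qt (u q') * scoeff (case q' of (\<mu>, \<nu>) \<Rightarrow> schur_lim \<mu> \<nu>) (al q) = (if q' = q then rat_qt (u q) else 0)"
    if q': "q' \<in> t" for q'
  proof -
    obtain \<mu> \<nu> where mn: "q' = (\<mu>, \<nu>)" by (cases q')
    have part: "is_partition \<nu>" using q' t(2) by (auto simp: mn Sig_def)
    have c: "scoeff (case q' of (\<mu>, \<nu>) \<Rightarrow> schur_lim \<mu> \<nu>) (al q) = Poly_Mapping.lookup (keyp (al q') :: qt mpoly) (al q)"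
      using scoeff_schur_lim[OF part _ keys[OF qt], of \<mu>] n[OF q'] by (simp add: mn al_def)
    show ?thesis
    proof (cases "q' = q")
      case True
      then show ?thesis using c by (simp add: keyp_lead)
    next
      case False
      show ?thesis
      proof (cases "u q' = 0")
        case True
        then show ?thesis using False by (simp add: rat_qt_0)
      next
        case nz: False
        have "al q \<noteq> al q'"
        proof
          assume "al q = al q'"
          moreover have "(fst q, snd q) \<in> Sig" "(fst q', snd q') \<in> Sig" using qt q' t(2) by auto
          ultimately have "fst q = fst q' \<and> snd q = snd q'"
            using n[OF qt] n[OF q'] by (intro alpha_inj[of _ _ _ _ n]) (auto simp: al_def)
          then show False using False by (simp add: prod_eq_iff)
        qed
        moreover have "rank n d (al q') \<le> M"
          unfolding M_def using nz q' S(1) by (intro Max_ge) (auto simp: S_def)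
        ultimately have "Poly_Mapping.lookup (keyp (al q') :: qt mpoly) (al q) = 0"
          using keyp_rank[OF _ keys[OF q'] d[OF q'], of "al q", where 'a=qt] q(2) by (metis leD)
        then show ?thesis using False by (simp add: c)
      qed
    qed
  qed
  have "(\<Sum>q'\<in>t. if q' = q then rat_qt (u q) else 0) = scoeff (\<Sum>p\<in>t. scale_rat (u p) (case p of (\<mu>, \<nu>) \<Rightarrow> schur_lim \<mu> \<nu>)) (al q)"
    unfolding scoeff_sum scoeff_scale_rat by (rule sum.cong) (simp_all only: coeff)
  then have "rat_qt (u q) = 0" using qt t(1) by (simp add: zero zero_series.rep_eq)
  then have "u q = 0" by (simp add: rat_qt_def)
  then show False using q(1) by (simp add: S_def)
qed

lemma inj_schur_lim: "inj_on (\<lambda>(\<mu>, \<nu>). schur_lim \<mu> \<nu> :: qt series) Sig"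
proof (rule inj_onI)
  fix p q assume p: "p \<in> Sig" "q \<in> Sig" and eq: "((case p of (\<mu>, \<nu>) \<Rightarrow> schur_lim \<mu> \<nu>) :: qt series) = (case q of (\<mu>, \<nu>) \<Rightarrow> schur_lim \<mu> \<nu>)"
  show "p = q"
  proof (rule ccontr)
    assume ne: "p \<noteq> q"
    define u where "u r = (if r = p then 1 else - 1 :: rat)" for r
    have "(\<Sum>r\<in>{p, q}. scale_rat (u r) (case r of (\<mu>, \<nu>) \<Rightarrow> schur_lim \<mu> \<nu>)) = 0"
      using ne by (simp add: u_def eq)
    then have "u p = 0"
      using p by (intro schur_lim_independent_family[of "{p, q}" u p]) auto
    then show False by (simp add: u_def)
  qed
qed

lemma independent_schur_lim: "series_Q.independent ((\<lambda>(\<mu>, \<nu>). schur_lim \<mu> \<nu>) ` Sig)"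
proof
  let ?s = "\<lambda>(\<mu>, \<nu>). schur_lim \<mu> \<nu> :: qt series"
  assume "series_Q.dependent (?s ` Sig)"
  then obtain t u v where t: "finite t" "t \<subseteq> ?s ` Sig" "(\<Sum>v\<in>t. scale_rat (u v) v) = 0" "v \<in> t" "u v \<noteq> 0"
    unfolding series_Q.dependent_explicit by blast
  obtain T where T: "T \<subseteq> Sig" "finite T" "t = ?s ` T"
    using finite_subset_image[OF t(1,2)] by blast
  have "inj_on ?s T" using inj_schur_lim T(1) by (rule inj_on_subset)
  then have "(\<Sum>p\<in>T. scale_rat (u (?s p)) (?s p)) = 0"
    using t(3) by (simp add: T(3) sum.reindex)
  moreover obtain p where p: "p \<in> T" "v = ?s p" using t(4) T(3) by blast
  ultimately have "u (?s p) = 0"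
    by (intro schur_lim_independent_family[OF T(2,1), of "\<lambda>p. u (?s p)" p])
  then show False using p t(5) by simp
qed

theorem corollary4p4:
  shows "(\<forall>(\<mu>, \<nu>)\<in>Sig. homogeneous (as_schur \<mu> \<nu> :: qt series))
    \<and> inj_on (\<lambda>(\<mu>, \<nu>). as_schur \<mu> \<nu> :: qt series) Sig
    \<and> series_Q.independent ((\<lambda>(\<mu>, \<nu>). as_schur \<mu> \<nu>) ` Sig)
    \<and> series_Q.span ((\<lambda>(\<mu>, \<nu>). as_schur \<mu> \<nu>) ` Sig) = P_as_Q"
proof -
  have eq: "((case p of (\<mu>, \<nu>) \<Rightarrow> as_schur \<mu> \<nu>) :: qt series) = (case p of (\<mu>, \<nu>) \<Rightarrow> schur_lim \<mu> \<nu>)"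
    if "p \<in> Sig" for p
    using that by (auto simp: Sig_def as_schur_eq)
  have img: "(\<lambda>(\<mu>, \<nu>). as_schur \<mu> \<nu>) ` Sig = (\<lambda>(\<mu>, \<nu>). schur_lim \<mu> \<nu> :: qt series) ` Sig"
    by (rule image_cong[OF refl eq])
  have "\<forall>(\<mu>, \<nu>)\<in>Sig. homogeneous (as_schur \<mu> \<nu> :: qt series)"
    by (auto simp: Sig_def as_schur_eq homogeneous_schur_lim)
  moreover have "inj_on (\<lambda>(\<mu>, \<nu>). as_schur \<mu> \<nu> :: qt series) Sig"
    by (rule iffD2[OF inj_on_cong[OF eq] inj_schur_lim])
  ultimately show ?thesis
    unfolding img using independent_schur_lim span_schur_lim by (intro conjI)
qed

end
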